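(* For a Banach space $E$ the following properties are equivalent: (a) $E$ contains no copies of $\ell_1$ (no closed subspace of $E$ is isomorphic to $\ell_1$). (b) $\mathcal{P}_{wcc}(^kE,F)\subseteq\mathcal{P}_{wco}(^kE,F)$ for any positive integer $k$ and any Banach space $F$. (c) $\mathcal{P}_{cc}(^kE,F)\subseteq\mathcal{P}_{wco}(^kE,F)$ for any positive integer $k$ and any Banach space $F$. (d) $\mathcal{P}_{cc}(^kE,F)\subseteq\mathcal{P}_{wco}(^kE,F)$ for some nonreflexive Banach space $F$ and some integer $k>1$.
   Context: Banach spaces are real or complex ($E$ and $F$ over the same field). $\mathcal{P}(^kE,F)$ is the space of continuous $k$-homogeneous polynomials from $E$ to $F$. $\mathcal{P}_{wcc}(^kE,F)$ (weakly completely continuous): those $P\in\mathcal{P}(^kE,F)$ taking weakly Cauchy sequences into weakly convergent sequences. $\mathcal{P}_{cc}(^kE,F)$ (completely continuous): those $P\in\mathcal{P}(^kE,F)$ taking weakly Cauchy sequences into norm convergent sequences. $\mathcal{P}_{wco}(^kE,F)$ (weakly compact): those $P\in\mathcal{P}(^kE,F)$ taking bounded subsets into relatively weakly compact subsets. *)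

theory Defs
  imports "HOL-Analysis.Analysis"
begin

section \<open>The scalar field\<close>

text \<open>The types of this class are, up to isometric isomorphism, exactly \<^typ>\<open>real\<close> and
  \<^typ>\<open>complex\<close>, so a statement over it covers real and complex Banach spaces at once.\<close>

class real_or_complex = real_normed_field +
  assumes real_or_complex:
    "(\<forall>x. \<exists>a. x = a *\<^sub>R 1) \<or>
     (\<exists>i. i * i = -1 \<and> (\<forall>x. \<exists>a b. x = a *\<^sub>R 1 + b *\<^sub>R i) \<and>
          (\<forall>a b. norm (a *\<^sub>R 1 + b *\<^sub>R i) = sqrt (a\<^sup>2 + b\<^sup>2)))"

instance real :: real_or_complex
  by standard simp

instance complex :: real_or_complex
proof
  have "x = Re x *\<^sub>R 1 + Im x *\<^sub>R \<i>" for x :: complex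
    by (simp add: complex_eq_iff)
  then have "\<exists>a b. x = a *\<^sub>R 1 + b *\<^sub>R \<i>" for x :: complex
    by blast
  moreover have "norm (a *\<^sub>R 1 + b *\<^sub>R \<i>) = sqrt (a\<^sup>2 + b\<^sup>2)" for a b :: real
    by (simp add: cmod_def)
  ultimately show "(\<forall>x::complex. \<exists>a. x = a *\<^sub>R 1) \<or>
     (\<exists>i::complex. i * i = -1 \<and> (\<forall>x. \<exists>a b. x = a *\<^sub>R 1 + b *\<^sub>R i) \<and>
          (\<forall>a b. norm (a *\<^sub>R 1 + b *\<^sub>R i) = sqrt (a\<^sup>2 + b\<^sup>2)))"
    by (intro disjI2 exI[of _ \<i>]) simp
qed


section \<open>Banach spaces with an explicit carrier\<close>

text \<open>The statement quantifies over Banach spaces inside a formula, which type classes do not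
  allow; hence spaces are records. What the operations do outside the carrier is irrelevant.
  A quantifier over all spaces of type \<open>('k, 'b) nspace\<close> ranges over the spaces carried by a subset
  of \<open>'b\<close>; as \<open>'b\<close> is a free type variable, no space is excluded. It must however not be too small:
  if its cardinality is below the continuum then it carries only the space \<open>{0}\<close>.\<close>

record ('k, 'a) nspace =
  vcarrier :: "'a set"
  vadd :: "'a \<Rightarrow> 'a \<Rightarrow> 'a"
  vzero :: 'a
  vscale :: "'k \<Rightarrow> 'a \<Rightarrow> 'a"
  vnorm :: "'a \<Rightarrow> real"

locale normed_space =
  fixes V :: "('k::real_or_complex, 'a) nspace"
  assumes zero_closed: "vzero V \<in> vcarrier V"
    and add_closed: "\<lbrakk>x \<in> vcarrier V; y \<in> vcarrier V\<rbrakk> \<Longrightarrow> vadd V x y \<in> vcarrier V"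
    and scale_closed: "x \<in> vcarrier V \<Longrightarrow> vscale V c x \<in> vcarrier V"
    and add_assoc: "\<lbrakk>x \<in> vcarrier V; y \<in> vcarrier V; z \<in> vcarrier V\<rbrakk>
          \<Longrightarrow> vadd V (vadd V x y) z = vadd V x (vadd V y z)"
    and add_commute: "\<lbrakk>x \<in> vcarrier V; y \<in> vcarrier V\<rbrakk> \<Longrightarrow> vadd V x y = vadd V y x"
    and add_zero: "x \<in> vcarrier V \<Longrightarrow> vadd V x (vzero V) = x"
    and add_inverse: "x \<in> vcarrier V \<Longrightarrow> \<exists>y\<in>vcarrier V. vadd V x y = vzero V"
    and scale_add_right: "\<lbrakk>x \<in> vcarrier V; y \<in> vcarrier V\<rbrakk>
          \<Longrightarrow> vscale V c (vadd V x y) = vadd V (vscale V c x) (vscale V c y)"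
    and scale_add_left: "x \<in> vcarrier V
          \<Longrightarrow> vscale V (c + d) x = vadd V (vscale V c x) (vscale V d x)"
    and scale_scale: "x \<in> vcarrier V \<Longrightarrow> vscale V c (vscale V d x) = vscale V (c * d) x"
    and scale_one: "x \<in> vcarrier V \<Longrightarrow> vscale V 1 x = x"
    and norm_eq_zero: "x \<in> vcarrier V \<Longrightarrow> vnorm V x = 0 \<longleftrightarrow> x = vzero V"
    and norm_scale: "x \<in> vcarrier V \<Longrightarrow> vnorm V (vscale V c x) = norm c * vnorm V x"
    and norm_triangle: "\<lbrakk>x \<in> vcarrier V; y \<in> vcarrier V\<rbrakk>
          \<Longrightarrow> vnorm V (vadd V x y) \<le> vnorm V x + vnorm V y"

text \<open>\<^locale>\<open>Metric_space\<close> asks for symmetry and nonnegativity on the whole type, whence the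
  case distinction.\<close>

definition vdist :: "('k::real_or_complex, 'a) nspace \<Rightarrow> 'a \<Rightarrow> 'a \<Rightarrow> real" where
  "vdist V x y =
     (if x \<in> vcarrier V \<and> y \<in> vcarrier V then vnorm V (vadd V x (vscale V (-1) y)) else 0)"

definition norm_topology :: "('k::real_or_complex, 'a) nspace \<Rightarrow> 'a topology" where
  "norm_topology V = Metric_space.mtopology (vcarrier V) (vdist V)"

locale banach_space = normed_space +
  assumes complete: "Metric_space.mcomplete (vcarrier V) (vdist V)"

context normed_space
begin

lemma scale_zero_left: "x \<in> vcarrier V \<Longrightarrow> vscale V 0 x = vzero V"
  using norm_eq_zero[of "vscale V 0 x"] norm_scale[of x 0] scale_closed[of x 0] by simp

lemma add_minus: "x \<in> vcarrier V \<Longrightarrow> vadd V x (vscale V (-1) x) = vzero V"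
  using scale_add_left[of x 1 "-1"] by (simp add: scale_one scale_zero_left)

lemma norm_nonneg: assumes "x \<in> vcarrier V" shows "0 \<le> vnorm V x"
proof -
  have "vnorm V (vadd V x (vscale V (-1) x)) = 0"
    using assms add_minus norm_eq_zero zero_closed by auto
  then show ?thesis
    using norm_triangle[OF assms scale_closed[OF assms, of "-1"]] norm_scale[OF assms, of "-1"]
    by simp
qed

lemma minus_minus: assumes "x \<in> vcarrier V" "y \<in> vcarrier V"
  shows "vscale V (-1) (vadd V x (vscale V (-1) y)) = vadd V y (vscale V (-1) x)"
  using assms by (simp add: scale_add_right scale_scale scale_one scale_closed add_commute)

lemma Metric_space_vdist: "Metric_space (vcarrier V) (vdist V)"
proof
  show "0 \<le> vdist V x y" for x y
    by (simp add: vdist_def norm_nonneg add_closed scale_closed)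
  show "vdist V x y = vdist V y x" for x y
    using norm_scale[of "vadd V x (vscale V (-1) y)" "-1"]
    by (auto simp: vdist_def minus_minus add_closed scale_closed)
  have cancel: "vadd V (vadd V x (vscale V (-1) y)) (vadd V y z) = vadd V x z"
    if "x \<in> vcarrier V" "y \<in> vcarrier V" "z \<in> vcarrier V" for x y z
  proof -
    have "vadd V (vadd V x (vscale V (-1) y)) (vadd V y z)
        = vadd V x (vadd V (vadd V (vscale V (-1) y) y) z)"
      using that by (simp add: add_assoc add_closed scale_closed)
    also have "vadd V (vscale V (-1) y) y = vzero V"
      using that add_minus add_commute scale_closed by metis
    also have "vadd V (vzero V) z = z"
      using that add_zero add_commute zero_closed by metis
    finally show ?thesis .
  qed
  show "vdist V x z \<le> vdist V x y + vdist V y z"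
    if "x \<in> vcarrier V" "y \<in> vcarrier V" "z \<in> vcarrier V" for x y z
    using that cancel[of x y "vscale V (-1) z"]
      norm_triangle[of "vadd V x (vscale V (-1) y)" "vadd V y (vscale V (-1) z)"]
    by (simp add: vdist_def add_closed scale_closed)
  show "vdist V x y = 0 \<longleftrightarrow> x = y" if xy: "x \<in> vcarrier V" "y \<in> vcarrier V" for x y
  proof
    assume "vdist V x y = 0"
    then have "vadd V x (vscale V (-1) y) = vzero V"
      using xy by (simp add: vdist_def norm_eq_zero add_closed scale_closed)
    then have "vadd V (vzero V) (vadd V y (vzero V)) = vadd V x (vzero V)"
      using cancel[of x y "vzero V"] xy zero_closed by simp
    then show "x = y"
      using xy by (metis add_zero add_commute zero_closed)
  next
    assume "x = y"
    then show "vdist V x y = 0"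
      using xy by (simp add: vdist_def add_minus norm_eq_zero zero_closed)
  qed
qed

end


section \<open>Linear maps, duals and the weak topology\<close>

definition linear_between ::
  "('k::real_or_complex, 'a) nspace \<Rightarrow> ('k, 'b) nspace \<Rightarrow> ('a \<Rightarrow> 'b) \<Rightarrow> bool" where
  "linear_between V W T \<longleftrightarrow>
     (\<forall>x\<in>vcarrier V. T x \<in> vcarrier W) \<and>
     (\<forall>x\<in>vcarrier V. \<forall>y\<in>vcarrier V. T (vadd V x y) = vadd W (T x) (T y)) \<and>
     (\<forall>c. \<forall>x\<in>vcarrier V. T (vscale V c x) = vscale W c (T x))"

definition scalar_space :: "('k::real_or_complex, 'k) nspace" where
  "scalar_space = \<lparr>vcarrier = UNIV, vadd = (+), vzero = 0, vscale = (*), vnorm = norm\<rparr>"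

text \<open>Functionals are extensional functions, so that distinct elements of the dual are distinct
  as functionals; the norm is the operator norm.\<close>

definition dual_space :: "('k::real_or_complex, 'a) nspace \<Rightarrow> ('k, 'a \<Rightarrow> 'k) nspace" where
  "dual_space V =
     \<lparr>vcarrier = {f \<in> extensional (vcarrier V).
                    linear_between V scalar_space f \<and>
                    continuous_map (norm_topology V) euclidean f},
      vadd = (\<lambda>f g. \<lambda>x\<in>vcarrier V. f x + g x),
      vzero = (\<lambda>x\<in>vcarrier V. 0),
      vscale = (\<lambda>c f. \<lambda>x\<in>vcarrier V. c * f x),
      vnorm = (\<lambda>f. SUP x\<in>{x \<in> vcarrier V. vnorm V x \<le> 1}. norm (f x))\<rparr>"

definition reflexive :: "('k::real_or_complex, 'a) nspace \<Rightarrow> bool" where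
  "reflexive V \<longleftrightarrow>
     (\<lambda>x. \<lambda>f\<in>vcarrier (dual_space V). f x) ` vcarrier V
       = vcarrier (dual_space (dual_space V))"

definition weak_topology :: "('k::real_or_complex, 'a) nspace \<Rightarrow> 'a topology" where
  "weak_topology V = topology_generated_by
     {{x \<in> vcarrier V. f x \<in> U} | f U. f \<in> vcarrier (dual_space V) \<and> open U}"

definition weakly_Cauchy :: "('k::real_or_complex, 'a) nspace \<Rightarrow> (nat \<Rightarrow> 'a) \<Rightarrow> bool" where
  "weakly_Cauchy V s \<longleftrightarrow>
     range s \<subseteq> vcarrier V \<and> (\<forall>f\<in>vcarrier (dual_space V). Cauchy (\<lambda>n. f (s n)))"

definition norm_bounded :: "('k::real_or_complex, 'a) nspace \<Rightarrow> 'a set \<Rightarrow> bool" where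
  "norm_bounded V A \<longleftrightarrow> A \<subseteq> vcarrier V \<and> (\<exists>M. \<forall>x\<in>A. vnorm V x \<le> M)"

definition relatively_weakly_compact :: "('k::real_or_complex, 'a) nspace \<Rightarrow> 'a set \<Rightarrow> bool" where
  "relatively_weakly_compact V A \<longleftrightarrow>
     A \<subseteq> vcarrier V \<and> compactin (weak_topology V) (weak_topology V closure_of A)"


section \<open>Copies of the sequence space of absolutely summable sequences\<close>

definition l1_space :: "('k::real_or_complex, nat \<Rightarrow> 'k) nspace" where
  "l1_space =
     \<lparr>vcarrier = {a. summable (\<lambda>n. norm (a n))},
      vadd = (\<lambda>a b n. a n + b n),
      vzero = (\<lambda>n. 0),
      vscale = (\<lambda>c a n. c * a n),
      vnorm = (\<lambda>a. \<Sum>n. norm (a n))\<rparr>"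

definition closed_subspace :: "('k::real_or_complex, 'a) nspace \<Rightarrow> 'a set \<Rightarrow> bool" where
  "closed_subspace V M \<longleftrightarrow>
     M \<subseteq> vcarrier V \<and> vzero V \<in> M \<and>
     (\<forall>x\<in>M. \<forall>y\<in>M. vadd V x y \<in> M) \<and> (\<forall>c. \<forall>x\<in>M. vscale V c x \<in> M) \<and>
     closedin (norm_topology V) M"

definition isomorphic_nspace ::
  "('k::real_or_complex, 'a) nspace \<Rightarrow> ('k, 'b) nspace \<Rightarrow> bool" where
  "isomorphic_nspace V W \<longleftrightarrow>
     (\<exists>T. linear_between V W T \<and> homeomorphic_map (norm_topology V) (norm_topology W) T)"

definition contains_copy_of_l1 :: "('k::real_or_complex, 'a) nspace \<Rightarrow> bool" where
  "contains_copy_of_l1 E \<longleftrightarrow>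
     (\<exists>M. closed_subspace E M \<and>
          isomorphic_nspace (E\<lparr>vcarrier := M\<rparr>) (l1_space :: ('k, nat \<Rightarrow> 'k) nspace))"


section \<open>Homogeneous polynomials\<close>

definition multilinear_map ::
  "nat \<Rightarrow> ('k::real_or_complex, 'a) nspace \<Rightarrow> ('k, 'b) nspace \<Rightarrow> ((nat \<Rightarrow> 'a) \<Rightarrow> 'b) \<Rightarrow> bool" where
  "multilinear_map k E F A \<longleftrightarrow>
     (\<forall>x \<in> {..<k} \<rightarrow>\<^sub>E vcarrier E. \<forall>i<k.
        linear_between E F (\<lambda>u. A (x(i := u))))"

definition polynomials ::
  "nat \<Rightarrow> ('k::real_or_complex, 'a) nspace \<Rightarrow> ('k, 'b) nspace \<Rightarrow> ('a \<Rightarrow> 'b) set" where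
  "polynomials k E F =
     {P \<in> extensional (vcarrier E).
        (\<exists>A. multilinear_map k E F A \<and> (\<forall>x\<in>vcarrier E. P x = A (\<lambda>i\<in>{..<k}. x))) \<and>
        continuous_map (norm_topology E) (norm_topology F) P}"

definition P_wcc ::
  "nat \<Rightarrow> ('k::real_or_complex, 'a) nspace \<Rightarrow> ('k, 'b) nspace \<Rightarrow> ('a \<Rightarrow> 'b) set" where
  "P_wcc k E F =
     {P \<in> polynomials k E F.
        \<forall>s. weakly_Cauchy E s \<longrightarrow> (\<exists>l. limitin (weak_topology F) (P \<circ> s) l sequentially)}"

definition P_cc ::
  "nat \<Rightarrow> ('k::real_or_complex, 'a) nspace \<Rightarrow> ('k, 'b) nspace \<Rightarrow> ('a \<Rightarrow> 'b) set" where
  "P_cc k E F =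
     {P \<in> polynomials k E F.
        \<forall>s. weakly_Cauchy E s \<longrightarrow> (\<exists>l. limitin (norm_topology F) (P \<circ> s) l sequentially)}"

definition P_wco ::
  "nat \<Rightarrow> ('k::real_or_complex, 'a) nspace \<Rightarrow> ('k, 'b) nspace \<Rightarrow> ('a \<Rightarrow> 'b) set" where
  "P_wco k E F =
     {P \<in> polynomials k E F.
        \<forall>B. norm_bounded E B \<longrightarrow> relatively_weakly_compact F (P ` B)}"

end

theory Submission
  imports Defs "HOL-Library.Diagonal_Subsequence"
begin

text \<open>Let \<open>P\<close> be a weakly completely continuous polynomial on a space without copies of \<open>\<ell>\<^sub>1\<close>. By
Rosenthal's theorem (\<open>Rosenthal\<close>) every bounded sequence has a weakly Cauchy subsequence, whose image
under \<open>P\<close> converges weakly; so every sequence in the image of a bounded set has a weakly convergent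
subsequence, and Eberlein's theorem (\<open>Eberlein\<close>) makes the image relatively weakly compact. Since
norm convergence implies weak convergence, completely continuous polynomials are covered as well, and
(d) becomes an instance of (c) once some nonreflexive space is at hand: \<open>\<ell>\<^sub>1\<close> itself, carried over to
the type of \<open>F\<close> (\<open>ex_nonreflexive\<close>).

For the converse, let \<open>E\<close> contain a copy of \<open>\<ell>\<^sub>1\<close> with basis \<open>x\<^sub>n\<close>, let \<open>F\<close> be nonreflexive and \<open>k \<ge> 2\<close>.
There are functionals \<open>\<phi>\<^sub>n\<close> on \<open>E\<close> with \<open>\<phi>\<^sub>n x\<^sub>m = \<delta>\<^sub>n\<^sub>m\<close> such that \<open>z \<mapsto> (\<phi>\<^sub>n z)\<^sub>n\<close> is a bounded operator to
\<open>\<ell>\<^sub>2\<close> which maps weakly Cauchy sequences to norm Cauchy ones (\<open>l1_copy_operator\<close>). They are Rademacher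
coefficients: by the Hahn-Banach theorem every choice \<open>S\<close> of signs is the restriction to the \<open>x\<^sub>n\<close> of a
functional \<open>g\<^sub>S\<close>, these functionals being uniformly bounded, and \<open>\<phi>\<^sub>n z\<close> is the mean over \<open>S\<close> of the
\<open>n\<close>-th sign times \<open>g\<^sub>S z\<close>. Bessel's inequality bounds \<open>\<Sum>\<^sub>n |\<phi>\<^sub>n z|\<^sup>2\<close> by the mean of \<open>|g\<^sub>S z|\<^sup>2\<close>, and this
mean tends to \<open>0\<close> along bounded weakly null sequences, by a form of the dominated convergence theorem
for finitely additive measures (\<open>weakly_null_mean_small\<close>). As \<open>F\<close> is not reflexive, its unit ball
contains, up to scaling, a sequence \<open>y\<^sub>n\<close> without weak cluster points (\<open>nonreflexive_sequence\<close>). Because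
\<open>k \<ge> 2\<close>, the series \<open>P z = \<Sum>\<^sub>n (\<phi>\<^sub>n z)\<^sup>k y\<^sub>n\<close> converges absolutely; \<open>P\<close> is a completely continuous polynomial
and \<open>P x\<^sub>n = y\<^sub>n\<close>, so it is not weakly compact (\<open>P_cc_not_subset_P_wco\<close>).

Three tools are used throughout. Limits along one fixed free ultrafilter on the natural numbers replace
weak* cluster points of functionals and define the mean over signs. Galvin's lemma on families of finite
sets of natural numbers yields the independent sequences in Rosenthal's theorem. Finally, elements of
a bidual that can be approximated on finitely many functionals by elements of a bounded set \<open>A\<close> are
either evaluations or give rise to a sequence in \<open>A\<close> without weak cluster points
(\<open>unrepresented_imp_no_cluster_sequence\<close>, after James); this is behind both Eberlein's theorem and
the sequence \<open>y\<^sub>n\<close>.\<close>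

section \<open>Galvin's lemma\<close>

text \<open>The forcing relation of Nash-Williams: whatever infinite part of \<open>M\<close> continues \<open>s\<close>, the family \<open>F\<close> is
hit by an initial segment. The initial segments of \<open>X\<close> are the sets \<open>X \<inter> {..<n}\<close>, so that \<open>X\<close> never
has to be enumerated.\<close>

definition accepts :: "nat set set \<Rightarrow> nat set \<Rightarrow> nat set \<Rightarrow> bool" where
  "accepts F M s \<longleftrightarrow>
     (\<forall>X. infinite X \<and> X \<subseteq> M \<and> (\<forall>x\<in>X. \<forall>y\<in>s. y < x) \<longrightarrow> (\<exists>n. (s \<union> X) \<inter> {..<n} \<in> F))"

definition rejects :: "nat set set \<Rightarrow> nat set \<Rightarrow> nat set \<Rightarrow> bool" where
  "rejects F M s \<longleftrightarrow> (\<forall>N. infinite N \<and> N \<subseteq> M \<longrightarrow> \<not> accepts F N s)"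

lemma rejects_mono: "rejects F M s \<Longrightarrow> N \<subseteq> M \<Longrightarrow> rejects F N s"
  unfolding rejects_def by blast

lemma accepts_member:
  assumes "finite s" "s \<in> F"
  shows "accepts F M s"
  unfolding accepts_def
proof (intro allI impI, elim conjE)
  fix X assume above: "\<forall>x\<in>X. \<forall>y\<in>s. y < x"
  show "\<exists>n. (s \<union> X) \<inter> {..<n} \<in> F"
  proof (cases "s = {}")
    case True
    then show ?thesis using assms by (intro exI[of _ 0]) simp
  next
    case False
    have "(s \<union> X) \<inter> {..<Suc (Max s)} = s"
    proof
      show "s \<subseteq> (s \<union> X) \<inter> {..<Suc (Max s)}" using assms by (auto simp: less_Suc_eq_le)
      have "x \<in> s" if "x \<in> X" "x \<le> Max s" for x
        using above that Max_in[OF assms(1) False] by (meson leD)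
      then show "(s \<union> X) \<inter> {..<Suc (Max s)} \<subseteq> s" by (auto simp: less_Suc_eq_le)
    qed
    then show ?thesis using assms by metis
  qed
qed

lemma infinite_above:
  fixes M s :: "nat set"
  assumes "infinite M" "finite s"
  shows "infinite (M \<inter> {x. \<forall>y\<in>s. y < x})"
proof
  assume fin: "finite (M \<inter> {x. \<forall>y\<in>s. y < x})"
  have "M \<subseteq> (M \<inter> {x. \<forall>y\<in>s. y < x}) \<union> (\<Union>y\<in>s. {..y})" by (auto simp: not_less)
  moreover have "finite (\<Union>y\<in>s. {..y})" using assms by auto
  ultimately show False using assms fin finite_subset by blast
qed

text \<open>Suppose that inside every infinite part of \<open>M\<close> some \<open>insert m s\<close> is accepted by an infinite set. Then one
can choose successively points \<open>m\<^sub>n\<close> and decreasing sets \<open>N\<^sub>n\<close> beyond them, with \<open>m\<^sub>n\<^sub>+\<^sub>1\<close> in \<open>N\<^sub>n\<close>, such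
that \<open>N\<^sub>n\<close> accepts \<open>insert m\<^sub>n s\<close>. The set of the \<open>m\<^sub>n\<close> would accept \<open>s\<close>: a continuation of \<open>s\<close> by some of
them has a first element \<open>m\<^sub>n\<close>, and its other elements lie in \<open>N\<^sub>n\<close>.\<close>

lemma rejects_insert:
  assumes M: "infinite M" and s: "finite s" and rej: "rejects F M s"
  shows "\<exists>M'\<subseteq>M. infinite M' \<and> (\<forall>m\<in>M'. rejects F M' (insert m s))"
proof (rule ccontr)
  assume "\<not> ?thesis"
  then have H: "\<exists>m\<in>M'. \<exists>N\<subseteq>M'. infinite N \<and> accepts F N (insert m s)" if "M' \<subseteq> M" "infinite M'" for M'
    using that unfolding rejects_def by blast
  define ab where "ab = {x. \<forall>y\<in>s. y < x}"
  have step: "\<exists>m\<in>M'. \<exists>N\<subseteq>M'. infinite N \<and> accepts F N (insert m s) \<and> (\<forall>x\<in>N. m < x)"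
    if "M' \<subseteq> M \<inter> ab" and inf: "infinite M'" for M'
  proof -
    have "M' \<subseteq> M" using that(1) by simp
    from H[OF this inf] obtain m N where mN: "m \<in> M'" "N \<subseteq> M'" "infinite N" "accepts F N (insert m s)"
      by (elim bexE exE conjE)
    define N' where "N' = N \<inter> {x. \<forall>y\<in>{m}. y < x}"
    have "infinite N'" unfolding N'_def by (rule infinite_above[OF mN(3)]) simp
    moreover have "accepts F N' (insert m s)"
      using mN(4) unfolding accepts_def N'_def by blast
    moreover have "N' \<subseteq> M'" "\<forall>x\<in>N'. m < x" using mN(2) unfolding N'_def by auto
    ultimately show ?thesis using mN(1) by blast
  qed
  define P where "P = (\<lambda>(n::nat) (m, N). N \<subseteq> M \<inter> ab \<and> m \<in> M \<inter> ab \<and> infinite N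
      \<and> accepts F N (insert m s) \<and> (\<forall>x\<in>N. m < x))"
  have "\<exists>f. \<forall>n. P n (f n) \<and> (fst (f (Suc n)) \<in> snd (f n) \<and> snd (f (Suc n)) \<subseteq> snd (f n))"
  proof (rule dependent_nat_choice)
    have "infinite (M \<inter> ab)" using infinite_above[OF M s] unfolding ab_def .
    then obtain m N where "m \<in> M \<inter> ab" "N \<subseteq> M \<inter> ab" "infinite N" "accepts F N (insert m s)" "\<forall>x\<in>N. m < x"
      using step[of "M \<inter> ab"] by blast
    then show "\<exists>x. P 0 x" unfolding P_def by (intro exI[of _ "(m,N)"]) simp
  next
    fix x n assume P: "P n x"
    obtain m N where x: "x = (m,N)" by fastforce
    with P have N: "N \<subseteq> M \<inter> ab" "infinite N" unfolding P_def by auto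
    from step[OF N] obtain m' N' where "m' \<in> N" "N' \<subseteq> N" "infinite N'"
      "accepts F N' (insert m' s)" "\<forall>x\<in>N'. m' < x" by blast
    then show "\<exists>y. P (Suc n) y \<and> fst y \<in> snd x \<and> snd y \<subseteq> snd x"
      using N unfolding P_def x by (intro exI[of _ "(m',N')"]) auto
  qed
  then obtain f where Pf: "\<And>n. P n (f n)"
    and Qf: "\<And>n. fst (f (Suc n)) \<in> snd (f n)" "\<And>n. snd (f (Suc n)) \<subseteq> snd (f n)" by blast
  define m where "m = fst \<circ> f"
  define N where "N = snd \<circ> f"
  have mN: "N n \<subseteq> M \<inter> ab" "m n \<in> M \<inter> ab" "accepts F (N n) (insert (m n) s)" "\<And>x. x \<in> N n \<Longrightarrow> m n < x" for n
    using Pf[of n] unfolding P_def m_def N_def by (auto simp: case_prod_unfold)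
  have mS: "m (Suc n) \<in> N n" for n using Qf unfolding m_def N_def by simp
  have Ndec: "N k \<subseteq> N n" if "n \<le> k" for n k
    using lift_Suc_antimono_le[of N n k] Qf(2) that unfolding N_def by simp
  have mono: "strict_mono m" using mN(4)[OF mS] by (simp add: strict_mono_Suc_iff)
  have later: "m k \<in> N n" if nk: "n < k" for n k
  proof -
    obtain l where "k = Suc l" "n \<le> l" using nk by (cases k) auto
    then show ?thesis using mS[of l] Ndec[of n l] by auto
  qed
  have "accepts F (range m) s"
    unfolding accepts_def
  proof (intro allI impI, elim conjE)
    fix X assume X: "infinite X" "X \<subseteq> range m" "\<forall>x\<in>X. \<forall>y\<in>s. y < x"
    define x where "x = (LEAST x. x \<in> X)"
    have "X \<noteq> {}" using X by auto
    then have x: "x \<in> X" "\<And>y. y \<in> X \<Longrightarrow> x \<le> y"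
      unfolding x_def by (auto intro: LeastI Least_le)
    obtain n where n: "x = m n" using x X by auto
    have sub: "X - {x} \<subseteq> N n"
    proof
      fix y assume y: "y \<in> X - {x}"
      then obtain k where k: "y = m k" using X by auto
      have "x < y" using x y by (simp add: order_less_le)
      then have "n < k" using k n mono by (simp add: strict_mono_less)
      then show "y \<in> N n" using later k by simp
    qed
    have "infinite (X - {x})" using X by simp
    moreover have "\<forall>z\<in>X - {x}. \<forall>y\<in>insert (m n) s. y < z" using X sub mN(4) by blast
    ultimately obtain j where "(insert (m n) s \<union> (X - {x})) \<inter> {..<j} \<in> F"
      using mN(3)[of n] sub unfolding accepts_def by blast
    moreover have "insert (m n) s \<union> (X - {x}) = s \<union> X" using x n by auto
    ultimately show "\<exists>j. (s \<union> X) \<inter> {..<j} \<in> F" by auto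
  qed
  moreover have "infinite (range m)" using mono by (simp add: range_inj_infinite strict_mono_imp_inj_on)
  moreover have "range m \<subseteq> M" using mN(2) by auto
  ultimately show False using rej unfolding rejects_def by blast
qed

lemma rejects_insert_finite:
  assumes "finite S" "infinite M" "\<forall>s\<in>S. finite s \<and> rejects F M s"
  shows "\<exists>M'\<subseteq>M. infinite M' \<and> (\<forall>s\<in>S. \<forall>m\<in>M'. rejects F M' (insert m s))"
  using assms
proof (induction S)
  case empty
  then show ?case by auto
next
  case (insert s S)
  then obtain M1 where M1: "M1 \<subseteq> M" "infinite M1" "\<forall>s\<in>S. \<forall>m\<in>M1. rejects F M1 (insert m s)"
    by auto
  have "rejects F M1 s" "finite s" using insert.prems M1(1) by (auto intro: rejects_mono)
  from rejects_insert[OF M1(2) this(2,1)]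
  obtain M2 where M2: "M2 \<subseteq> M1" "infinite M2" "\<forall>m\<in>M2. rejects F M2 (insert m s)"
    by (elim exE conjE)
  have "rejects F M2 (insert m t)" if "t \<in> S" "m \<in> M2" for t m
  proof (rule rejects_mono[OF _ M2(1)])
    show "rejects F M1 (insert m t)" using that M1(3) M2(1) by blast
  qed
  then have "\<forall>t\<in>insert s S. \<forall>m\<in>M2. rejects F M2 (insert m t)" using M2(3) by simp
  moreover have "M2 \<subseteq> M" using M1(1) M2(1) by simp
  ultimately show ?case using M2(2) by blast
qed

text \<open>If the empty set is rejected, rejection is propagated from the subsets of the finitely many points chosen
so far to the subsets containing one more point. The chosen points form an infinite set all of whose
finite subsets are rejected by some infinite set, and a member of \<open>F\<close> is never rejected.\<close>

theorem Galvin: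
  fixes F :: "nat set set"
  obtains M where "infinite M" "\<And>X. X \<subseteq> M \<Longrightarrow> infinite X \<Longrightarrow> \<exists>n. X \<inter> {..<n} \<in> F"
  | N where "infinite N" "\<And>s. s \<subseteq> N \<Longrightarrow> finite s \<Longrightarrow> s \<notin> F"
proof (cases "rejects F UNIV {}")
  case False
  then obtain M where "infinite M" "accepts F M {}" unfolding rejects_def by blast
  then show thesis using that(1)[of M] unfolding accepts_def by auto
next
  case True
  define P where "P = (\<lambda>(n::nat) (T, M). finite T \<and> card T = n \<and> infinite M \<and> (\<forall>t\<in>Pow T. rejects F M t)
      \<and> (\<forall>x\<in>M. \<forall>y\<in>T. y < x))"
  have "\<exists>f. \<forall>n. P n (f n) \<and> (fst (f n) \<subseteq> fst (f (Suc n)))"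
  proof (rule dependent_nat_choice)
    show "\<exists>x. P 0 x" using True unfolding P_def by (intro exI[of _ "({}, UNIV)"]) simp
  next
    fix x n assume P: "P n x"
    obtain T M where x: "x = (T,M)" by fastforce
    with P have TM: "finite T" "card T = n" "infinite M" "\<And>t. t \<subseteq> T \<Longrightarrow> rejects F M t" "\<forall>x\<in>M. \<forall>y\<in>T. y < x"
      unfolding P_def by auto
    have "\<forall>s\<in>Pow T. finite s \<and> rejects F M s" using TM by (auto intro: finite_subset)
    from rejects_insert_finite[OF _ TM(3) this] TM(1)
    obtain M' where M': "M' \<subseteq> M" "infinite M'" "\<forall>s\<in>Pow T. \<forall>m\<in>M'. rejects F M' (insert m s)" by auto
    obtain m where m: "m \<in> M'" using M'(2) by fastforce
    define M'' where "M'' = M' \<inter> {x. \<forall>y\<in>{m}. y < x}"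
    have "infinite M''" unfolding M''_def by (rule infinite_above[OF M'(2)]) simp
    moreover have "\<forall>t\<in>Pow (insert m T). rejects F M'' t"
    proof
      fix t assume t: "t \<in> Pow (insert m T)"
      show "rejects F M'' t"
      proof (cases "m \<in> t")
        case True
        then have "t = insert m (t - {m})" "t - {m} \<in> Pow T" using t by auto
        then show ?thesis using M'(3) m rejects_mono[of F M' t M''] unfolding M''_def by (metis inf_le1)
      next
        case False
        then have "t \<subseteq> T" using t by auto
        then show ?thesis using TM(4) M'(1) rejects_mono unfolding M''_def by (metis inf.coboundedI1)
      qed
    qed
    moreover have "m \<notin> T" using TM(5) M'(1) m by blast
    ultimately show "\<exists>y. P (Suc n) y \<and> fst x \<subseteq> fst y"
      using TM M' unfolding P_def x
      by (intro exI[of _ "(insert m T, M'')"]) (auto simp: M''_def)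
  qed
  then obtain f where Pf: "\<And>n. P n (f n)" and Qf: "\<And>n. fst (f n) \<subseteq> fst (f (Suc n))" by blast
  define T where "T = fst \<circ> f"
  have T: "finite (T n)" "card (T n) = n" "\<And>t. t \<subseteq> T n \<Longrightarrow> \<exists>M. infinite M \<and> rejects F M t" for n
    using Pf[of n] unfolding P_def T_def by (auto simp: case_prod_unfold)
  have Tmono: "incseq T" using Qf unfolding T_def by (intro incseq_SucI) simp
  show thesis
  proof (rule that(2)[of "\<Union>n. T n"])
    show "infinite (\<Union>n. T n)"
    proof
      assume fin: "finite (\<Union>n. T n)"
      have "card (T (Suc (card (\<Union>n. T n)))) \<le> card (\<Union>n. T n)" by (rule card_mono[OF fin]) auto
      then show False using T(2) by simp
    qed
    fix s assume s: "s \<subseteq> (\<Union>n. T n)" "finite s"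
    have "\<exists>n. s \<subseteq> T n" using s(2,1)
    proof (induction s)
      case (insert x s)
      then obtain n k where "s \<subseteq> T n" "x \<in> T k" by auto
      then have "insert x s \<subseteq> T (max n k)" using incseqD[OF Tmono, of n "max n k"] incseqD[OF Tmono, of k "max n k"] by auto
      then show ?case by blast
    qed simp
    then obtain M where "infinite M" "rejects F M s" using T(3) by blast
    then show "s \<notin> F" using accepts_member[OF s(2)] unfolding rejects_def by blast
  qed
qed

section \<open>Independent pairs\<close>

text \<open>Farahat's route to Rosenthal's dichotomy: Galvin's lemma is applied to the finite sets along which no
point lies alternately in \<open>A\<close> and \<open>B\<close>. A point that is infinitely often in \<open>A\<close> and infinitely often in
\<open>B\<close> follows some infinite set in this alternating way; this gives the first case. If every finite
subset of \<open>N\<close> is followed by a point, then every second element of \<open>N\<close> can be used freely, because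
the element before it may be inserted or left out to adjust the parity.\<close>

lemma convergent_or_independent_pairs:
  fixes A B :: "nat \<Rightarrow> 'c set"
  obtains r :: "nat \<Rightarrow> nat" where "strict_mono r" "\<And>t. finite {n. t \<in> A (r n)} \<or> finite {n. t \<in> B (r n)}"
  | r :: "nat \<Rightarrow> nat" where "strict_mono r" "\<And>\<epsilon> n. \<exists>t. \<forall>i<n. t \<in> (if \<epsilon> i then A (r i) else B (r i))"
proof -
  define cell where "cell s = (\<Inter>x\<in>s. if even (card (s \<inter> {..<x})) then A x else B x)" for s :: "nat set"
  show thesis
  proof (rule Galvin[of "{s. cell s = {}}"])
    fix M assume M: "infinite M" "\<And>X. X \<subseteq> M \<Longrightarrow> infinite X \<Longrightarrow> \<exists>n. X \<inter> {..<n} \<in> {s. cell s = {}}"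
    show thesis
    proof (rule that(1)[of "enumerate M"])
      show "strict_mono (enumerate M)" using M(1) by (simp add: strict_mono_enumerate)
      fix t
      show "finite {n. t \<in> A (enumerate M n)} \<or> finite {n. t \<in> B (enumerate M n)}"
      proof (rule ccontr)
        assume "\<not> ?thesis"
        then have inf: "infinite {n. t \<in> A (enumerate M n)}" "infinite {n. t \<in> B (enumerate M n)}" by auto
        define C where "C k = (if even k then A else B)" for k :: nat
        have nxt: "\<exists>n>m. t \<in> C k (enumerate M n)" for k m
          using inf unfolding C_def infinite_nat_iff_unbounded by auto
        have "\<exists>g. \<forall>k. t \<in> C k (enumerate M (g k)) \<and> (g k < g (Suc k))"
          by (rule dependent_nat_choice) (use nxt in blast)+
        then obtain g where g: "\<And>k. t \<in> C k (enumerate M (g k))" "strict_mono g"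
          by (auto simp: strict_mono_Suc_iff)
        define h where "h = enumerate M \<circ> g"
        have h: "strict_mono h" unfolding h_def using M(1) g(2) by (intro strict_mono_o strict_mono_enumerate)
        have card: "card (range h \<inter> {..<h k}) = k" for k
        proof -
          have "range h \<inter> {..<h k} = h ` {..<k}" using h by (auto simp: strict_mono_less)
          then show ?thesis using h by (simp add: card_image strict_mono_imp_inj_on inj_on_subset)
        qed
        have "range h \<subseteq> M" unfolding h_def using M(1) by (auto intro: enumerate_in_set)
        moreover have "infinite (range h)" using h by (simp add: range_inj_infinite strict_mono_imp_inj_on)
        ultimately obtain n where n: "cell (range h \<inter> {..<n}) = {}" using M(2) by blast
        have "t \<in> cell (range h \<inter> {..<n})"
          unfolding cell_def
        proof (intro INT_I)
          fix x assume x: "x \<in> range h \<inter> {..<n}"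
          then obtain k where k: "x = h k" by auto
          have "range h \<inter> {..<n} \<inter> {..<x} = range h \<inter> {..<h k}" using x k by auto
          then have "card (range h \<inter> {..<n} \<inter> {..<x}) = k" using card by simp
          then show "t \<in> (if even (card (range h \<inter> {..<n} \<inter> {..<x})) then A x else B x)"
            using g(1)[of k] k unfolding C_def h_def by (auto split: if_splits)
        qed
        then show False using n by simp
      qed
    qed
  next
    fix N assume N: "infinite N" "\<And>s. s \<subseteq> N \<Longrightarrow> finite s \<Longrightarrow> s \<notin> {s. cell s = {}}"
    define m where "m = enumerate N"
    have m: "strict_mono m" "\<And>i. m i \<in> N" unfolding m_def using N(1) by (auto simp: strict_mono_enumerate enumerate_in_set)
    show thesis
    proof (rule that(2)[of "\<lambda>i. m (2 * i + 1)"])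
      show "strict_mono (\<lambda>i. m (2 * i + 1))" using m(1) by (simp add: strict_mono_def)
      fix \<epsilon> :: "nat \<Rightarrow> bool" and n
      have "\<exists>s. s \<subseteq> m ` {..<2*n} \<and> (\<forall>i<n. m (2*i+1) \<in> s \<and> (even (card (s \<inter> {..<m (2*i+1)})) \<longleftrightarrow> \<epsilon> i))"
      proof (induction n)
        case (Suc n)
        then obtain s where s: "s \<subseteq> m ` {..<2*n}"
          "\<And>i. i < n \<Longrightarrow> m (2*i+1) \<in> s \<and> (even (card (s \<inter> {..<m (2*i+1)})) \<longleftrightarrow> \<epsilon> i)" by blast
        have fin: "finite s" using s(1) by (auto intro: finite_subset)
        \<comment> \<open>the element \<open>m (2*n)\<close> only serves to correct the parity\<close>
        define s' where "s' = (if even (card s) \<longleftrightarrow> \<epsilon> n then s else insert (m (2*n)) s)"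
        have lt: "x < m (2*n)" if "x \<in> s" for x using that s(1) m(1) by (auto simp: strict_mono_less)
        have lt': "m (2*n) < m (2*n+1)" using m(1) by (simp add: strict_mono_less)
        have par: "even (card s') \<longleftrightarrow> \<epsilon> n"
          using fin lt unfolding s'_def by (auto simp: card_insert_if)
        have s'sub: "s' \<subseteq> m ` {..<2 * Suc n}"
          using s(1) unfolding s'_def by (auto split: if_splits)
        have below: "insert (m (2*n+1)) s' \<inter> {..<m (2*n+1)} = s'"
        proof -
          have "x < m (2*n+1)" if "x \<in> s" for x using lt[OF that] lt' by simp
          then show ?thesis using lt' unfolding s'_def by (auto split: if_splits)
        qed
        have same: "insert (m (2*n+1)) s' \<inter> {..<m (2*i+1)} = s \<inter> {..<m (2*i+1)}" if "i < n" for i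
          using that m(1) unfolding s'_def by (auto simp: strict_mono_less)
        show ?case
        proof (intro exI[of _ "insert (m (2*n+1)) s'"] conjI allI impI)
          show "insert (m (2*n+1)) s' \<subseteq> m ` {..<2 * Suc n}" using s'sub by auto
          fix i assume i: "i < Suc n"
          show "m (2*i+1) \<in> insert (m (2*n+1)) s'"
            using i s(2)[of i] by (cases "i = n") (auto simp: s'_def)
          show "even (card (insert (m (2*n+1)) s' \<inter> {..<m (2*i+1)})) \<longleftrightarrow> \<epsilon> i"
          proof (cases "i = n")
            case True
            then show ?thesis using below par by simp
          next
            case False
            then have "i < n" using i by simp
            then show ?thesis using same[of i] s(2)[of i] by simp
          qed
        qed
      qed simp
      then obtain s where s: "s \<subseteq> m ` {..<2*n}"
          "\<And>i. i < n \<Longrightarrow> m (2*i+1) \<in> s \<and> (even (card (s \<inter> {..<m (2*i+1)})) \<longleftrightarrow> \<epsilon> i)" by blast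
      have "cell s \<noteq> {}" using N(2)[of s] s(1) m(2) finite_subset[OF s(1)] by auto
      then obtain t where "t \<in> cell s" by auto
      then have "t \<in> (if \<epsilon> i then A (m (2*i+1)) else B (m (2*i+1)))" if "i < n" for i
        using s(2)[OF that] unfolding cell_def by force
      then show "\<exists>t. \<forall>i<n. t \<in> (if \<epsilon> i then A (m (2*i+1)) else B (m (2*i+1)))" by blast
    qed
  qed
qed

section \<open>Finitely additive measures\<close>

text \<open>Sets of measure at least \<open>\<epsilon>\<close> with pairwise intersections of measure less than \<open>\<epsilon> / (2 p)\<close> are nearly
disjoint: \<open>p\<close> of them have a union of measure at least \<open>p \<epsilon> / 2\<close>, which exceeds \<open>1\<close> for large \<open>p\<close>.\<close>

lemma infinitely_many_overlap:
  fixes m :: "'c set \<Rightarrow> real" and A :: "nat \<Rightarrow> 'c set"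
  assumes nn: "\<And>S. 0 \<le> m S" and add: "\<And>S T. S \<inter> T = {} \<Longrightarrow> m (S \<union> T) = m S + m T"
    and le: "m UNIV \<le> 1" and J: "infinite J" and \<epsilon>: "0 < \<epsilon>" and big: "\<And>j. j \<in> J \<Longrightarrow> \<epsilon> \<le> m (A j)"
  obtains i \<delta> where "i \<in> J" "0 < \<delta>" "infinite {j\<in>J. \<delta> \<le> m (A i \<inter> A j)}"
proof -
  have mono: "m S \<le> m T" if "S \<subseteq> T" for S T
    using add[of S "T - S"] nn[of "T - S"] that by (simp add: Un_absorb1)
  have emp: "m {} = 0" using add[of "{}" "{}"] by simp
  have sub: "m (S \<union> T) \<le> m S + m T" for S T
    using add[of S "T - S"] mono[of "T - S" T] by simp
  obtain p :: nat where p: "2 / \<epsilon> < real p" using reals_Archimedean2 by blast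
  have p0: "0 < p" using p \<epsilon> by (metis of_nat_0_less_iff zero_less_divide_iff zero_less_numeral order.strict_trans)
  define \<delta> where "\<delta> = \<epsilon> / (2 * real p)"
  have \<delta>: "0 < \<delta>" using \<epsilon> p0 by (simp add: \<delta>_def)
  have "\<exists>i\<in>J. infinite {j\<in>J. \<delta> \<le> m (A i \<inter> A j)}"
  proof (rule ccontr)
    assume "\<not> ?thesis"
    then have fin: "finite {j\<in>J. \<delta> \<le> m (A i \<inter> A j)}" if "i \<in> J" for i using that by blast
    have "\<exists>I. finite I \<and> I \<subseteq> J \<and> card I = n \<and> real n * \<epsilon> / 2 \<le> m (\<Union>i\<in>I. A i)" if "n \<le> p" for n
      using that
    proof (induction n)
      case 0
      show ?case by (intro exI[of _ "{}"]) (simp add: emp)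
    next
      case (Suc n)
      then obtain I where I: "finite I" "I \<subseteq> J" "card I = n" "real n * \<epsilon> / 2 \<le> m (\<Union>i\<in>I. A i)" by auto
      define Z where "Z = I \<union> (\<Union>i\<in>I. {j\<in>J. \<delta> \<le> m (A i \<inter> A j)})"
      have "finite Z" using I fin unfolding Z_def by auto
      then have "J - Z \<noteq> {}" using J by (metis Diff_infinite_finite finite.emptyI)
      then obtain j where jZ: "j \<in> J" "j \<notin> Z" by blast
      have j: "j \<in> J" "j \<notin> I" "\<And>i. i \<in> I \<Longrightarrow> m (A i \<inter> A j) < \<delta>"
        using jZ unfolding Z_def by (auto simp: not_le)
      have ov: "m (\<Union>i\<in>I'. A i \<inter> A j) \<le> real (card I') * \<delta>" if "finite I'" "I' \<subseteq> I" for I'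
        using that
      proof (induction I')
        case (insert i I')
        have "m (\<Union>i\<in>insert i I'. A i \<inter> A j) \<le> m (A i \<inter> A j) + m (\<Union>i\<in>I'. A i \<inter> A j)" using sub by simp
        also have "\<dots> \<le> \<delta> + real (card I') * \<delta>" using insert j(3)[of i] by simp
        finally show ?case using insert by (simp add: algebra_simps)
      qed (simp add: emp)
      define U where "U = (\<Union>i\<in>I. A i)"
      have "A j = (A j - U) \<union> (\<Union>i\<in>I. A i \<inter> A j)" unfolding U_def by blast
      then have "m (A j) \<le> m (A j - U) + m (\<Union>i\<in>I. A i \<inter> A j)"
        using sub[of "A j - U" "\<Union>i\<in>I. A i \<inter> A j"] by simp
      then have 1: "\<epsilon> - real n * \<delta> \<le> m (A j - U)" using big[OF j(1)] ov[of I] I by auto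
      have "real n * \<delta> \<le> \<epsilon> / 2" using Suc.prems \<epsilon> p0 by (simp add: \<delta>_def field_simps)
      then have "\<epsilon> / 2 \<le> m (A j - U)" using 1 by simp
      moreover have "m (\<Union>i\<in>insert j I. A i) = m U + m (A j - U)"
        using add[of U "A j - U"] unfolding U_def by (simp add: Un_commute)
      ultimately have "real (Suc n) * \<epsilon> / 2 \<le> m (\<Union>i\<in>insert j I. A i)"
        using I(4) unfolding U_def by (simp add: field_simps)
      then show ?case using I j by (intro exI[of _ "insert j I"]) auto
    qed
    then obtain I where "real p * \<epsilon> / 2 \<le> m (\<Union>i\<in>I. A i)" by blast
    also have "\<dots> \<le> 1" using le mono[of "\<Union>i\<in>I. A i" UNIV] by simp
    finally show False using p \<epsilon> by (simp add: field_simps)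
  qed
  then show thesis using \<delta> that by blast
qed

text \<open>For a countably additive measure one would take a point that lies in infinitely many of the sets. For a
finitely additive one, the sets are selected one by one, keeping an infinite reserve of sets that meet
the intersection selected so far in measure bounded below.\<close>

lemma finitely_additive_fip:
  fixes m :: "'c set \<Rightarrow> real" and A :: "nat \<Rightarrow> 'c set"
  assumes nn: "\<And>S. 0 \<le> m S" and add: "\<And>S T. S \<inter> T = {} \<Longrightarrow> m (S \<union> T) = m S + m T"
    and le: "m UNIV \<le> 1" and \<epsilon>: "0 < \<epsilon>" and big: "\<And>j. \<epsilon> \<le> m (A j)"
  obtains r :: "nat \<Rightarrow> nat" where "strict_mono r" "\<And>n. (\<Inter>i\<le>n. A (r i)) \<noteq> {}"
proof -
  have emp: "m {} = 0" using add[of "{}" "{}"] by simp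
  define P where "P = (\<lambda>(n::nat) (i::nat, B, J). \<exists>\<delta>>0. infinite J \<and> (\<forall>j\<in>J. i < j \<and> \<delta> \<le> m (B \<inter> A j)))"
  define Q where "Q = (\<lambda>(n::nat) (i::nat, B, J) (i'::nat, B', J'). (i::nat) < i' \<and> B' = B \<inter> A i' \<and> (J' :: nat set) \<subseteq> J)"
  have "\<exists>f. \<forall>n. P n (f n) \<and> Q n (f n) (f (Suc n))"
  proof (rule dependent_nat_choice)
    show "\<exists>x. P 0 x" unfolding P_def
    proof (intro exI[of _ "(0::nat, UNIV, {0<..})"], simp, intro exI[of _ \<epsilon>] conjI ballI)
      show "infinite {0::nat<..}" by (simp add: infinite_Ioi)
    qed (use \<epsilon> big in auto)
  next
    fix x n assume "P n x"
    then obtain i B J \<delta> where x: "x = (i,B,J)" and \<delta>: "0 < \<delta>" "infinite J" "\<And>j. j \<in> J \<Longrightarrow> i < j \<and> \<delta> \<le> m (B \<inter> A j)"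
      unfolding P_def by (cases x) auto
    obtain i' \<delta>' where *: "i' \<in> J" "0 < \<delta>'" "infinite {j\<in>J. \<delta>' \<le> m ((B \<inter> A i') \<inter> (B \<inter> A j))}"
      using infinitely_many_overlap[OF nn add le \<delta>(2,1), of "\<lambda>j. B \<inter> A j"] \<delta>(3) by blast
    define J' where "J' = {j\<in>J. \<delta>' \<le> m ((B \<inter> A i') \<inter> (B \<inter> A j))} \<inter> {x. \<forall>y\<in>{i'}. y < x}"
    have "infinite J'" unfolding J'_def by (rule infinite_above[OF *(3)]) simp
    moreover have "(B \<inter> A i') \<inter> (B \<inter> A j) = B \<inter> A i' \<inter> A j" for j by auto
    ultimately have "P (Suc n) (i', B \<inter> A i', J')" unfolding P_def
      using * by (auto simp: J'_def)
    moreover have "Q n x (i', B \<inter> A i', J')" using \<delta>(3) * unfolding Q_def x J'_def by auto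
    ultimately show "\<exists>y. P (Suc n) y \<and> Q n x y" by blast
  qed
  then obtain f where Pf: "\<And>n. P n (f n)" and Qf: "\<And>n. Q n (f n) (f (Suc n))" by blast
  define i where "i = fst \<circ> f"
  define B where "B = fst \<circ> snd \<circ> f"
  have iS: "i n < i (Suc n)" and BS: "B (Suc n) = B n \<inter> A (i (Suc n))" for n
    using Qf[of n] unfolding Q_def i_def B_def by (auto simp: case_prod_unfold)
  have ne: "B n \<noteq> {}" for n
  proof -
    obtain \<delta> j where "0 < \<delta>" "\<delta> \<le> m (B n \<inter> A j)"
      using Pf[of n] unfolding P_def B_def by (auto simp: case_prod_unfold dest!: infinite_imp_nonempty)
    then show ?thesis using emp by auto
  qed
  have Bsub: "B (Suc n) \<subseteq> (\<Inter>l\<le>n. A (i (Suc l)))" for n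
  proof (induction n)
    case (Suc n)
    have "{..Suc n} = insert (Suc n) {..n}" by auto
    then show ?case using Suc unfolding BS[of "Suc n"] by auto
  qed (auto simp: BS)
  show thesis
  proof (rule that)
    show "strict_mono (\<lambda>n. i (Suc n))" using iS by (simp add: strict_mono_Suc_iff)
    show "(\<Inter>l\<le>n. A (i (Suc l))) \<noteq> {}" for n using Bsub[of n] ne[of "Suc n"] by blast
  qed
qed

section \<open>Real and imaginary parts\<close>

text \<open>Both scalar fields are treated at once by the decomposition \<open>x = kre x + kim x * iu\<close>, where \<open>iu\<close> is a
square root of \<open>-1\<close> over the complex numbers and \<open>0\<close> over the reals.\<close>

definition iu :: "'k::real_or_complex" where
  "iu = (if \<forall>x::'k. \<exists>a. x = of_real a then 0
         else SOME i. i * i = -1 \<and> (\<forall>x. \<exists>a b. x = of_real a + of_real b * i) \<and>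
          (\<forall>a b. norm (of_real a + of_real b * i) = sqrt (a\<^sup>2 + b\<^sup>2)))"

lemma iu_cases:
  obtains "(iu::'k::real_or_complex) = 0" "\<And>x::'k. \<exists>a. x = of_real a"
  | "(iu::'k) * iu = -1" "(iu::'k) \<noteq> 0" "\<And>x::'k. \<exists>a b. x = of_real a + of_real b * iu"
    "\<And>a b. norm (of_real a + of_real b * (iu::'k)) = sqrt (a\<^sup>2 + b\<^sup>2)"
proof (cases "\<forall>x::'k. \<exists>a. x = of_real a")
  case True
  then show thesis using that(1) unfolding iu_def by simp
next
  case False
  moreover have "(\<forall>x::'k. \<exists>a. x = of_real a) \<or> (\<exists>i::'k. i * i = -1 \<and> (\<forall>x. \<exists>a b. x = of_real a + of_real b * i) \<and>
          (\<forall>a b. norm (of_real a + of_real b * i) = sqrt (a\<^sup>2 + b\<^sup>2)))"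
    using real_or_complex[where 'a = 'k] by (simp only: scaleR_conv_of_real mult_1_right)
  ultimately have "\<exists>i::'k. i * i = -1 \<and> (\<forall>x. \<exists>a b. x = of_real a + of_real b * i) \<and>
          (\<forall>a b. norm (of_real a + of_real b * i) = sqrt (a\<^sup>2 + b\<^sup>2))"
    by blast
  from someI_ex[OF this] have "(iu::'k) * iu = -1 \<and> (\<forall>x::'k. \<exists>a b. x = of_real a + of_real b * iu) \<and>
          (\<forall>a b. norm (of_real a + of_real b * (iu::'k)) = sqrt (a\<^sup>2 + b\<^sup>2))"
    using False unfolding iu_def by simp
  moreover from this have "(iu::'k) \<noteq> 0" by auto
  ultimately show thesis using that(2) by blast
qed

definition kre :: "'k::real_or_complex \<Rightarrow> real" where
  "kre x = (SOME a. \<exists>b. x = of_real a + of_real b * iu)"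

text \<open>The second conjunct makes the imaginary part vanish over the reals, where the first one leaves it
arbitrary.\<close>

definition kim :: "'k::real_or_complex \<Rightarrow> real" where
  "kim x = (SOME b. x = of_real (kre x) + of_real b * iu \<and> (iu = (0::'k) \<longrightarrow> b = 0))"

lemma parts_eq_iff:
  "of_real a + of_real b * (iu::'k::real_or_complex) = of_real a' + of_real b' * iu
    \<longleftrightarrow> a = a' \<and> ((iu::'k) \<noteq> 0 \<longrightarrow> b = b')"
proof (cases rule: iu_cases[where 'k = 'k])
  case 2
  have "b = b' \<and> a = a'" if "of_real a + of_real b * (iu::'k) = of_real a' + of_real b' * iu"
  proof -
    have "norm (of_real (a - a') + of_real (b - b') * (iu::'k)) = 0"
      using that by (simp add: algebra_simps)
    then show ?thesis unfolding 2(4) by (simp add: sum_power2_eq_zero_iff)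
  qed
  then show ?thesis using 2 by auto
qed simp

lemma kre_kim: "of_real (kre x) + of_real (kim x) * iu = (x::'k::real_or_complex)"
  and kim_real: "(iu::'k::real_or_complex) = 0 \<Longrightarrow> kim (x::'k) = 0"
proof -
  have "\<exists>a b. x = of_real a + of_real b * iu"
    by (cases rule: iu_cases[where 'k = 'k]) auto
  then have "\<exists>b. x = of_real (kre x) + of_real b * iu" unfolding kre_def by (rule someI_ex)
  then have "\<exists>b. x = of_real (kre x) + of_real b * iu \<and> (iu = (0::'k) \<longrightarrow> b = 0)"
    by (cases "iu = (0::'k)") auto
  from someI_ex[OF this]
  have *: "x = of_real (kre x) + of_real (kim x) * iu \<and> (iu = (0::'k) \<longrightarrow> kim x = 0)"
    unfolding kim_def[symmetric] .
  then show "of_real (kre x) + of_real (kim x) * iu = x" by simp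
  show "iu = (0::'k) \<Longrightarrow> kim x = 0" using * by simp
qed

lemma kre_parts [simp]: "kre (of_real a + of_real b * (iu::'k::real_or_complex)) = a"
  using kre_kim[of "of_real a + of_real b * (iu::'k)"] by (simp only: parts_eq_iff)

lemma kim_parts: "(iu::'k::real_or_complex) \<noteq> 0 \<Longrightarrow> kim (of_real a + of_real b * (iu::'k)) = b"
  using kre_kim[of "of_real a + of_real b * (iu::'k)"] unfolding parts_eq_iff by blast

lemma kre_of_real [simp]: "kre (of_real a) = a"
  using kre_parts[of a 0] by simp

lemma kim_of_real [simp]: "kim (of_real a :: 'k::real_or_complex) = 0"
  using kim_parts[of a 0, where 'k = 'k] kim_real[of "of_real a :: 'k"] by (cases "iu = (0::'k)") auto

lemma kre_add: "kre (x + y) = kre x + kre (y::'k::real_or_complex)"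
proof -
  have "x + y = of_real (kre x + kre y) + of_real (kim x + kim y) * iu"
    by (subst kre_kim[of x, symmetric], subst kre_kim[of y, symmetric]) (simp add: algebra_simps)
  then show ?thesis by (metis kre_parts)
qed

lemma kim_add: "kim (x + y) = kim x + kim (y::'k::real_or_complex)"
proof (cases "iu = (0::'k)")
  case False
  have "x + y = of_real (kre x + kre y) + of_real (kim x + kim y) * iu"
    by (subst kre_kim[of x, symmetric], subst kre_kim[of y, symmetric]) (simp add: algebra_simps)
  then show ?thesis by (metis kim_parts False)
qed (simp add: kim_real)

lemma kre_mult_real: "kre (of_real t * x) = t * kre (x::'k::real_or_complex)"
proof -
  have "of_real t * x = of_real (t * kre x) + of_real (t * kim x) * iu"
    by (subst kre_kim[of x, symmetric]) (simp add: algebra_simps)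
  then show ?thesis by (metis kre_parts)
qed

lemma kim_mult_real: "kim (of_real t * x) = t * kim (x::'k::real_or_complex)"
proof (cases "iu = (0::'k)")
  case False
  have "of_real t * x = of_real (t * kre x) + of_real (t * kim x) * iu"
    by (subst kre_kim[of x, symmetric]) (simp add: algebra_simps)
  then show ?thesis by (metis kim_parts False)
qed (simp add: kim_real)

lemma kre_iu: "kre (iu * x) = - kim (x::'k::real_or_complex)"
proof (cases rule: iu_cases[where 'k = 'k])
  case 1
  then show ?thesis using kre_of_real[of 0, where ?'a = 'k] by (simp add: kim_real)
next
  case 2
  have "iu * x = of_real (kre x) * iu + of_real (kim x) * (iu * iu)"
    by (subst kre_kim[of x, symmetric]) (simp only: algebra_simps)
  then have "iu * x = of_real (- kim x) + of_real (kre x) * iu"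
    by (simp add: 2(1))
  then show ?thesis by (metis kre_parts)
qed

lemma norm_parts: "(norm x)\<^sup>2 = (kre x)\<^sup>2 + (kim (x::'k::real_or_complex))\<^sup>2"
proof (cases rule: iu_cases[where 'k = 'k])
  case 1
  then have "norm x = norm (of_real (kre x) :: 'k)" using kre_kim[of x] by simp
  then show ?thesis using 1 by (simp add: kim_real)
next
  case 2
  have "norm x = norm (of_real (kre x) + of_real (kim x) * (iu::'k))" by (simp add: kre_kim)
  then show ?thesis by (simp add: 2(4))
qed

lemma norm_iu: "norm (iu::'k::real_or_complex) \<le> 1"
proof (cases rule: iu_cases[where 'k = 'k])
  case 2
  then show ?thesis using 2(4)[of 0 1] by simp
qed simp

lemma abs_kre_le: "\<bar>kre x\<bar> \<le> norm (x::'k::real_or_complex)"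
  and abs_kim_le: "\<bar>kim x\<bar> \<le> norm (x::'k::real_or_complex)"
  using norm_parts[of x] abs_le_square_iff[of "kre x" "norm x"] abs_le_square_iff[of "kim x" "norm x"]
  by simp_all

lemma norm_le_parts: "norm (x::'k::real_or_complex) \<le> \<bar>kre x\<bar> + \<bar>kim x\<bar>"
proof -
  have "norm x \<le> norm (of_real (kre x) :: 'k) + norm (of_real (kim x) * (iu::'k))"
    by (metis kre_kim norm_triangle_ineq)
  also have "norm (of_real (kim x) * (iu::'k)) \<le> \<bar>kim x\<bar>"
    using norm_iu[where 'k = 'k] by (simp add: norm_mult mult_left_le)
  finally show ?thesis by simp
qed

lemma compact_cball_scalar: "compact (cball (0::'k::real_or_complex) C)"
proof -
  let ?f = "\<lambda>p::real \<times> real. of_real (fst p) + of_real (snd p) * (iu::'k)"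
  have "compact (?f ` ({-C..C} \<times> {-C..C}))"
    by (intro compact_continuous_image continuous_intros compact_Times compact_Icc)
  moreover have "cball 0 C \<subseteq> ?f ` ({-C..C} \<times> {-C..C})"
  proof
    fix x :: 'k assume "x \<in> cball 0 C"
    then have "kre x \<in> {-C..C}" "kim x \<in> {-C..C}" using abs_kre_le[of x] abs_kim_le[of x] by auto
    then show "x \<in> ?f ` ({-C..C} \<times> {-C..C})"
      by (intro image_eqI[of _ _ "(kre x, kim x)"]) (simp_all add: kre_kim)
  qed
  ultimately show ?thesis
    using compact_Int_closed[of "?f ` ({-C..C} \<times> {-C..C})" "cball 0 C"] by (simp add: inf_absorb2)
qed

lemma Cauchy_scalar_convergent:
  fixes s :: "nat \<Rightarrow> 'k::real_or_complex"
  assumes "Cauchy s"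
  obtains l where "s \<longlonglongrightarrow> l"
proof -
  obtain C where "\<And>n. norm (s n) \<le> C" using cauchy_imp_bounded[OF assms] by (auto simp: bounded_iff)
  then have "\<forall>n. s n \<in> cball 0 C" by simp
  then show thesis using compact_cball_scalar[of C] compact_imp_complete assms that
    unfolding complete_def by blast
qed

lemma summable_norm_scalar:
  fixes a :: "nat \<Rightarrow> 'k::real_or_complex"
  assumes "summable (\<lambda>n. norm (a n))" shows "summable a"
proof -
  have "Cauchy (\<lambda>n. \<Sum>i<n. a i)"
  proof (rule CauchyI)
    fix d :: real assume "0 < d"
    then obtain N where N: "\<And>m n. N \<le> m \<Longrightarrow> norm (\<Sum>i\<in>{m..<n}. norm (a i)) < d"
      using assms unfolding summable_Cauchy by blast
    have ord: "norm ((\<Sum>i<m. a i) - (\<Sum>i<n. a i)) < d" if "N \<le> n" "n \<le> m" for m n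
    proof -
      have "(\<Sum>i<m. a i) - (\<Sum>i<n. a i) = (\<Sum>i\<in>{n..<m}. a i)"
        using that by (simp add: sum_diff_nat_ivl lessThan_atLeast0)
      then show ?thesis using N[OF that(1), of m] norm_sum[of a "{n..<m}"] by auto
    qed
    show "\<exists>M. \<forall>m\<ge>M. \<forall>n\<ge>M. norm ((\<Sum>i<m. a i) - (\<Sum>i<n. a i)) < d"
      using ord by (metis nle_le norm_minus_commute)
  qed
  then obtain l where "(\<lambda>n. \<Sum>i<n. a i) \<longlonglongrightarrow> l" by (rule Cauchy_scalar_convergent)
  then show ?thesis unfolding summable_def sums_def by blast
qed

lemma scalar_dense:
  fixes x :: "'k::real_or_complex"
  assumes "0 < e"
  obtains a b where "a \<in> \<rat>" "b \<in> \<rat>" "norm (x - (of_real a + of_real b * iu)) < e"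
proof -
  obtain a where a: "a \<in> \<rat>" "kre x - e/2 < a" "a < kre x"
    using Rats_dense_in_real[of "kre x - e/2" "kre x"] assms by auto
  obtain b where b: "b \<in> \<rat>" "kim x - e/2 < b" "b < kim x"
    using Rats_dense_in_real[of "kim x - e/2" "kim x"] assms by auto
  have "x - (of_real a + of_real b * iu) = of_real (kre x - a) + of_real (kim x - b) * iu"
    by (subst kre_kim[of x, symmetric]) (simp add: algebra_simps)
  moreover have "norm (of_real (kre x - a) + of_real (kim x - b) * (iu::'k)) \<le> (kre x - a) + (kim x - b)"
  proof -
    have "norm (of_real (kre x - a) + of_real (kim x - b) * (iu::'k))
      \<le> norm (of_real (kre x - a) :: 'k) + norm (of_real (kim x - b) * (iu::'k))" by (rule norm_triangle_ineq)
    also have "norm (of_real (kim x - b) * (iu::'k)) \<le> \<bar>kim x - b\<bar>"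
      using norm_iu[where 'k = 'k] by (metis mult_left_le norm_ge_zero norm_mult norm_of_real)
    finally show ?thesis using a b by (simp del: of_real_diff)
  qed
  ultimately have "norm (x - (of_real a + of_real b * iu)) \<le> (kre x - a) + (kim x - b)"
    by (simp only:)
  then show thesis using that[OF a(1) b(1)] a b by linarith
qed

text \<open>The real or the imaginary parts of the \<open>a i\<close> carry at least half of the sum of the norms, and the signs
of these parts turn their absolute values into the real or imaginary part of a signed sum.\<close>

lemma signs_half:
  fixes a :: "nat \<Rightarrow> 'k::real_or_complex"
  obtains \<epsilon> :: "nat \<Rightarrow> bool" where
    "(\<Sum>i<n. norm (a i)) / 2 \<le> norm (\<Sum>i<n. (if \<epsilon> i then 1 else -1) * a i)"
proof -
  have key: "(\<Sum>i<n. \<bar>h (a i)\<bar>) \<le> norm (\<Sum>i<n. (if 0 \<le> h (a i) then 1 else -1) * a i)"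
    if "\<And>x y. h (x + y) = h x + h y" "\<And>t x. h (of_real t * x) = t * h x" "\<And>x. \<bar>h x\<bar> \<le> norm x"
    for h :: "'k \<Rightarrow> real"
  proof -
    have h0: "h 0 = 0" using that(2)[of 0 0] by simp
    have hs: "h (sum f A) = (\<Sum>i\<in>A. h (f i))" if "finite A" for f and A :: "nat set"
      using that by (induction A) (simp_all add: h0 \<open>\<And>x y. h (x + y) = h x + h y\<close>)
    have "h ((if 0 \<le> h (a i) then 1 else -1) * a i) = \<bar>h (a i)\<bar>" for i
      using that(2)[of 1 "a i"] that(2)[of "-1" "a i"] by auto
    then have "(\<Sum>i<n. \<bar>h (a i)\<bar>) = h (\<Sum>i<n. (if 0 \<le> h (a i) then 1 else -1) * a i)"
      by (simp add: hs)
    also have "\<dots> \<le> norm (\<Sum>i<n. (if 0 \<le> h (a i) then 1 else -1) * a i)" using that(3) by (meson abs_le_D1)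
    finally show ?thesis .
  qed
  have "(\<Sum>i<n. norm (a i)) \<le> (\<Sum>i<n. \<bar>kre (a i)\<bar>) + (\<Sum>i<n. \<bar>kim (a i)\<bar>)"
    unfolding sum.distrib[symmetric] by (intro sum_mono norm_le_parts)
  then consider "(\<Sum>i<n. norm (a i)) / 2 \<le> (\<Sum>i<n. \<bar>kre (a i)\<bar>)" | "(\<Sum>i<n. norm (a i)) / 2 \<le> (\<Sum>i<n. \<bar>kim (a i)\<bar>)"
    by linarith
  then show thesis
  proof cases
    case 1
    then show thesis
      using that[of "\<lambda>i. 0 \<le> kre (a i)"] key[of kre, OF kre_add kre_mult_real abs_kre_le] by linarith
  next
    case 2
    then show thesis
      using that[of "\<lambda>i. 0 \<le> kim (a i)"] key[of kim, OF kim_add kim_mult_real abs_kim_le] by linarith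
  qed
qed

section \<open>Limits along an ultrafilter\<close>

text \<open>A minimal element, by Zorn's lemma, among the nontrivial filters below \<open>sequentially\<close>.\<close>

lemma ex_ultrafilter:
  "\<exists>F::nat filter. F \<noteq> bot \<and> F \<le> sequentially \<and> (\<forall>P. eventually P F \<or> eventually (\<lambda>x. \<not> P x) F)"
proof -
  let ?A = "{F::nat filter. F \<noteq> bot \<and> F \<le> sequentially}"
  have "\<exists>m\<in>?A. \<forall>a\<in>?A. a \<le> m \<longrightarrow> a = m"
  proof (rule predicate_Zorn[where P = "\<lambda>a b. b \<le> a"])
    show "partial_order_on ?A (relation_of (\<lambda>a b. b \<le> a) ?A)"
      by (rule partial_order_on_relation_ofI) auto
  next
    fix C assume C: "C \<in> Chains (relation_of (\<lambda>a b. b \<le> a) ?A)"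
    then have CA: "C \<subseteq> ?A" and lin: "\<And>F G. F \<in> C \<Longrightarrow> G \<in> C \<Longrightarrow> F \<le> G \<or> G \<le> F"
      unfolding Chains_def relation_of_def by auto
    show "\<exists>u\<in>?A. \<forall>a\<in>C. u \<le> a"
    proof (cases "C = {}")
      case True
      then show ?thesis by (intro bexI[of _ sequentially]) auto
    next
      case False
      have "eventually P (Inf C) \<longleftrightarrow> (\<exists>F\<in>C. eventually P F)" for P
        by (rule eventually_Inf_base[OF False]) (use lin in \<open>auto simp: inf_absorb1 inf_absorb2\<close>)
      then have "Inf C \<noteq> bot" using CA unfolding trivial_limit_def by auto
      moreover have "Inf C \<le> sequentially" using False CA by (auto intro: Inf_lower2)
      ultimately show ?thesis by (auto intro: Inf_lower)
    qed
  qed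
  then obtain U where U: "U \<noteq> bot" "U \<le> sequentially"
    and max: "\<And>a. a \<noteq> bot \<Longrightarrow> a \<le> sequentially \<Longrightarrow> a \<le> U \<Longrightarrow> a = U" by auto
  have "eventually P U \<or> eventually (\<lambda>x. \<not> P x) U" for P
  proof (cases "inf U (principal {x. P x}) = bot")
    case True
    then show ?thesis by (simp add: trivial_limit_def eventually_inf_principal)
  next
    case False
    then have "inf U (principal {x. P x}) = U" using max U(2) by (meson inf.cobounded1 order.trans)
    moreover have "eventually P (inf U (principal {x. P x}))" by (simp add: eventually_inf_principal)
    ultimately show ?thesis by simp
  qed
  then show ?thesis using U by blast
qed

text \<open>A free ultrafilter on the natural numbers, fixed once and for all.\<close>

definition uf :: "nat filter" where
  "uf = (SOME F. F \<noteq> bot \<and> F \<le> sequentially \<and> (\<forall>P. eventually P F \<or> eventually (\<lambda>x. \<not> P x) F))"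

lemma uf_nontrivial [simp]: "uf \<noteq> bot" and uf_le: "uf \<le> sequentially"
  and uf_ultra: "eventually P uf \<or> eventually (\<lambda>x. \<not> P x) uf"
proof -
  have "uf \<noteq> bot \<and> uf \<le> sequentially \<and> (\<forall>P. eventually P uf \<or> eventually (\<lambda>x. \<not> P x) uf)"
    unfolding uf_def by (rule someI_ex[OF ex_ultrafilter])
  then show "uf \<noteq> bot" "uf \<le> sequentially" "eventually P uf \<or> eventually (\<lambda>x. \<not> P x) uf" by auto
qed

lemma uf_tendsto: "(s \<longlonglongrightarrow> l) \<Longrightarrow> (s \<longlongrightarrow> l) uf"
  using uf_le tendsto_mono by blast

lemma uf_eventually: "eventually P sequentially \<Longrightarrow> eventually P uf"
  using uf_le by (simp add: filter_leD)

lemma uf_compact: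
  assumes "compact K" "\<And>n. s n \<in> (K :: 'c::t2_space set)"
  shows "\<exists>l\<in>K. (s \<longlongrightarrow> l) uf"
proof -
  have "filtermap s uf \<noteq> bot" by (simp add: filtermap_bot_iff)
  moreover have "eventually (\<lambda>x. x \<in> K) (filtermap s uf)" using assms by (simp add: eventually_filtermap)
  ultimately obtain l where l: "l \<in> K" "inf (nhds l) (filtermap s uf) \<noteq> bot"
    using assms(1) unfolding compact_filter by blast
  have "(s \<longlongrightarrow> l) uf"
  proof (rule topological_tendstoI)
    fix S assume S: "open S" "l \<in> S"
    show "\<forall>\<^sub>F x in uf. s x \<in> S"
    proof (rule ccontr)
      assume "\<not> ?thesis"
      then have "\<forall>\<^sub>F x in uf. s x \<notin> S" using uf_ultra by blast
      then have "eventually (\<lambda>x. x \<notin> S) (filtermap s uf)" by (simp add: eventually_filtermap)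
      moreover have "eventually (\<lambda>x. x \<in> S) (nhds l)" using S by (simp add: eventually_nhds_in_open)
      ultimately have "eventually (\<lambda>x. False) (inf (nhds l) (filtermap s uf))"
        unfolding eventually_inf by (metis (mono_tags, lifting))
      then show False using l(2) by (simp add: trivial_limit_def)
    qed
  qed
  then show ?thesis using l by blast
qed

text \<open>Bounded scalar sequences always have a limit along \<open>uf\<close>, and this limit is linear in the sequence. This
is what makes it a substitute for passing to weak* convergent subnets of functionals.\<close>

definition ulim :: "(nat \<Rightarrow> 'c::t2_space) \<Rightarrow> 'c" where
  "ulim s = Lim uf s"

lemma ulim_eq: "(s \<longlongrightarrow> l) uf \<Longrightarrow> ulim s = l"
  unfolding ulim_def by (rule tendsto_Lim) auto

lemma ulim_scalar:
  fixes s :: "nat \<Rightarrow> 'k::real_or_complex"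
  assumes "\<And>n. norm (s n) \<le> C"
  shows "(s \<longlongrightarrow> ulim s) uf"
proof -
  obtain l where "(s \<longlongrightarrow> l) uf" using uf_compact[OF compact_cball_scalar[of C], of s] assms by auto
  then show ?thesis using ulim_eq[of s l] by simp
qed

section \<open>Arithmetic and continuity in normed spaces\<close>

abbreviation vsub :: "('k::real_or_complex, 'a) nspace \<Rightarrow> 'a \<Rightarrow> 'a \<Rightarrow> 'a" where
  "vsub V x y \<equiv> vadd V x (vscale V (-1) y)"

context normed_space
begin

lemmas closed = zero_closed add_closed scale_closed

lemma zero_add: "x \<in> vcarrier V \<Longrightarrow> vadd V (vzero V) x = x"
  using add_zero add_commute zero_closed by metis

lemma add_left_commute:
  "\<lbrakk>x \<in> vcarrier V; y \<in> vcarrier V; z \<in> vcarrier V\<rbrakk> \<Longrightarrow> vadd V x (vadd V y z) = vadd V y (vadd V x z)"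
  by (metis add_assoc add_commute)

lemmas add_ac = add_assoc add_commute add_left_commute

lemma norm_zero [simp]: "vnorm V (vzero V) = 0"
  using norm_eq_zero zero_closed by simp

lemma scale_zero_right: "vscale V c (vzero V) = vzero V"
  using norm_scale[OF zero_closed, of c] norm_eq_zero[of "vscale V c (vzero V)"] scale_closed zero_closed by simp

lemma minus_add: "x \<in> vcarrier V \<Longrightarrow> vadd V (vscale V (-1) x) x = vzero V"
  using add_minus[of x] add_commute[of x "vscale V (-1) x"] by (simp add: closed)

lemma vdist_eq: "x \<in> vcarrier V \<Longrightarrow> y \<in> vcarrier V \<Longrightarrow> vdist V x y = vnorm V (vsub V x y)"
  by (simp add: vdist_def)

lemma norm_vsub_commute:
  "x \<in> vcarrier V \<Longrightarrow> y \<in> vcarrier V \<Longrightarrow> vnorm V (vsub V x y) = vnorm V (vsub V y x)"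
  using norm_scale[of "vsub V x y" "-1"] by (simp add: minus_minus closed)

lemma topspace_norm_topology [simp]: "topspace (norm_topology V) = vcarrier V"
  unfolding norm_topology_def using Metric_space_vdist by (rule Metric_space.topspace_mtopology)

lemma limitin_norm:
  assumes "\<And>n. s n \<in> vcarrier V"
  shows "limitin (norm_topology V) s l sequentially \<longleftrightarrow>
    l \<in> vcarrier V \<and> (\<lambda>n. vnorm V (vsub V (s n) l)) \<longlonglongrightarrow> 0"
proof -
  interpret Metric_space "vcarrier V" "vdist V" by (rule Metric_space_vdist)
  show ?thesis
    unfolding norm_topology_def limitin_metric_dist_null using assms by (auto simp: vdist_eq)
qed

lemma continuous_map_norm:
  assumes "normed_space W"
  shows "continuous_map (norm_topology V) (norm_topology W) T \<longleftrightarrow>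
    T ` vcarrier V \<subseteq> vcarrier W \<and> (\<forall>a\<in>vcarrier V. \<forall>e>0. \<exists>d>0. \<forall>x\<in>vcarrier V.
      vnorm V (vsub V a x) < d \<longrightarrow> vnorm W (vsub W (T a) (T x)) < e)"
proof -
  interpret W: normed_space W by fact
  have "T ` vcarrier V \<subseteq> vcarrier W \<Longrightarrow>
    (\<forall>a\<in>vcarrier V. \<forall>e>0. \<exists>d>0. \<forall>x. x \<in> vcarrier V \<and> vdist V a x < d \<longrightarrow> vdist W (T a) (T x) < e) \<longleftrightarrow>
    (\<forall>a\<in>vcarrier V. \<forall>e>0. \<exists>d>0. \<forall>x\<in>vcarrier V.
      vnorm V (vsub V a x) < d \<longrightarrow> vnorm W (vsub W (T a) (T x)) < e)"
    by (intro ball_cong refl all_cong1 imp_cong ex_cong1 conj_cong)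
       (auto simp: vdist_eq W.vdist_eq image_subset_iff)
  then show ?thesis
    unfolding norm_topology_def
      Metric_space.metric_continuous_map[OF Metric_space_vdist W.Metric_space_vdist] by blast
qed

end

lemma linear_betweenD:
  assumes "linear_between V W T"
  shows "x \<in> vcarrier V \<Longrightarrow> T x \<in> vcarrier W"
    "x \<in> vcarrier V \<Longrightarrow> y \<in> vcarrier V \<Longrightarrow> T (vadd V x y) = vadd W (T x) (T y)"
    "x \<in> vcarrier V \<Longrightarrow> T (vscale V c x) = vscale W c (T x)"
  using assms unfolding linear_between_def by auto

lemma (in normed_space) linear_between_zero:
  assumes "normed_space W" "linear_between V W T" shows "T (vzero V) = vzero W"
proof -
  interpret W: normed_space W by fact
  show ?thesis
    using linear_betweenD[OF assms(2)] zero_closed scale_zero_left W.scale_zero_left by metis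
qed

lemma (in normed_space) linear_continuous_iff:
  assumes W: "normed_space W" and T: "linear_between V W T"
  shows "continuous_map (norm_topology V) (norm_topology W) T \<longleftrightarrow>
    (\<exists>K. \<forall>x\<in>vcarrier V. vnorm W (T x) \<le> K * vnorm V x)"
proof
  interpret W: normed_space W by fact
  note lin = linear_betweenD[OF T]
  have T0: "T (vzero V) = vzero W" by (rule linear_between_zero[OF W T])
  have Tsub: "T (vsub V x y) = vsub W (T x) (T y)" if "x \<in> vcarrier V" "y \<in> vcarrier V" for x y
    using that by (simp add: lin closed)
  {
    assume "continuous_map (norm_topology V) (norm_topology W) T"
    then have "\<exists>d>0. \<forall>x\<in>vcarrier V. vnorm V (vsub V (vzero V) x) < d
        \<longrightarrow> vnorm W (vsub W (T (vzero V)) (T x)) < 1"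
      unfolding continuous_map_norm[OF W] using zero_closed by (meson zero_less_one)
    then obtain d where d: "0 < d" "\<And>x. x \<in> vcarrier V \<Longrightarrow> vnorm V x < d \<Longrightarrow> vnorm W (T x) < 1"
      using norm_scale[of _ "-1"] W.norm_scale[of _ "-1"]
      by (auto simp: T0 zero_add W.zero_add closed lin W.closed)
    have "vnorm W (T x) \<le> 2 / d * vnorm V x" if x: "x \<in> vcarrier V" for x
    proof (cases "vnorm V x = 0")
      case True
      then show ?thesis using x norm_eq_zero T0 by simp
    next
      case False
      then have pos: "0 < vnorm V x" using norm_nonneg[OF x] by simp
      define c where "c = d / (2 * vnorm V x)"
      have c: "0 < c" using pos d by (simp add: c_def)
      have "vnorm V (vscale V (of_real c) x) = d / 2"
        using pos c d(1) x norm_scale[OF x, of "of_real c"] by (simp add: c_def del: of_real_divide of_real_mult)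
      then have "vnorm W (T (vscale V (of_real c) x)) < 1" using d x scale_closed by simp
      then have "c * vnorm W (T x) < 1" using x c by (simp add: lin W.norm_scale)
      then show ?thesis using pos d(1) by (simp add: c_def field_simps)
    qed
    then show "\<exists>K. \<forall>x\<in>vcarrier V. vnorm W (T x) \<le> K * vnorm V x" by blast
  next
    assume "\<exists>K. \<forall>x\<in>vcarrier V. vnorm W (T x) \<le> K * vnorm V x"
    then obtain K where K: "\<And>x. x \<in> vcarrier V \<Longrightarrow> vnorm W (T x) \<le> K * vnorm V x" by blast
    show "continuous_map (norm_topology V) (norm_topology W) T"
      unfolding continuous_map_norm[OF W]
    proof (intro conjI ballI allI impI)
      show "T ` vcarrier V \<subseteq> vcarrier W" using lin by auto
      fix a and e :: real assume a: "a \<in> vcarrier V" and e: "0 < e"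
      show "\<exists>d>0. \<forall>x\<in>vcarrier V. vnorm V (vsub V a x) < d \<longrightarrow> vnorm W (vsub W (T a) (T x)) < e"
      proof (intro exI[of _ "e / (\<bar>K\<bar> + 1)"] conjI ballI impI)
        show "0 < e / (\<bar>K\<bar> + 1)" using e by simp
        fix x assume x: "x \<in> vcarrier V" and *: "vnorm V (vsub V a x) < e / (\<bar>K\<bar> + 1)"
        have ax: "vsub V a x \<in> vcarrier V" using a x by (simp add: closed)
        have "vnorm W (vsub W (T a) (T x)) \<le> K * vnorm V (vsub V a x)"
          using K[OF ax] Tsub a x by simp
        also have "\<dots> \<le> (\<bar>K\<bar> + 1) * vnorm V (vsub V a x)"
          by (rule mult_right_mono) (auto simp: norm_nonneg ax)
        also have "\<dots> < e" using * by (simp add: field_simps)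
        finally show "vnorm W (vsub W (T a) (T x)) < e" .
      qed
    qed
  }
qed

lemma normed_space_scalar: "normed_space (scalar_space :: ('k::real_or_complex, 'k) nspace)"
  by standard (auto simp: scalar_space_def algebra_simps norm_mult norm_triangle_ineq
      intro: exI[of _ "- x" for x])

lemma norm_topology_scalar: "norm_topology (scalar_space :: ('k::real_or_complex, 'k) nspace) = euclidean"
proof -
  have "vdist (scalar_space :: ('k, 'k) nspace) = dist"
    by (intro ext) (simp add: vdist_def scalar_space_def dist_norm)
  then show ?thesis
    by (simp add: norm_topology_def scalar_space_def)
qed

section \<open>The Hahn-Banach theorem\<close>

text \<open>Partial functionals are represented by their graphs, the subspaces \<open>G\<close> of \<open>V \<times> \<real>\<close> with \<open>s \<le> p x\<close> for all
\<open>(x, s)\<close> in \<open>G\<close>, ordered by inclusion. Domination alone makes \<open>G\<close> the graph of a function, as a pair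
\<open>(0, s)\<close> with \<open>s \<noteq> 0\<close> has multiples that violate it. The one-step extension treats points inside and
outside the domain of \<open>G\<close> alike.\<close>

lemma (in normed_space) real_Hahn_Banach:
  fixes p :: "'a \<Rightarrow> real" and G0 :: "('a \<times> real) set"
  assumes p_add: "\<And>x y. x \<in> vcarrier V \<Longrightarrow> y \<in> vcarrier V \<Longrightarrow> p (vadd V x y) \<le> p x + p y"
    and p_scale: "\<And>t x. x \<in> vcarrier V \<Longrightarrow> 0 \<le> t \<Longrightarrow> p (vscale V (of_real t) x) = t * p x"
    and G0: "G0 \<subseteq> vcarrier V \<times> UNIV" "(vzero V, 0) \<in> G0"
    and G0_add: "\<And>x s y t. (x, s) \<in> G0 \<Longrightarrow> (y, t) \<in> G0 \<Longrightarrow> (vadd V x y, s + t) \<in> G0"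
    and G0_scale: "\<And>x s c. (x, s) \<in> G0 \<Longrightarrow> (vscale V (of_real c) x, c * s) \<in> G0"
    and G0_le: "\<And>x s. (x, s) \<in> G0 \<Longrightarrow> s \<le> p x"
  obtains u where
    "\<And>x y. x \<in> vcarrier V \<Longrightarrow> y \<in> vcarrier V \<Longrightarrow> u (vadd V x y) = u x + u y"
    "\<And>c x. x \<in> vcarrier V \<Longrightarrow> u (vscale V (of_real c) x) = c * u x"
    "\<And>x. x \<in> vcarrier V \<Longrightarrow> u x \<le> p x"
    "\<And>x s. (x, s) \<in> G0 \<Longrightarrow> u x = s"
proof -
  define good where "good G \<longleftrightarrow> G0 \<subseteq> G \<and> G \<subseteq> vcarrier V \<times> UNIV \<and>
    (\<forall>x s y t. (x, s) \<in> G \<longrightarrow> (y, t) \<in> G \<longrightarrow> (vadd V x y, s + t) \<in> G) \<and>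
    (\<forall>x s c. (x, s) \<in> G \<longrightarrow> (vscale V (of_real c) x, c * s) \<in> G) \<and>
    (\<forall>x s. (x, s) \<in> G \<longrightarrow> s \<le> p x)" for G :: "('a \<times> real) set"
  have "\<exists>M\<in>Collect good. \<forall>X\<in>Collect good. M \<subseteq> X \<longrightarrow> X = M"
  proof (rule subset_Zorn_nonempty)
    have "good G0" unfolding good_def using assms by auto
    then show "Collect good \<noteq> {}" by blast
  next
    fix \<C> assume C: "\<C> \<noteq> {}" "subset.chain (Collect good) \<C>"
    then have Cg: "\<And>G. G \<in> \<C> \<Longrightarrow> good G" and lin: "\<And>G H. G \<in> \<C> \<Longrightarrow> H \<in> \<C> \<Longrightarrow> G \<subseteq> H \<or> H \<subseteq> G"
      unfolding subset_chain_def by auto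
    have "(vadd V x y, s + t) \<in> \<Union>\<C>" if xs: "(x, s) \<in> \<Union>\<C>" and yt: "(y, t) \<in> \<Union>\<C>" for x s y t
    proof -
      obtain G H where GH: "G \<in> \<C>" "(x, s) \<in> G" "H \<in> \<C>" "(y, t) \<in> H" using xs yt by blast
      then obtain I where "I \<in> \<C>" "(x, s) \<in> I" "(y, t) \<in> I" using lin by (metis subsetD)
      then show ?thesis using Cg unfolding good_def by blast
    qed
    moreover have "(vscale V (of_real c) x, c * s) \<in> \<Union>\<C>" if "(x, s) \<in> \<Union>\<C>" for x s c
      using that Cg unfolding good_def by blast
    moreover have "s \<le> p x" if "(x, s) \<in> \<Union>\<C>" for x s
      using that Cg unfolding good_def by blast
    moreover have "G0 \<subseteq> \<Union>\<C>" using C(1) Cg unfolding good_def by blast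
    moreover have "\<Union>\<C> \<subseteq> vcarrier V \<times> UNIV"
    proof (rule Union_least)
      show "G \<subseteq> vcarrier V \<times> UNIV" if "G \<in> \<C>" for G using Cg[OF that] unfolding good_def by blast
    qed
    ultimately show "\<Union>\<C> \<in> Collect good" unfolding good_def by simp
  qed
  then obtain M where gM: "good M" and max: "\<And>X. good X \<Longrightarrow> M \<subseteq> X \<Longrightarrow> X = M" by auto
  have M: "G0 \<subseteq> M" "\<And>x s. (x, s) \<in> M \<Longrightarrow> x \<in> vcarrier V"
    "\<And>x s y t. (x, s) \<in> M \<Longrightarrow> (y, t) \<in> M \<Longrightarrow> (vadd V x y, s + t) \<in> M"
    "\<And>x s c. (x, s) \<in> M \<Longrightarrow> (vscale V (of_real c) x, c * s) \<in> M"
    "\<And>x s. (x, s) \<in> M \<Longrightarrow> s \<le> p x"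
    using gM unfolding good_def by auto
  have M0: "(vzero V, 0) \<in> M" using G0(2) M(1) by auto
  have total: "\<exists>c. (x0, c) \<in> M" if x0: "x0 \<in> vcarrier V" for x0
  proof -
    \<comment> \<open>the values \<open>c\<close> allowed at \<open>x0\<close> lie between these lower bounds and the upper bounds \<open>p (y + x0) - t\<close>\<close>
    define L where "L = {s - p (vsub V x x0) | x s. (x, s) \<in> M}"
    have LR: "l \<le> p (vadd V y x0) - t" if l: "l \<in> L" and y: "(y, t) \<in> M" for l y t
    proof -
      obtain x s where xs: "(x, s) \<in> M" "l = s - p (vsub V x x0)" using l unfolding L_def by blast
      have c: "x \<in> vcarrier V" "y \<in> vcarrier V" using xs y M(2) by auto
      have "vadd V (vsub V x x0) (vadd V y x0) = vadd V (vadd V x y) (vadd V (vscale V (-1) x0) x0)"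
        using c x0 by (simp add: add_ac closed)
      also have "\<dots> = vadd V x y" using c x0 by (simp add: minus_add add_zero closed)
      finally have "p (vadd V x y) \<le> p (vsub V x x0) + p (vadd V y x0)"
        using p_add[of "vsub V x x0" "vadd V y x0"] c x0 by (simp add: closed)
      moreover have "s + t \<le> p (vadd V x y)" using M(3)[OF xs(1) y] M(5) by blast
      ultimately show ?thesis using xs by simp
    qed
    define c where "c = Sup L"
    have Lne: "L \<noteq> {}" unfolding L_def using M0 by blast
    have Lbd: "bdd_above L" using LR[OF _ M0] by (rule bdd_aboveI)
    have c1: "s - p (vsub V x x0) \<le> c" if "(x, s) \<in> M" for x s
      unfolding c_def using Lbd that by (intro cSup_upper) (auto simp: L_def)
    have c2: "c \<le> p (vadd V y x0) - t" if "(y, t) \<in> M" for y t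
      unfolding c_def using Lne LR[OF _ that] by (rule cSup_least)
    define M' where "M' = {(vadd V x (vscale V (of_real a) x0), s + a * c) | x s a. (x, s) \<in> M}"
    have in_M': "(vadd V x (vscale V (of_real a) x0), s + a * c) \<in> M'" if "(x, s) \<in> M" for x s a
      unfolding M'_def using that by blast
    have "M \<subseteq> M'"
    proof
      fix z assume z: "z \<in> M"
      obtain x s where zx: "z = (x, s)" by fastforce
      then show "z \<in> M'" using in_M'[of x s 0] z M(2)[of x s] x0 by (simp add: scale_zero_left add_zero)
    qed
    moreover have "good M'"
      unfolding good_def
    proof (intro conjI allI impI)
      show "G0 \<subseteq> M'" using M(1) \<open>M \<subseteq> M'\<close> by simp
      show "M' \<subseteq> vcarrier V \<times> UNIV" unfolding M'_def using M(2) x0 by (auto intro!: closed)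
    next
      fix x s y t assume "(x, s) \<in> M'" "(y, t) \<in> M'"
      then obtain x1 s1 a y1 t1 b where *: "(x1, s1) \<in> M" "(y1, t1) \<in> M"
        "x = vadd V x1 (vscale V (of_real a) x0)" "s = s1 + a * c"
        "y = vadd V y1 (vscale V (of_real b) x0)" "t = t1 + b * c" unfolding M'_def by blast
      have cl: "x1 \<in> vcarrier V" "y1 \<in> vcarrier V" using * M(2) by auto
      have "vadd V x y = vadd V (vadd V x1 y1) (vscale V (of_real (a + b)) x0)"
        using cl x0 by (simp add: * scale_add_left add_ac closed)
      moreover have "s + t = (s1 + t1) + (a + b) * c" by (simp add: * algebra_simps)
      ultimately show "(vadd V x y, s + t) \<in> M'" using in_M'[OF M(3)[OF *(1,2)], of "a + b"] by simp
    next
      fix x s d assume "(x, s) \<in> M'"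
      then obtain x1 s1 a where *: "(x1, s1) \<in> M"
        "x = vadd V x1 (vscale V (of_real a) x0)" "s = s1 + a * c" unfolding M'_def by blast
      have cl: "x1 \<in> vcarrier V" using * M(2) by auto
      have "vscale V (of_real d) x = vadd V (vscale V (of_real d) x1) (vscale V (of_real (d * a)) x0)"
        using cl x0 by (simp add: * scale_add_right scale_scale closed)
      moreover have "d * s = d * s1 + (d * a) * c" by (simp add: * algebra_simps)
      ultimately show "(vscale V (of_real d) x, d * s) \<in> M'" using in_M'[OF M(4)[OF *(1)], of d "d * a"] by simp
    next
      fix x s assume "(x, s) \<in> M'"
      then obtain x1 s1 a where *: "(x1, s1) \<in> M"
        "x = vadd V x1 (vscale V (of_real a) x0)" "s = s1 + a * c" unfolding M'_def by blast
      have cl: "x1 \<in> vcarrier V" using * M(2) by auto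
      consider "a = 0" | "0 < a" | "a < 0" by linarith
      then show "s \<le> p x"
      proof cases
        case 1
        then show ?thesis using * cl x0 M(5) by (simp add: scale_zero_left add_zero)
      next
        case 2
        define y where "y = vscale V (of_real (inverse a)) x1"
        have y: "y \<in> vcarrier V" using cl by (simp add: y_def closed)
        have "x = vscale V (of_real a) (vadd V y x0)"
          using cl x0 2 unfolding *(2) y_def
          by (simp add: scale_add_right scale_scale closed scale_one flip: of_real_mult)
        then have "p x = a * p (vadd V y x0)" using p_scale[of "vadd V y x0" a] 2 y x0 by (simp add: closed)
        moreover have "c \<le> p (vadd V y x0) - inverse a * s1"
          using c2 M(4)[OF *(1), of "inverse a"] unfolding y_def by blast
        then have "a * c \<le> a * (p (vadd V y x0) - inverse a * s1)" using 2 by (simp add: mult_left_mono)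
        ultimately show ?thesis using 2 by (simp add: *(3) right_diff_distrib mult.assoc[symmetric])
      next
        case 3
        define b where "b = - a"
        have b: "0 < b" using 3 b_def by simp
        define y where "y = vscale V (of_real (inverse b)) x1"
        have y: "y \<in> vcarrier V" using cl by (simp add: y_def closed)
        have "x = vscale V (of_real b) (vsub V y x0)"
          using cl x0 b unfolding *(2) y_def b_def
          by (simp add: scale_add_right scale_scale closed scale_one flip: of_real_mult)
        then have "p x = b * p (vsub V y x0)" using p_scale[of "vsub V y x0" b] b y x0 by (simp add: closed)
        moreover have "inverse b * s1 - p (vsub V y x0) \<le> c"
          using c1 M(4)[OF *(1), of "inverse b"] unfolding y_def by blast
        then have "b * (inverse b * s1 - p (vsub V y x0)) \<le> b * c" using b by (simp add: mult_left_mono)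
        ultimately show ?thesis using b by (simp add: *(3) right_diff_distrib b_def mult.assoc[symmetric])
      qed
    qed
    ultimately have "M' = M" using max by blast
    moreover have "(vadd V (vzero V) (vscale V (of_real 1) x0), 0 + 1 * c) \<in> M'" by (rule in_M'[OF M0])
    ultimately show ?thesis using x0 by (auto simp: zero_add scale_one)
  qed
  have unique: "s = t" if "(x, s) \<in> M" "(x, t) \<in> M" for x s t
  proof (rule ccontr)
    assume ne: "s \<noteq> t"
    have x: "x \<in> vcarrier V" using that M(2) by blast
    have "(vadd V x (vscale V (of_real (-1)) x), s + (-1) * t) \<in> M" using M(3,4) that by blast
    then have "(vzero V, s - t) \<in> M" using x by (simp add: add_minus)
    then have "(vscale V (of_real (1 / (s - t))) (vzero V), 1 / (s - t) * (s - t)) \<in> M" by (rule M(4))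
    then have "1 \<le> p (vzero V)" using M(5) ne by (fastforce simp: scale_zero_right)
    moreover have "p (vzero V) = 0" using p_scale[OF zero_closed, of 0] by (simp add: scale_zero_right)
    ultimately show False by simp
  qed
  define u where "u x = (THE s. (x, s) \<in> M)" for x
  have u_eq: "u x = s" if "(x, s) \<in> M" for x s
    unfolding u_def using that unique by (intro the_equality) blast+
  have uM: "(x, u x) \<in> M" if "x \<in> vcarrier V" for x using total[OF that] u_eq by blast
  show thesis
  proof (rule that[of u])
    show "u (vadd V x y) = u x + u y" if "x \<in> vcarrier V" "y \<in> vcarrier V" for x y
      using that uM M(3) u_eq by blast
    show "u (vscale V (of_real c) x) = c * u x" if "x \<in> vcarrier V" for c x
      using that uM M(4) u_eq by blast
    show "u x \<le> p x" if "x \<in> vcarrier V" for x using that uM M(5) by blast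
    show "u x = s" if "(x, s) \<in> G0" for x s using that M(1) u_eq by blast
  qed
qed

lemma (in normed_space) linear_scalar_iff:
  "linear_between V scalar_space f \<longleftrightarrow>
    (\<forall>x\<in>vcarrier V. \<forall>y\<in>vcarrier V. f (vadd V x y) = f x + f y) \<and>
    (\<forall>c. \<forall>x\<in>vcarrier V. f (vscale V c x) = c * f x)"
  by (simp add: linear_between_def scalar_space_def)

text \<open>The real part of \<open>h\<close> is extended to a real functional \<open>u\<close>, and \<open>f\<close> is recovered as
\<open>f x = u x - iu * u (iu x)\<close>. Over the reals \<open>iu = 0\<close> and this is \<open>u\<close>, so that one formula serves both
fields. The bound follows by rotating \<open>f x\<close> onto the positive reals.\<close>

lemma (in normed_space) Hahn_Banach:
  fixes p :: "'a \<Rightarrow> real" and h :: "'a \<Rightarrow> 'k"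
  assumes p_add: "\<And>x y. x \<in> vcarrier V \<Longrightarrow> y \<in> vcarrier V \<Longrightarrow> p (vadd V x y) \<le> p x + p y"
    and p_scale: "\<And>c x. x \<in> vcarrier V \<Longrightarrow> p (vscale V c x) = norm c * p x"
    and M: "M \<subseteq> vcarrier V" "vzero V \<in> M" "\<And>x y. x \<in> M \<Longrightarrow> y \<in> M \<Longrightarrow> vadd V x y \<in> M"
      "\<And>c x. x \<in> M \<Longrightarrow> vscale V c x \<in> M"
    and h_add: "\<And>x y. x \<in> M \<Longrightarrow> y \<in> M \<Longrightarrow> h (vadd V x y) = h x + h y"
    and h_scale: "\<And>c x. x \<in> M \<Longrightarrow> h (vscale V c x) = c * h x"
    and h_le: "\<And>x. x \<in> M \<Longrightarrow> norm (h x) \<le> p x"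
  obtains f where "linear_between V scalar_space f"
    "\<And>x. x \<in> vcarrier V \<Longrightarrow> norm (f x) \<le> p x" "\<And>x. x \<in> M \<Longrightarrow> f x = h x"
proof -
  obtain u where u_add: "\<And>x y. x \<in> vcarrier V \<Longrightarrow> y \<in> vcarrier V \<Longrightarrow> u (vadd V x y) = u x + u y"
    and u_scale: "\<And>c x. x \<in> vcarrier V \<Longrightarrow> u (vscale V (of_real c) x) = c * u x"
    and u_le: "\<And>x. x \<in> vcarrier V \<Longrightarrow> u x \<le> p x"
    and u_h: "\<And>x s. (x, s) \<in> (\<lambda>x. (x, kre (h x))) ` M \<Longrightarrow> u x = s"
  proof (rule real_Hahn_Banach[of p "(\<lambda>x. (x, kre (h x))) ` M"])
    have "h (vzero V) = 0" using h_scale[OF M(2), of 0] by (simp add: scale_zero_right)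
    then show "(vzero V, 0) \<in> (\<lambda>x. (x, kre (h x))) ` M"
      using M(2) kre_of_real[of 0, where 'a = 'k] by force
    show "s \<le> p x" if "(x, s) \<in> (\<lambda>x. (x, kre (h x))) ` M" for x s
      using that h_le abs_kre_le by (smt (verit) image_iff prod.inject)
  qed (use M in \<open>auto simp: p_add p_scale h_add h_scale kre_add kre_mult_real\<close>)
  define f :: "'a \<Rightarrow> 'k" where "f x = of_real (u x) - iu * of_real (u (vscale V iu x))" for x
  have kf: "kre (f x) = u x" for x
  proof -
    have "f x = of_real (u x) + of_real (- u (vscale V iu x)) * iu" unfolding f_def by simp
    then show ?thesis by (metis kre_parts)
  qed
  have f_add: "f (vadd V x y) = f x + f y" if "x \<in> vcarrier V" "y \<in> vcarrier V" for x y
    using that by (simp add: f_def u_add scale_add_right closed algebra_simps)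
  have f_real: "f (vscale V (of_real c) x) = of_real c * f x" if "x \<in> vcarrier V" for c x
  proof -
    have "vscale V iu (vscale V (of_real c) x) = vscale V (of_real c) (vscale V iu x)"
      using that by (simp add: scale_scale mult.commute)
    then show ?thesis using that by (simp add: f_def u_scale closed algebra_simps)
  qed
  have f_iu: "f (vscale V iu x) = iu * f x" if x: "x \<in> vcarrier V" for x
  proof (cases rule: iu_cases[where 'k = 'k])
    case 1
    then show ?thesis using x u_scale[of x 0] u_scale[of "vzero V" 0]
      by (simp add: f_def scale_zero_left zero_closed scale_zero_right)
  next
    case 2
    have "vscale V iu (vscale V iu x) = vscale V (of_real (-1)) x" using x 2(1) by (simp add: scale_scale)
    then have "u (vscale V iu (vscale V iu x)) = - u x" using u_scale[OF x, of "-1"] by simp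
    moreover have "iu * (iu * z) = - z" for z :: 'k by (simp add: 2(1) flip: mult.assoc)
    ultimately show ?thesis by (simp add: f_def right_diff_distrib)
  qed
  have f_scale: "f (vscale V c x) = c * f x" if x: "x \<in> vcarrier V" for c x
  proof -
    have "vscale V c x = vadd V (vscale V (of_real (kre c)) x) (vscale V (of_real (kim c)) (vscale V iu x))"
      using x by (subst kre_kim[of c, symmetric]) (simp add: scale_add_left scale_scale)
    then have "f (vscale V c x) = (of_real (kre c) + of_real (kim c) * iu) * f x"
      using x by (simp add: f_add f_real f_iu closed algebra_simps)
    then show ?thesis by (simp only: kre_kim)
  qed
  show thesis
  proof (rule that)
    show "linear_between V scalar_space f" unfolding linear_scalar_iff using f_add f_scale by blast
    show "norm (f x) \<le> p x" if x: "x \<in> vcarrier V" for x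
    proof (cases "f x = 0")
      case True
      then show ?thesis using p_scale[OF x, of "-1"] p_scale[OF x, of 0] p_add[OF x scale_closed[OF x, of "-1"]]
        add_minus[OF x] scale_zero_left[OF x] by simp
    next
      case False
      define c where "c = of_real (norm (f x)) / f x"
      have "norm c = 1" using False by (simp add: c_def norm_divide)
      have "f (vscale V c x) = of_real (norm (f x))" using False x by (simp add: f_scale c_def)
      then have "norm (f x) = u (vscale V c x)" using kf[of "vscale V c x"] by simp
      also have "\<dots> \<le> p x" using u_le[of "vscale V c x"] x p_scale[OF x, of c] \<open>norm c = 1\<close> by (simp add: closed)
      finally show ?thesis .
    qed
    show "f x = h x" if x: "x \<in> M" for x
    proof -
      have 1: "u x = kre (h x)" using u_h x by blast
      have "u (vscale V iu x) = kre (h (vscale V iu x))" using u_h M(4)[OF x] by blast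
      then have "u (vscale V iu x) = - kim (h x)" using h_scale[OF x] kre_iu by metis
      then have "f x = of_real (kre (h x)) + of_real (kim (h x)) * iu" using 1 by (simp add: f_def)
      then show ?thesis by (simp only: kre_kim)
    qed
  qed
qed

section \<open>The dual space\<close>

context normed_space
begin

lemma dual_iff:
  "f \<in> vcarrier (dual_space V) \<longleftrightarrow> f \<in> extensional (vcarrier V) \<and> linear_between V scalar_space f \<and>
     (\<exists>K. \<forall>x\<in>vcarrier V. norm (f x) \<le> K * vnorm V x)"
  using linear_continuous_iff[OF normed_space_scalar, of f]
  unfolding dual_space_def norm_topology_scalar by (auto simp: scalar_space_def)

lemma dual_extensional: "f \<in> vcarrier (dual_space V) \<Longrightarrow> f \<in> extensional (vcarrier V)"
  and dual_linear: "f \<in> vcarrier (dual_space V) \<Longrightarrow> linear_between V scalar_space f"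
  unfolding dual_iff by auto

lemma dual_add:
  "\<lbrakk>f \<in> vcarrier (dual_space V); x \<in> vcarrier V; y \<in> vcarrier V\<rbrakk> \<Longrightarrow> f (vadd V x y) = f x + f y"
  and dual_scale:
  "\<lbrakk>f \<in> vcarrier (dual_space V); x \<in> vcarrier V\<rbrakk> \<Longrightarrow> f (vscale V c x) = c * f x"
  using dual_linear linear_scalar_iff by blast+

lemma dual_vsub:
  "\<lbrakk>f \<in> vcarrier (dual_space V); x \<in> vcarrier V; y \<in> vcarrier V\<rbrakk> \<Longrightarrow> f (vsub V x y) = f x - f y"
  by (simp add: dual_add dual_scale closed)

lemma dual_vzero: "f \<in> vcarrier (dual_space V) \<Longrightarrow> f (vzero V) = 0"
  using dual_scale[OF _ zero_closed, of f 0] by (simp add: scale_zero_right)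

lemma dual_bounded_ball:
  assumes "f \<in> vcarrier (dual_space V)"
  shows "bdd_above ((\<lambda>x. norm (f x)) ` {x \<in> vcarrier V. vnorm V x \<le> 1})"
proof -
  obtain K where K: "\<And>x. x \<in> vcarrier V \<Longrightarrow> norm (f x) \<le> K * vnorm V x" using assms dual_iff by blast
  show ?thesis
  proof (rule bdd_aboveI2)
    fix x assume "x \<in> {x \<in> vcarrier V. vnorm V x \<le> 1}"
    then have x: "x \<in> vcarrier V" "vnorm V x \<le> 1" "0 \<le> vnorm V x" by (auto simp: norm_nonneg)
    have "K * vnorm V x \<le> \<bar>K\<bar> * 1" using x by (intro mult_mono) auto
    then show "norm (f x) \<le> \<bar>K\<bar>" using K[OF x(1)] by simp
  qed
qed

lemma dual_norm_def: "vnorm (dual_space V) f = (SUP x\<in>{x \<in> vcarrier V. vnorm V x \<le> 1}. norm (f x))"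
  by (simp add: dual_space_def)

lemma dual_norm_leI:
  assumes "\<And>x. x \<in> vcarrier V \<Longrightarrow> norm (f x) \<le> K * vnorm V x" "0 \<le> K"
  shows "vnorm (dual_space V) f \<le> K"
  unfolding dual_norm_def
proof (rule cSUP_least)
  show "{x \<in> vcarrier V. vnorm V x \<le> 1} \<noteq> {}" using zero_closed by force
  fix x assume "x \<in> {x \<in> vcarrier V. vnorm V x \<le> 1}"
  then show "norm (f x) \<le> K" using assms(1)[of x] mult_left_mono[of "vnorm V x" 1 K] assms(2) by auto
qed

lemma dual_norm_nonneg: "f \<in> vcarrier (dual_space V) \<Longrightarrow> 0 \<le> vnorm (dual_space V) f"
  unfolding dual_norm_def using zero_closed
  by (intro cSUP_upper2[OF dual_bounded_ball, of f "vzero V"]) auto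

lemma dual_bound:
  assumes f: "f \<in> vcarrier (dual_space V)" and x: "x \<in> vcarrier V"
  shows "norm (f x) \<le> vnorm (dual_space V) f * vnorm V x"
proof (cases "vnorm V x = 0")
  case True
  then show ?thesis using x norm_eq_zero dual_vzero[OF f] by simp
next
  case False
  then have pos: "0 < vnorm V x" using norm_nonneg[OF x] by simp
  define y where "y = vscale V (of_real (inverse (vnorm V x))) x"
  have "vnorm V y = 1" using pos x norm_scale[OF x, of "of_real (inverse (vnorm V x))"]
    by (simp add: y_def del: of_real_inverse)
  then have "y \<in> {x \<in> vcarrier V. vnorm V x \<le> 1}" using x by (simp add: y_def closed)
  then have "norm (f y) \<le> vnorm (dual_space V) f"
    unfolding dual_norm_def by (rule cSUP_upper[OF _ dual_bounded_ball[OF f]])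
  moreover have "norm (f y) = inverse (vnorm V x) * norm (f x)"
    using pos x by (simp add: y_def dual_scale[OF f x] norm_mult del: of_real_inverse)
  ultimately show ?thesis using pos by (simp add: field_simps)
qed

lemma dual_restrictI:
  assumes "linear_between V scalar_space f" "\<And>x. x \<in> vcarrier V \<Longrightarrow> norm (f x) \<le> K * vnorm V x"
  shows "restrict f (vcarrier V) \<in> vcarrier (dual_space V)"
  unfolding dual_iff using assms by (auto simp: linear_scalar_iff closed)

lemma dual_ext:
  assumes "f \<in> vcarrier (dual_space V)" "g \<in> vcarrier (dual_space V)"
    "\<And>x. x \<in> vcarrier V \<Longrightarrow> f x = g x"
  shows "f = g"
  using assms dual_extensional by (intro extensionalityI[of f "vcarrier V"]) auto

lemma dual_ops:
  "vadd (dual_space V) f g = (\<lambda>x\<in>vcarrier V. f x + g x)"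
  "vzero (dual_space V) = (\<lambda>x\<in>vcarrier V. 0)"
  "vscale (dual_space V) c f = (\<lambda>x\<in>vcarrier V. c * f x)"
  by (simp_all add: dual_space_def)

lemma normed_space_dual: "normed_space (dual_space V)"
proof
  show z: "vzero (dual_space V) \<in> vcarrier (dual_space V)"
    unfolding dual_ops by (rule dual_restrictI[of _ 0]) (auto simp: linear_scalar_iff)
  show cadd: "vadd (dual_space V) f g \<in> vcarrier (dual_space V)"
    if "f \<in> vcarrier (dual_space V)" "g \<in> vcarrier (dual_space V)" for f g
    unfolding dual_ops
  proof (rule dual_restrictI)
    show "norm (f x + g x) \<le> (vnorm (dual_space V) f + vnorm (dual_space V) g) * vnorm V x"
      if "x \<in> vcarrier V" for x
      using dual_bound[OF \<open>f \<in> _\<close> that] dual_bound[OF \<open>g \<in> _\<close> that] norm_triangle_ineq[of "f x" "g x"]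
      by (simp add: distrib_right)
  qed (use that in \<open>simp add: linear_scalar_iff dual_add dual_scale algebra_simps\<close>)
  show csc: "vscale (dual_space V) c f \<in> vcarrier (dual_space V)"
    if "f \<in> vcarrier (dual_space V)" for f c
    unfolding dual_ops
  proof (rule dual_restrictI)
    show "norm (c * f x) \<le> (norm c * vnorm (dual_space V) f) * vnorm V x"
      if "x \<in> vcarrier V" for x
      using dual_bound[OF \<open>f \<in> _\<close> that] by (simp add: norm_mult mult.assoc mult_left_mono)
  qed (use that in \<open>simp add: linear_scalar_iff dual_add dual_scale algebra_simps\<close>)
  show "vnorm (dual_space V) (vscale (dual_space V) c f) = norm c * vnorm (dual_space V) f"
    if f: "f \<in> vcarrier (dual_space V)" for f c
  proof -
    have le: "vnorm (dual_space V) (vscale (dual_space V) c f) \<le> norm c * vnorm (dual_space V) f"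
      if f: "f \<in> vcarrier (dual_space V)" for f c
      unfolding dual_ops
      by (rule dual_norm_leI)
         (use dual_bound[OF f] dual_norm_nonneg[OF f] in \<open>simp_all add: norm_mult mult.assoc mult_left_mono\<close>)
    show ?thesis
    proof (cases "c = 0")
      case True
      then show ?thesis using le[OF f, of c] dual_norm_nonneg[OF csc[OF f, of c]] by simp
    next
      case False
      have "vscale (dual_space V) (inverse c) (vscale (dual_space V) c f) = f"
        by (rule dual_ext[OF csc[OF csc[OF f]] f]) (use False in \<open>simp add: dual_ops\<close>)
      then have "vnorm (dual_space V) f \<le> inverse (norm c) * vnorm (dual_space V) (vscale (dual_space V) c f)"
        using le[OF csc[OF f, of c], of "inverse c"] by (simp add: norm_inverse)
      then show ?thesis using le[OF f, of c] False by (simp add: field_simps)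
    qed
  qed
  show "vnorm (dual_space V) f = 0 \<longleftrightarrow> f = vzero (dual_space V)" if f: "f \<in> vcarrier (dual_space V)" for f
  proof
    assume *: "vnorm (dual_space V) f = 0"
    show "f = vzero (dual_space V)"
      by (rule dual_ext[OF f z]) (use dual_bound[OF f] * in \<open>simp add: dual_ops\<close>)
  next
    assume *: "f = vzero (dual_space V)"
    have "vnorm (dual_space V) f \<le> 0" unfolding * dual_ops by (rule dual_norm_leI) auto
    then show "vnorm (dual_space V) f = 0" using dual_norm_nonneg[OF f] by simp
  qed
  show "vnorm (dual_space V) (vadd (dual_space V) f g) \<le> vnorm (dual_space V) f + vnorm (dual_space V) g"
    if f: "f \<in> vcarrier (dual_space V)" and g: "g \<in> vcarrier (dual_space V)" for f g
    unfolding dual_ops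
  proof (rule dual_norm_leI)
    show "norm ((\<lambda>x\<in>vcarrier V. f x + g x) x) \<le> (vnorm (dual_space V) f + vnorm (dual_space V) g) * vnorm V x"
      if "x \<in> vcarrier V" for x
      using dual_bound[OF f that] dual_bound[OF g that] norm_triangle_ineq[of "f x" "g x"] that
      by (simp add: distrib_right)
  qed (simp add: dual_norm_nonneg f g)
  show "\<exists>g\<in>vcarrier (dual_space V). vadd (dual_space V) f g = vzero (dual_space V)"
    if "f \<in> vcarrier (dual_space V)" for f
    by (rule bexI[OF _ csc[OF that, of "-1"]]) (auto simp: dual_ops)
  show "vadd (dual_space V) f (vzero (dual_space V)) = f" if "f \<in> vcarrier (dual_space V)" for f
    by (rule dual_ext[OF cadd[OF that z] that]) (simp add: dual_ops)
  show "vscale (dual_space V) 1 f = f" if "f \<in> vcarrier (dual_space V)" for f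
    by (rule dual_ext[OF csc[OF that] that]) (simp add: dual_ops)
qed (auto simp: dual_ops algebra_simps fun_eq_iff)

lemma in_dual_ball_iff:
  assumes "f \<in> vcarrier (dual_space V)"
  shows "vnorm (dual_space V) f \<le> K \<longleftrightarrow> 0 \<le> K \<and> (\<forall>x\<in>vcarrier V. norm (f x) \<le> K * vnorm V x)"
proof
  assume *: "vnorm (dual_space V) f \<le> K"
  have "vnorm (dual_space V) f * vnorm V x \<le> K * vnorm V x" if "x \<in> vcarrier V" for x
    using * norm_nonneg[OF that] by (rule mult_right_mono)
  then show "0 \<le> K \<and> (\<forall>x\<in>vcarrier V. norm (f x) \<le> K * vnorm V x)"
    using * dual_norm_nonneg[OF assms] dual_bound[OF assms] by (meson order.trans)
next
  assume "0 \<le> K \<and> (\<forall>x\<in>vcarrier V. norm (f x) \<le> K * vnorm V x)"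
  then show "vnorm (dual_space V) f \<le> K" by (intro dual_norm_leI) auto
qed

section \<open>Consequences of the Hahn-Banach theorem\<close>

lemma Hahn_Banach_bounded:
  fixes h :: "'a \<Rightarrow> 'k"
  assumes M: "M \<subseteq> vcarrier V" "vzero V \<in> M" "\<And>x y. x \<in> M \<Longrightarrow> y \<in> M \<Longrightarrow> vadd V x y \<in> M"
      "\<And>c x. x \<in> M \<Longrightarrow> vscale V c x \<in> M"
    and h_add: "\<And>x y. x \<in> M \<Longrightarrow> y \<in> M \<Longrightarrow> h (vadd V x y) = h x + h y"
    and h_scale: "\<And>c x. x \<in> M \<Longrightarrow> h (vscale V c x) = c * h x"
    and h_le: "\<And>x. x \<in> M \<Longrightarrow> norm (h x) \<le> K * vnorm V x" and K: "0 \<le> K"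
  obtains f where "f \<in> vcarrier (dual_space V)" "vnorm (dual_space V) f \<le> K" "\<And>x. x \<in> M \<Longrightarrow> f x = h x"
proof -
  obtain f where f: "linear_between V scalar_space f"
    "\<And>x. x \<in> vcarrier V \<Longrightarrow> norm (f x) \<le> K * vnorm V x" "\<And>x. x \<in> M \<Longrightarrow> f x = h x"
  proof (rule Hahn_Banach[of "\<lambda>x. K * vnorm V x" M h])
    show "K * vnorm V (vadd V x y) \<le> K * vnorm V x + K * vnorm V y"
      if "x \<in> vcarrier V" "y \<in> vcarrier V" for x y
      using norm_triangle[OF that] K by (metis distrib_left mult_left_mono)
  qed (use assms in \<open>auto simp: norm_scale\<close>)
  show thesis
  proof (rule that[of "restrict f (vcarrier V)"])
    show "restrict f (vcarrier V) \<in> vcarrier (dual_space V)" by (rule dual_restrictI[OF f(1,2)])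
    show "vnorm (dual_space V) (restrict f (vcarrier V)) \<le> K"
      by (rule dual_norm_leI) (use f(2) K in auto)
  qed (use f(3) M(1) in auto)
qed

text \<open>The functional is prescribed on the line through \<open>a\<close>. With the distance to a subspace as \<open>p\<close> it vanishes
on that subspace, which is how the lemma enters Helly's theorem.\<close>

lemma seminorm_functional:
  assumes p_add: "\<And>x y. x \<in> vcarrier V \<Longrightarrow> y \<in> vcarrier V \<Longrightarrow> p (vadd V x y) \<le> p x + p y"
    and p_scale: "\<And>c x. x \<in> vcarrier V \<Longrightarrow> p (vscale V c x) = norm c * p x"
    and p_le: "\<And>x. x \<in> vcarrier V \<Longrightarrow> p x \<le> vnorm V x"
    and a: "a \<in> vcarrier V" and pa: "0 < p a"
  obtains f where "f \<in> vcarrier (dual_space V)" "\<And>x. x \<in> vcarrier V \<Longrightarrow> norm (f x) \<le> p x"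
    "f a = of_real (p a)"
proof -
  have inj: "c = d" if "vscale V c a = vscale V d a" for c d
  proof -
    have "vscale V (c - d) a = vadd V (vscale V c a) (vscale V (-1) (vscale V d a))"
      using a scale_add_left[OF a, of c "- d"] by (simp add: scale_scale)
    also have "\<dots> = vzero V" using that a by (simp add: add_minus closed)
    finally have "norm (c - d) * p a = p (vzero V)" using p_scale[OF a] by metis
    also have "\<dots> = 0" using p_scale[OF zero_closed, of 0] by (simp add: scale_zero_right)
    finally show ?thesis using pa by simp
  qed
  define h where "h x = (THE c. x = vscale V c a) * of_real (p a)" for x
  have h: "h (vscale V c a) = c * of_real (p a)" for c
    unfolding h_def using inj by (metis (mono_tags, lifting) the_equality)
  obtain f where f: "linear_between V scalar_space f"
    "\<And>x. x \<in> vcarrier V \<Longrightarrow> norm (f x) \<le> p x" "\<And>x. x \<in> range (\<lambda>c. vscale V c a) \<Longrightarrow> f x = h x"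
  proof (rule Hahn_Banach[of p "range (\<lambda>c. vscale V c a)" h])
    show "vzero V \<in> range (\<lambda>c. vscale V c a)" using scale_zero_left[OF a] by (metis rangeI)
    show "vadd V x y \<in> range (\<lambda>c. vscale V c a)" if "x \<in> range (\<lambda>c. vscale V c a)" "y \<in> range (\<lambda>c. vscale V c a)" for x y
      using that a by (auto simp: scale_add_left[symmetric])
    show "vscale V c x \<in> range (\<lambda>c. vscale V c a)" if "x \<in> range (\<lambda>c. vscale V c a)" for x c
      using that a by (auto simp: scale_scale)
    show "h (vadd V x y) = h x + h y" if "x \<in> range (\<lambda>c. vscale V c a)" "y \<in> range (\<lambda>c. vscale V c a)" for x y
      using that a by (auto simp: scale_add_left[symmetric] h distrib_right)
    show "h (vscale V c x) = c * h x" if "x \<in> range (\<lambda>c. vscale V c a)" for x c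
      using that a by (auto simp: scale_scale h)
    show "norm (h x) \<le> p x" if "x \<in> range (\<lambda>c. vscale V c a)" for x
      using that a pa by (auto simp: h norm_mult p_scale)
  qed (use p_add p_scale a in \<open>auto simp: closed\<close>)
  show thesis
  proof (rule that[of "restrict f (vcarrier V)"])
    show "restrict f (vcarrier V) \<in> vcarrier (dual_space V)"
      by (rule dual_restrictI[OF f(1), of 1]) (use f(2) p_le in \<open>fastforce intro: order.trans\<close>)
    have "f (vscale V 1 a) = of_real (p a)" using f(3)[of "vscale V 1 a"] h[of 1] by simp
    then show "restrict f (vcarrier V) a = of_real (p a)" using a by (simp add: scale_one)
  qed (use f(2) in auto)
qed

lemma norming_functional:
  assumes a: "a \<in> vcarrier V"
  obtains f where "f \<in> vcarrier (dual_space V)" "vnorm (dual_space V) f \<le> 1" "f a = of_real (vnorm V a)"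
proof (cases "vnorm V a = 0")
  case True
  have "vnorm (dual_space V) (vzero (dual_space V)) \<le> 1"
    using normed_space.norm_zero[OF normed_space_dual] by simp
  then show thesis using that[of "vzero (dual_space V)"] normed_space.zero_closed[OF normed_space_dual] a True
    by (simp add: dual_ops)
next
  case False
  then have "0 < vnorm V a" using norm_nonneg[OF a] by simp
  then obtain f where f: "f \<in> vcarrier (dual_space V)" "\<And>x. x \<in> vcarrier V \<Longrightarrow> norm (f x) \<le> vnorm V x"
    "f a = of_real (vnorm V a)"
    using seminorm_functional[of "vnorm V", OF norm_triangle norm_scale order.refl a] by blast
  moreover have "vnorm (dual_space V) f \<le> 1" using f(2) by (intro dual_norm_leI) auto
  ultimately show thesis using that by blast
qed

lemma norm_leI:
  assumes "a \<in> vcarrier V"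
    "\<And>f. f \<in> vcarrier (dual_space V) \<Longrightarrow> vnorm (dual_space V) f \<le> 1 \<Longrightarrow> norm (f a) \<le> K"
  shows "vnorm V a \<le> K"
proof -
  obtain f where "f \<in> vcarrier (dual_space V)" "vnorm (dual_space V) f \<le> 1" "f a = of_real (vnorm V a)"
    by (rule norming_functional[OF assms(1)])
  then show ?thesis using assms(2)[of f] norm_nonneg[OF assms(1)] by simp
qed

lemma dual_separates:
  assumes "a \<in> vcarrier V" "b \<in> vcarrier V" "\<And>f. f \<in> vcarrier (dual_space V) \<Longrightarrow> f a = f b"
  shows "a = b"
proof -
  have "vnorm V (vsub V a b) \<le> 0"
    by (rule norm_leI) (use assms in \<open>auto simp: closed dual_vsub\<close>)
  then have "vdist V a b = 0" using assms norm_nonneg[of "vsub V a b"] by (simp add: vdist_eq closed)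
  then show ?thesis using Metric_space.zero[OF Metric_space_vdist] assms by blast
qed

lemma dual_ball_bound:
  "\<lbrakk>f \<in> vcarrier (dual_space V); vnorm (dual_space V) f \<le> K; x \<in> vcarrier V\<rbrakk> \<Longrightarrow> norm (f x) \<le> K * vnorm V x"
  using in_dual_ball_iff by blast

text \<open>This takes the place of the Banach-Alaoglu theorem: a bounded sequence of functionals has a limit
functional along the ultrafilter.\<close>

lemma ulim_functional:
  assumes f: "\<And>n. f n \<in> vcarrier (dual_space V)" "\<And>n. vnorm (dual_space V) (f n) \<le> K"
  shows "(\<lambda>x\<in>vcarrier V. ulim (\<lambda>n. f n x)) \<in> vcarrier (dual_space V)"
    and "\<And>x. x \<in> vcarrier V \<Longrightarrow> ((\<lambda>n. f n x) \<longlongrightarrow> ulim (\<lambda>n. f n x)) uf"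
    and "vnorm (dual_space V) (\<lambda>x\<in>vcarrier V. ulim (\<lambda>n. f n x)) \<le> K"
proof -
  have b: "norm (f n x) \<le> K * vnorm V x" if "x \<in> vcarrier V" for n x
    using dual_ball_bound f that by blast
  show lim: "((\<lambda>n. f n x) \<longlongrightarrow> ulim (\<lambda>n. f n x)) uf" if "x \<in> vcarrier V" for x
    by (rule ulim_scalar) (rule b[OF that])
  have lin: "linear_between V scalar_space (\<lambda>x. ulim (\<lambda>n. f n x))"
    unfolding linear_scalar_iff
  proof (intro conjI ballI allI)
    show "ulim (\<lambda>n. f n (vadd V x y)) = ulim (\<lambda>n. f n x) + ulim (\<lambda>n. f n y)"
      if "x \<in> vcarrier V" "y \<in> vcarrier V" for x y
      using tendsto_add[OF lim[OF that(1)] lim[OF that(2)]] that f(1) by (intro ulim_eq) (simp add: dual_add)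
    show "ulim (\<lambda>n. f n (vscale V c x)) = c * ulim (\<lambda>n. f n x)" if "x \<in> vcarrier V" for x c
      using tendsto_mult[OF tendsto_const[of c] lim[OF that]] that f(1) by (intro ulim_eq) (simp add: dual_scale)
  qed
  have bd: "norm (ulim (\<lambda>n. f n x)) \<le> K * vnorm V x" if "x \<in> vcarrier V" for x
    by (rule tendsto_upperbound[OF tendsto_norm[OF lim[OF that]]]) (use b that in auto)
  show "(\<lambda>x\<in>vcarrier V. ulim (\<lambda>n. f n x)) \<in> vcarrier (dual_space V)" by (rule dual_restrictI[OF lin bd])
  show "vnorm (dual_space V) (\<lambda>x\<in>vcarrier V. ulim (\<lambda>n. f n x)) \<le> K"
  proof (rule dual_norm_leI)
    show "0 \<le> K" using f dual_norm_nonneg order.trans by blast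
  qed (use bd in auto)
qed

end

section \<open>Functionals with nested kernels\<close>

text \<open>Either some vector is annihilated by all earlier \<open>L i\<close> but not by \<open>L n\<close>; then a multiple of \<open>L n\<close> can be
subtracted from \<open>\<psi>\<close> so that the difference vanishes where the earlier \<open>L i\<close> do. Or there is no such
vector, and \<open>L n\<close> can be omitted.\<close>

lemma (in normed_space) kernel_lemma:
  fixes L :: "nat \<Rightarrow> 'a \<Rightarrow> 'k"
  assumes "\<And>i. i < n \<Longrightarrow> linear_between V scalar_space (L i)" "linear_between V scalar_space \<psi>"
    "\<And>x. x \<in> vcarrier V \<Longrightarrow> (\<And>i. i < n \<Longrightarrow> L i x = 0) \<Longrightarrow> \<psi> x = 0"
  shows "\<exists>c. \<forall>x\<in>vcarrier V. \<psi> x = (\<Sum>i<n. c i * L i x)"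
  using assms
proof (induction n arbitrary: \<psi>)
  case 0
  then show ?case by auto
next
  case (Suc n)
  have lin: "f (vadd V x y) = f x + f y" "f (vscale V c x) = c * f x"
    if "linear_between V scalar_space f" "x \<in> vcarrier V" "y \<in> vcarrier V" for f x y c
    using that unfolding linear_scalar_iff by auto
  have L: "linear_between V scalar_space (L i)" if "i \<le> n" for i using Suc.prems(1) that by simp
  show ?case
  proof (cases "\<exists>w\<in>vcarrier V. (\<forall>i<n. L i w = 0) \<and> L n w \<noteq> 0")
    case True
    then obtain w0 where w0: "w0 \<in> vcarrier V" "\<And>i. i < n \<Longrightarrow> L i w0 = 0" "L n w0 \<noteq> 0" by blast
    define w where "w = vscale V (inverse (L n w0)) w0"
    have w: "w \<in> vcarrier V" "\<And>i. i < n \<Longrightarrow> L i w = 0" "L n w = 1"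
      using w0 L by (auto simp: w_def closed lin)
    define \<psi>' where "\<psi>' x = \<psi> x - \<psi> w * L n x" for x
    have "\<exists>c. \<forall>x\<in>vcarrier V. \<psi>' x = (\<Sum>i<n. c i * L i x)"
    proof (rule Suc.IH)
      show "linear_between V scalar_space \<psi>'"
        unfolding linear_scalar_iff \<psi>'_def using Suc.prems(2) L[of n] by (auto simp: lin algebra_simps)
      fix x assume x: "x \<in> vcarrier V" "\<And>i. i < n \<Longrightarrow> L i x = 0"
      define z where "z = vadd V x (vscale V (- L n x) w)"
      have z: "z \<in> vcarrier V" using x w by (simp add: z_def closed)
      have "L i z = 0" if "i < Suc n" for i
        using that x w L[of i] by (cases "i = n") (auto simp: z_def lin closed)
      then have "\<psi> z = 0" using Suc.prems(3)[OF z] by blast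
      then show "\<psi>' x = 0" using x w Suc.prems(2) by (simp add: z_def \<psi>'_def lin closed)
    qed (use L in auto)
    then obtain c where c: "\<And>x. x \<in> vcarrier V \<Longrightarrow> \<psi>' x = (\<Sum>i<n. c i * L i x)" by blast
    show ?thesis
    proof (intro exI[of _ "\<lambda>i. if i < n then c i else \<psi> w"] ballI)
      fix x assume "x \<in> vcarrier V"
      then show "\<psi> x = (\<Sum>i<Suc n. (if i < n then c i else \<psi> w) * L i x)"
        using c[of x] by (simp add: \<psi>'_def algebra_simps)
    qed
  next
    case False
    have "\<exists>c. \<forall>x\<in>vcarrier V. \<psi> x = (\<Sum>i<n. c i * L i x)"
    proof (rule Suc.IH)
      fix x assume x: "x \<in> vcarrier V" "\<And>i. i < n \<Longrightarrow> L i x = 0"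
      then have "L n x = 0" using False by blast
      then show "\<psi> x = 0" using Suc.prems(3)[OF x(1)] x(2) less_Suc_eq by metis
    qed (use L Suc.prems in auto)
    then obtain c where c: "\<And>x. x \<in> vcarrier V \<Longrightarrow> \<psi> x = (\<Sum>i<n. c i * L i x)" by blast
    show ?thesis
      by (intro exI[of _ "\<lambda>i. if i < n then c i else 0"] ballI) (simp add: c)
  qed
qed

section \<open>Completeness\<close>

lemma (in banach_space) Cauchy_converges:
  assumes s: "\<And>n. s n \<in> vcarrier V"
    and C: "\<And>e. 0 < e \<Longrightarrow> \<exists>N. \<forall>m\<ge>N. \<forall>n\<ge>N. vnorm V (vsub V (s m) (s n)) < e"
  obtains l where "l \<in> vcarrier V" "(\<lambda>n. vnorm V (vsub V (s n) l)) \<longlonglongrightarrow> 0"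
proof -
  interpret M: Metric_space "vcarrier V" "vdist V" by (rule Metric_space_vdist)
  have "M.MCauchy s"
    unfolding M.MCauchy_def
  proof (intro conjI allI impI)
    show "range s \<subseteq> vcarrier V" using s by auto
    fix e :: real assume "0 < e"
    then show "\<exists>N. \<forall>n n'. N \<le> n \<longrightarrow> N \<le> n' \<longrightarrow> vdist V (s n) (s n') < e"
      using C[of e] s by (auto simp: vdist_eq)
  qed
  then obtain l where "limitin (norm_topology V) s l sequentially"
    using complete unfolding M.mcomplete_def norm_topology_def by blast
  then show thesis using that limitin_norm[of s l] s by blast
qed

lemma (in normed_space) banach_spaceI:
  assumes "\<And>s. (\<And>n. s n \<in> vcarrier V) \<Longrightarrow>
      (\<And>e. 0 < e \<Longrightarrow> \<exists>N. \<forall>m\<ge>N. \<forall>n\<ge>N. vnorm V (vsub V (s m) (s n)) < e) \<Longrightarrow>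
      \<exists>l\<in>vcarrier V. (\<lambda>n. vnorm V (vsub V (s n) l)) \<longlonglongrightarrow> 0"
  shows "banach_space V"
proof
  interpret M: Metric_space "vcarrier V" "vdist V" by (rule Metric_space_vdist)
  show "M.mcomplete"
    unfolding M.mcomplete_def
  proof (intro allI impI)
    fix s assume s: "M.MCauchy s"
    then have sc: "s n \<in> vcarrier V" for n unfolding M.MCauchy_def by auto
    have "\<exists>l\<in>vcarrier V. (\<lambda>n. vnorm V (vsub V (s n) l)) \<longlonglongrightarrow> 0"
    proof (rule assms[OF sc])
      fix e :: real assume "0 < e"
      then obtain N where "\<forall>n n'. N \<le> n \<longrightarrow> N \<le> n' \<longrightarrow> vdist V (s n) (s n') < e"
        using s unfolding M.MCauchy_def by blast
      then show "\<exists>N. \<forall>m\<ge>N. \<forall>n\<ge>N. vnorm V (vsub V (s m) (s n)) < e" using sc by (auto simp: vdist_eq)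
    qed
    then show "\<exists>x. limitin M.mtopology s x sequentially"
      using limitin_norm[of s] sc unfolding norm_topology_def by blast
  qed
qed

primrec vsum :: "('k::real_or_complex, 'a) nspace \<Rightarrow> (nat \<Rightarrow> 'k) \<Rightarrow> (nat \<Rightarrow> 'a) \<Rightarrow> nat \<Rightarrow> 'a" where
  "vsum V c y 0 = vzero V"
| "vsum V c y (Suc n) = vadd V (vsum V c y n) (vscale V (c n) (y n))"

context normed_space
begin

lemma vsum_closed: "(\<And>i. i < n \<Longrightarrow> y i \<in> vcarrier V) \<Longrightarrow> vsum V c y n \<in> vcarrier V"
  by (induction n) (auto simp: closed)

lemma dual_vsum:
  "f \<in> vcarrier (dual_space V) \<Longrightarrow> (\<And>i. i < n \<Longrightarrow> y i \<in> vcarrier V) \<Longrightarrow>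
    f (vsum V c y n) = (\<Sum>i<n. c i * f (y i))"
  by (induction n) (auto simp: dual_vzero dual_add dual_scale closed vsum_closed)

section \<open>Pointwise bounded sets are bounded\<close>

text \<open>Sokal's gliding hump proof of the uniform boundedness principle. If \<open>vnorm V (x n) > 4\<^sup>n\<close>, a functional is
built from corrections of norm at most \<open>3\<^sup>-\<^sup>n\<close>. The \<open>n\<close>-th correction raises the value at \<open>x n\<close> to at
least \<open>3\<^sup>-\<^sup>n vnorm V (x n)\<close>, and all later ones together remove at most half of it. The partial sums of the corrections converge along
the ultrafilter to a functional that is unbounded on the \<open>x n\<close>.\<close>

lemma pointwise_bounded_imp_bounded:
  assumes S: "S \<subseteq> vcarrier V"
    and pb: "\<And>f. f \<in> vcarrier (dual_space V) \<Longrightarrow> \<exists>K. \<forall>x\<in>S. norm (f x) \<le> K"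
  shows "\<exists>M. \<forall>x\<in>S. vnorm V x \<le> M"
proof (rule ccontr)
  assume "\<not> ?thesis"
  then have "\<forall>n. \<exists>x\<in>S. 4 ^ n < vnorm V x" by (metis not_le)
  then obtain x where x: "\<And>n. x n \<in> S" "\<And>n. 4 ^ n < vnorm V (x n)" by metis
  have xc: "x n \<in> vcarrier V" for n using x S by auto
  interpret D: normed_space "dual_space V" by (rule normed_space_dual)
  have step: "\<exists>g. g \<in> vcarrier (dual_space V) \<and> (\<forall>y\<in>vcarrier V. norm (g y - f y) \<le> (1/3)^n * vnorm V y)
      \<and> (1/3)^n * vnorm V (x n) \<le> norm (g (x n))" if f: "f \<in> vcarrier (dual_space V)" for f n
  proof -
    obtain h where h: "h \<in> vcarrier (dual_space V)" "vnorm (dual_space V) h \<le> 1" "h (x n) = of_real (vnorm V (x n))"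
      by (rule norming_functional[OF xc[of n]])
    define t :: 'k where "t = of_real ((1/3)^n)"
    have nt: "norm t = (1/3)^n" unfolding t_def by (simp only: norm_of_real) simp
    have pos: "0 \<le> vnorm V (x n)" using xc norm_nonneg by blast
    have "2 * norm (t * h (x n)) \<le> norm (f (x n) + t * h (x n)) + norm (f (x n) - t * h (x n))"
      using norm_triangle_ineq4[of "f (x n) + t * h (x n)" "f (x n) - t * h (x n)"]
      by (simp add: norm_mult flip: mult_2)
    moreover have "norm (t * h (x n)) = (1/3)^n * vnorm V (x n)" using pos by (simp add: norm_mult nt h(3))
    \<comment> \<open>one of the signs \<open>s = 1\<close> and \<open>s = -1\<close> does, as \<open>2 |b| \<le> |a + b| + |a - b|\<close>\<close>
    ultimately obtain s :: 'k where s: "norm s = 1" "(1/3)^n * vnorm V (x n) \<le> norm (f (x n) + s * (t * h (x n)))"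
      by (metis (no_types, opaque_lifting) add.commute diff_conv_add_uminus field_sum_of_halves
          linorder_not_le mult_1 mult_2 mult_minus1 norm_minus_cancel norm_one add_strict_mono)
    define g where "g = vadd (dual_space V) f (vscale (dual_space V) (s * t) h)"
    have g: "g \<in> vcarrier (dual_space V)" using f h by (simp add: g_def D.closed)
    have geq: "g y = f y + s * (t * h y)" if "y \<in> vcarrier V" for y
      using that by (simp add: g_def dual_ops mult.assoc)
    have "norm (g y - f y) \<le> (1/3)^n * vnorm V y" if y: "y \<in> vcarrier V" for y
    proof -
      have "norm (g y - f y) = (1/3)^n * norm (h y)" using s(1) nt by (simp add: geq[OF y] norm_mult)
      also have "\<dots> \<le> (1/3)^n * vnorm V y" using dual_ball_bound[OF h(1,2) y] by (intro mult_left_mono) auto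
      finally show ?thesis .
    qed
    then show ?thesis using g s(2) geq[OF xc[of n]] by (intro exI[of _ g]) simp
  qed
  have "\<exists>F. \<forall>n. F n \<in> vcarrier (dual_space V) \<and> (n = 0 \<longrightarrow> F n = vzero (dual_space V)) \<and>
      ((\<forall>y\<in>vcarrier V. norm (F (Suc n) y - F n y) \<le> (1/3)^n * vnorm V y)
      \<and> (1/3)^n * vnorm V (x n) \<le> norm (F (Suc n) (x n)))"
    using dependent_nat_choice[of "\<lambda>n f. f \<in> vcarrier (dual_space V) \<and> (n = 0 \<longrightarrow> f = vzero (dual_space V))"
        "\<lambda>n f g. (\<forall>y\<in>vcarrier V. norm (g y - f y) \<le> (1/3)^n * vnorm V y)
      \<and> (1/3)^n * vnorm V (x n) \<le> norm (g (x n))"] step D.zero_closed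
    by (simp add: conj_assoc)
  then obtain F where F: "\<And>n. F n \<in> vcarrier (dual_space V)" "F 0 = vzero (dual_space V)"
    "\<And>n y. y \<in> vcarrier V \<Longrightarrow> norm (F (Suc n) y - F n y) \<le> (1/3)^n * vnorm V y"
    "\<And>n. (1/3)^n * vnorm V (x n) \<le> norm (F (Suc n) (x n))" by blast
  \<comment> \<open>a geometric series with ratio \<open>1/3\<close>\<close>
  have tele: "norm (F (n + j) y - F n y) \<le> 3/2 * (1/3)^n * (1 - (1/3)^j) * vnorm V y"
    if y: "y \<in> vcarrier V" for n j y
  proof (induction j)
    case (Suc j)
    have "norm (F (n + Suc j) y - F n y) \<le> norm (F (Suc (n + j)) y - F (n + j) y) + norm (F (n + j) y - F n y)"
      using norm_triangle_ineq[of "F (Suc (n + j)) y - F (n + j) y" "F (n + j) y - F n y"] by simp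
    also have "\<dots> \<le> (1/3)^(n+j) * vnorm V y + 3/2 * (1/3)^n * (1 - (1/3)^j) * vnorm V y"
      using Suc F(3)[OF y, of "n + j"] by simp
    also have "\<dots> = 3/2 * (1/3)^n * (1 - (1/3)^Suc j) * vnorm V y" by (simp add: power_add field_simps)
    finally show ?case .
  qed simp
  have tele': "norm (F (n + j) y - F n y) \<le> 3/2 * (1/3)^n * vnorm V y" if y: "y \<in> vcarrier V" for n j y
  proof -
    have "3/2 * (1/3)^n * (1 - (1/3)^j) * vnorm V y \<le> 3/2 * (1/3)^n * vnorm V y"
      using norm_nonneg[OF y] by (intro mult_right_mono) (auto simp: mult_left_le)
    then show ?thesis using tele[OF y, of n j] by (rule order.trans[rotated])
  qed
  have Fb: "vnorm (dual_space V) (F n) \<le> 3/2" for n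
  proof (rule dual_norm_leI)
    show "norm (F n y) \<le> 3/2 * vnorm V y" if "y \<in> vcarrier V" for y
      using tele'[OF that, of 0 n] that by (simp add: F(2) dual_ops)
  qed simp
  define f where "f = (\<lambda>y\<in>vcarrier V. ulim (\<lambda>n. F n y))"
  have fD: "f \<in> vcarrier (dual_space V)" unfolding f_def by (rule ulim_functional(1)[OF F(1) Fb])
  have flim: "((\<lambda>n. F n y) \<longlongrightarrow> f y) uf" if "y \<in> vcarrier V" for y
    using ulim_functional(2)[OF F(1) Fb that] that by (simp add: f_def)
  obtain K where K: "\<And>n. norm (f (x n)) \<le> K" using pb[OF fD] x by blast
  have key: "(4/3)^n / 2 \<le> K" for n
  proof -
    have "norm (f (x n) - F (Suc n) (x n)) \<le> 3/2 * (1/3)^Suc n * vnorm V (x n)"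
    proof (rule tendsto_upperbound)
      show "((\<lambda>m. norm (F m (x n) - F (Suc n) (x n))) \<longlongrightarrow> norm (f (x n) - F (Suc n) (x n))) uf"
        by (intro tendsto_intros flim xc)
      show "\<forall>\<^sub>F m in uf. norm (F m (x n) - F (Suc n) (x n)) \<le> 3/2 * (1/3)^Suc n * vnorm V (x n)"
      proof (rule uf_eventually, rule eventually_sequentiallyI[of "Suc n"])
        fix m assume "Suc n \<le> m"
        then obtain j where "m = Suc n + j" using le_Suc_ex by blast
        then show "norm (F m (x n) - F (Suc n) (x n)) \<le> 3/2 * (1/3)^Suc n * vnorm V (x n)"
          using tele'[OF xc, of "Suc n" j] by simp
      qed
    qed simp
    moreover have "norm (F (Suc n) (x n)) \<le> norm (f (x n)) + norm (f (x n) - F (Suc n) (x n))"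
      using norm_triangle_sub[of "F (Suc n) (x n)" "f (x n)"] by (simp add: norm_minus_commute)
    ultimately have "(1/3)^n * vnorm V (x n) / 2 \<le> K"
      using F(4)[of n] K[of n] by simp
    moreover have "(1/3)^n * 4^n \<le> (1/3)^n * vnorm V (x n)" using x(2)[of n] by (intro mult_left_mono) auto
    moreover have "(1/3)^n * 4^n = (4/3 :: real)^n" by (simp flip: power_mult_distrib)
    ultimately show ?thesis by simp
  qed
  obtain n where "2 * K < (4/3)^n" using real_arch_pow[of "4/3" "2 * K"] by auto
  then show False using key[of n] by simp
qed

section \<open>Helly's theorem\<close>

text \<open>Linear functionals on the dual respect pointwise linear relations between functionals.\<close>

lemma dual_sum_rep:
  fixes f :: "nat \<Rightarrow> 'a \<Rightarrow> 'k"
  assumes f: "\<And>i. i < n \<Longrightarrow> f i \<in> vcarrier (dual_space V)" and g: "g \<in> vcarrier (dual_space V)"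
    and rep: "\<And>x. x \<in> vcarrier V \<Longrightarrow> g x = (\<Sum>i<n. c i * f i x)"
    and \<phi>: "linear_between (dual_space V) scalar_space \<phi>"
  shows "\<phi> g = (\<Sum>i<n. c i * \<phi> (f i))"
proof -
  interpret D: normed_space "dual_space V" by (rule normed_space_dual)
  have "vsum (dual_space V) c f n x = (\<Sum>i<n. c i * f i x)" if "x \<in> vcarrier V" for x
    using that by (induction n) (simp_all add: dual_ops)
  then have "g = vsum (dual_space V) c f n"
    by (intro dual_ext[OF g D.vsum_closed]) (simp_all add: f rep)
  moreover have "\<phi> (vsum (dual_space V) c f n) = (\<Sum>i<n. c i * \<phi> (f i))" using f
  proof (induction n)
    case 0
    have "\<phi> (vscale (dual_space V) 0 (vzero (dual_space V))) = 0 * \<phi> (vzero (dual_space V))"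
      using \<phi> D.zero_closed unfolding D.linear_scalar_iff by blast
    then show ?case by (simp add: D.scale_zero_right)
  next
    case (Suc n)
    then show ?case using \<phi> unfolding D.linear_scalar_iff by (simp add: D.vsum_closed D.closed)
  qed
  ultimately show ?thesis by simp
qed

text \<open>The equations are consistent because every linear relation among the \<open>f i\<close> also holds among the values
\<open>\<phi> (f i)\<close>.\<close>

lemma interpolate_exists:
  fixes f :: "nat \<Rightarrow> 'a \<Rightarrow> 'k"
  assumes f: "\<And>i. i < n \<Longrightarrow> f i \<in> vcarrier (dual_space V)"
    and \<phi>: "linear_between (dual_space V) scalar_space \<phi>"
  shows "\<exists>a\<in>vcarrier V. \<forall>i<n. f i a = \<phi> (f i)"
  using f
proof (induction n)
  case 0
  then show ?case using zero_closed by auto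
next
  case (Suc n)
  then obtain a where a: "a \<in> vcarrier V" "\<And>i. i < n \<Longrightarrow> f i a = \<phi> (f i)" by auto
  have fn: "f i \<in> vcarrier (dual_space V)" if "i \<le> n" for i using Suc.prems that by simp
  show ?case
  proof (cases "\<exists>w\<in>vcarrier V. (\<forall>i<n. f i w = 0) \<and> f n w \<noteq> 0")
    case True
    then obtain w where w: "w \<in> vcarrier V" "\<And>i. i < n \<Longrightarrow> f i w = 0" "f n w \<noteq> 0" by blast
    define b where "b = vadd V a (vscale V ((\<phi> (f n) - f n a) / f n w) w)"
    have "f i b = \<phi> (f i)" if "i < Suc n" for i
      using that a w fn[of i] by (cases "i = n") (auto simp: b_def dual_add dual_scale closed)
    moreover have "b \<in> vcarrier V" using a w by (simp add: b_def closed)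
    ultimately show ?thesis by blast
  next
    case False
    have "\<exists>c. \<forall>x\<in>vcarrier V. f n x = (\<Sum>i<n. c i * f i x)"
      by (rule kernel_lemma) (use False fn dual_linear in auto)
    then obtain c where c: "\<And>x. x \<in> vcarrier V \<Longrightarrow> f n x = (\<Sum>i<n. c i * f i x)" by blast
    have "\<phi> (f n) = (\<Sum>i<n. c i * \<phi> (f i))"
      by (rule dual_sum_rep[OF _ _ c \<phi>]) (use fn in auto)
    then have "f n a = \<phi> (f n)" using c[OF a(1)] a(2) by simp
    then show ?thesis using a less_Suc_eq by metis
  qed
qed

text \<open>Let \<open>N\<close> be the common kernel of the \<open>f i\<close>, \<open>p\<close> the distance to \<open>N\<close>, and \<open>a\<close> any solution of the
interpolation problem. A functional \<open>g\<close> of norm at most \<open>1\<close> with \<open>g a = p a\<close> that vanishes on \<open>N\<close> is a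
combination of the \<open>f i\<close>, so that \<open>p a = g a = \<phi> g \<le> K\<close>; now \<open>a\<close> is moved along \<open>N\<close>.\<close>

theorem Helly:
  fixes f :: "nat \<Rightarrow> 'a \<Rightarrow> 'k"
  assumes f: "\<And>i. i < n \<Longrightarrow> f i \<in> vcarrier (dual_space V)"
    and \<phi>: "linear_between (dual_space V) scalar_space \<phi>"
    and \<phi>_le: "\<And>g. g \<in> vcarrier (dual_space V) \<Longrightarrow> norm (\<phi> g) \<le> K * vnorm (dual_space V) g"
    and K: "0 \<le> K" and e: "0 < e"
  obtains a where "a \<in> vcarrier V" "vnorm V a < K + e" "\<And>i. i < n \<Longrightarrow> f i a = \<phi> (f i)"
proof -
  obtain a where a: "a \<in> vcarrier V" "\<And>i. i < n \<Longrightarrow> f i a = \<phi> (f i)"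
    using interpolate_exists[of n f \<phi>] f \<phi> by blast
  define N where "N = {w \<in> vcarrier V. \<forall>i<n. f i w = 0}"
  have N0: "vzero V \<in> N" using f dual_vzero zero_closed unfolding N_def by auto
  have Nc: "w \<in> vcarrier V" if "w \<in> N" for w using that N_def by auto
  have Nadd: "vadd V w z \<in> N" if "w \<in> N" "z \<in> N" for w z
    using that f unfolding N_def by (auto simp: dual_add closed)
  have Nsc: "vscale V c w \<in> N" if "w \<in> N" for w c
    using that f unfolding N_def by (auto simp: dual_scale closed)
  define p where "p x = (INF w\<in>N. vnorm V (vadd V x w))" for x
  have bdd: "bdd_below ((\<lambda>w. vnorm V (vadd V x w)) ` N)" if "x \<in> vcarrier V" for x
    by (rule bdd_belowI2[of _ 0]) (use that Nc in \<open>simp add: norm_nonneg closed\<close>)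
  have p_le: "p x \<le> vnorm V (vadd V x w)" if "x \<in> vcarrier V" "w \<in> N" for x w
    unfolding p_def using bdd[OF that(1)] that(2) by (rule cINF_lower)
  have p_ge: "t \<le> p x" if "\<And>w. w \<in> N \<Longrightarrow> t \<le> vnorm V (vadd V x w)" for t x
    unfolding p_def using N0 that by (intro cINF_greatest) auto
  have p_lt: "\<exists>w\<in>N. vnorm V (vadd V x w) < t" if "p x < t" for x t
    using p_ge[of t x] that by (meson not_le)
  have p_norm: "p x \<le> vnorm V x" if "x \<in> vcarrier V" for x
    using p_le[OF that N0] that by (simp add: add_zero)
  have p_add: "p (vadd V x y) \<le> p x + p y" if xy: "x \<in> vcarrier V" "y \<in> vcarrier V" for x y
  proof (rule field_le_epsilon)
    fix d :: real assume "0 < d"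
    then obtain w z where wz: "w \<in> N" "vnorm V (vadd V x w) < p x + d/2" "z \<in> N" "vnorm V (vadd V y z) < p y + d/2"
      using p_lt[of x "p x + d/2"] p_lt[of y "p y + d/2"] by auto
    have "vadd V (vadd V x y) (vadd V w z) = vadd V (vadd V x w) (vadd V y z)"
      using xy wz Nc by (simp add: add_ac closed)
    then have "p (vadd V x y) \<le> vnorm V (vadd V (vadd V x w) (vadd V y z))"
      using p_le[of "vadd V x y" "vadd V w z"] xy wz Nadd by (simp add: closed)
    also have "\<dots> \<le> vnorm V (vadd V x w) + vnorm V (vadd V y z)"
      using xy wz Nc by (intro norm_triangle) (auto simp: closed)
    finally show "p (vadd V x y) \<le> p x + p y + d" using wz by simp
  qed
  have p_scale_le: "p (vscale V c x) \<le> norm c * p x" if x: "x \<in> vcarrier V" for c x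
  proof (cases "c = 0")
    case True
    then show ?thesis using p_norm[of "vscale V c x"] x norm_scale[OF x, of c] by (simp add: closed)
  next
    case False
    have "p (vscale V c x) / norm c \<le> p x"
    proof (rule p_ge)
      fix w assume w: "w \<in> N"
      have "p (vscale V c x) \<le> vnorm V (vadd V (vscale V c x) (vscale V c w))"
        using p_le[of "vscale V c x" "vscale V c w"] x w Nsc by (simp add: closed)
      also have "\<dots> = norm c * vnorm V (vadd V x w)"
        using x w Nc norm_scale[of "vadd V x w" c] by (simp add: scale_add_right closed)
      finally show "p (vscale V c x) / norm c \<le> vnorm V (vadd V x w)" using False by (simp add: field_simps)
    qed
    then show ?thesis using False by (simp add: field_simps)
  qed
  have p_scale: "p (vscale V c x) = norm c * p x" if x: "x \<in> vcarrier V" for c x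
  proof (cases "c = 0")
    case True
    have "0 \<le> p y" if "y \<in> vcarrier V" for y using that Nc by (intro p_ge norm_nonneg) (auto simp: closed)
    then show ?thesis using p_scale_le[OF x, of c] True x by (simp add: order.antisym closed)
  next
    case False
    have "p x \<le> inverse (norm c) * p (vscale V c x)"
      using p_scale_le[of "vscale V c x" "inverse c"] x False by (simp add: closed scale_scale scale_one norm_inverse)
    then have "norm c * p x \<le> p (vscale V c x)" using False by (simp add: field_simps)
    then show ?thesis using p_scale_le[OF x, of c] by simp
  qed
  have "p a \<le> K"
  proof (cases "0 < p a")
    case True
    obtain g where g: "g \<in> vcarrier (dual_space V)" "\<And>x. x \<in> vcarrier V \<Longrightarrow> norm (g x) \<le> p x"
      "g a = of_real (p a)"
      using seminorm_functional[of p a] p_add p_scale p_norm a(1) True by blast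
    have "g w = 0" if "w \<in> vcarrier V" "\<And>i. i < n \<Longrightarrow> f i w = 0" for w
    proof -
      have w: "w \<in> N" using that by (simp add: N_def)
      have "norm (g w) \<le> vnorm V (vsub V w w)"
        using g(2)[OF that(1)] p_le[OF that(1) Nsc[OF w, of "-1"]] by simp
      then show ?thesis using add_minus[OF that(1)] by simp
    qed
    then have "\<exists>c. \<forall>x\<in>vcarrier V. g x = (\<Sum>i<n. c i * f i x)"
      by (intro kernel_lemma dual_linear f g(1)) auto
    then obtain c where c: "\<And>x. x \<in> vcarrier V \<Longrightarrow> g x = (\<Sum>i<n. c i * f i x)" by blast
    have "\<phi> g = (\<Sum>i<n. c i * \<phi> (f i))" by (rule dual_sum_rep[OF f g(1) c \<phi>])
    then have "\<phi> g = g a" using c[OF a(1)] a(2) by simp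
    moreover have "vnorm (dual_space V) g \<le> 1"
    proof (rule dual_norm_leI)
      show "norm (g x) \<le> 1 * vnorm V x" if "x \<in> vcarrier V" for x using g(2)[OF that] p_norm[OF that] by simp
    qed simp
    then have "K * vnorm (dual_space V) g \<le> K" using K by (simp add: mult_left_le)
    ultimately show ?thesis using \<phi>_le[OF g(1)] g(3) True by simp
  qed (use K in simp)
  then obtain w where w: "w \<in> N" "vnorm V (vadd V a w) < K + e" using p_lt[of a "K + e"] e by auto
  show thesis
  proof (rule that[OF _ w(2)])
    show "vadd V a w \<in> vcarrier V" using a w Nc by (simp add: closed)
    show "f i (vadd V a w) = \<phi> (f i)" if i: "i < n" for i
    proof -
      have "f i w = 0" using w(1) i unfolding N_def by blast
      then show ?thesis using dual_add[OF f[OF i] a(1) Nc[OF w(1)]] a(2)[OF i] by simp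
    qed
  qed
qed

end

section \<open>A sequential criterion for elements of the bidual\<close>

text \<open>Only single functionals are tested, so this is weaker than being a cluster point in the weak topology.
It holds for weak limits of subsequences and for weak cluster points alike.\<close>

definition weak_cluster :: "('k::real_or_complex, 'a) nspace \<Rightarrow> (nat \<Rightarrow> 'a) \<Rightarrow> 'a \<Rightarrow> bool" where
  "weak_cluster V a x \<longleftrightarrow> x \<in> vcarrier V \<and>
     (\<forall>f\<in>vcarrier (dual_space V). \<forall>e>0. \<forall>N. \<exists>n\<ge>N. norm (f (a n) - f x) < e)"

text \<open>\<open>\<phi>\<close> is in the closure of \<open>A\<close>, viewed as a set of functions on the dual, for pointwise convergence.\<close>

definition approximable ::
  "('k::real_or_complex, 'a) nspace \<Rightarrow> 'a set \<Rightarrow> (('a \<Rightarrow> 'k) \<Rightarrow> 'k) \<Rightarrow> bool" where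
  "approximable V A \<phi> \<longleftrightarrow>
     (\<forall>G e. finite G \<and> G \<subseteq> vcarrier (dual_space V) \<and> 0 < e \<longrightarrow> (\<exists>a\<in>A. \<forall>f\<in>G. norm (f a - \<phi> f) < e))"

lemma approximableD:
  assumes "approximable V A \<phi>" "finite G" "G \<subseteq> vcarrier (dual_space V)" "0 < e"
  obtains a where "a \<in> A" "\<And>f. f \<in> G \<Longrightarrow> norm (f a - \<phi> f) < e"
  using assms unfolding approximable_def by meson

context normed_space
begin

lemma approximable_linear:
  assumes A: "A \<subseteq> vcarrier V" and ap: "approximable V A \<phi>"
  shows "linear_between (dual_space V) scalar_space \<phi>"
proof -
  interpret D: normed_space "dual_space V" by (rule normed_space_dual)
  have small: "z = 0" if "\<And>e. 0 < e \<Longrightarrow> norm z \<le> C * e" for z :: 'k and C :: real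
  proof (rule ccontr)
    assume "z \<noteq> 0"
    have "norm z \<le> C * (norm z / (2 * (\<bar>C\<bar> + 1)))" 
      by (rule that, intro divide_pos_pos) (use \<open>z \<noteq> 0\<close> in auto)
    also have "\<dots> \<le> (\<bar>C\<bar> + 1) * (norm z / (2 * (\<bar>C\<bar> + 1)))" by (intro mult_right_mono) auto
    also have "\<dots> = norm z / 2" by (simp add: field_simps)
    finally show False using \<open>z \<noteq> 0\<close> by simp
  qed
  show ?thesis
    unfolding D.linear_scalar_iff
  proof (intro conjI ballI allI)
    fix f g assume fg: "f \<in> vcarrier (dual_space V)" "g \<in> vcarrier (dual_space V)"
    let ?h = "vadd (dual_space V) f g"
    have "\<phi> ?h - (\<phi> f + \<phi> g) = 0"
    proof (rule small)
      fix e :: real assume e: "0 < e"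
      have "{f, g, ?h} \<subseteq> vcarrier (dual_space V)" using fg D.add_closed[OF fg] by simp
      then obtain a where a0: "a \<in> A" "\<And>k. k \<in> {f, g, ?h} \<Longrightarrow> norm (k a - \<phi> k) < e"
        by (rule approximableD[OF ap _ _ e, rotated]) auto
      have a: "a \<in> A" "norm (f a - \<phi> f) < e" "norm (g a - \<phi> g) < e" "norm (?h a - \<phi> ?h) < e"
        using a0(1) a0(2)[of f] a0(2)[of g] a0(2)[of ?h] by simp_all
      have "?h a = f a + g a" using a(1) A by (auto simp: dual_ops)
      then have "\<phi> ?h - (\<phi> f + \<phi> g) = ((f a - \<phi> f) + (g a - \<phi> g)) - (?h a - \<phi> ?h)" by simp
      also have "norm \<dots> \<le> norm (f a - \<phi> f) + norm (g a - \<phi> g) + norm (?h a - \<phi> ?h)"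
        by (rule order.trans[OF norm_triangle_ineq4 add_right_mono[OF norm_triangle_ineq]])
      finally show "norm (\<phi> ?h - (\<phi> f + \<phi> g)) \<le> 3 * e" using a by simp
    qed
    then show "\<phi> ?h = \<phi> f + \<phi> g" by simp
  next
    fix c f assume f: "f \<in> vcarrier (dual_space V)"
    let ?h = "vscale (dual_space V) c f"
    have "\<phi> ?h - c * \<phi> f = 0"
    proof (rule small)
      fix e :: real assume e: "0 < e"
      have "{f, ?h} \<subseteq> vcarrier (dual_space V)" using f D.scale_closed[OF f] by simp
      then obtain a where a0: "a \<in> A" "\<And>k. k \<in> {f, ?h} \<Longrightarrow> norm (k a - \<phi> k) < e"
        by (rule approximableD[OF ap _ _ e, rotated]) auto
      have a: "a \<in> A" "norm (f a - \<phi> f) < e" "norm (?h a - \<phi> ?h) < e"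
        using a0(1) a0(2)[of f] a0(2)[of ?h] by simp_all
      have "?h a = c * f a" using a(1) A by (auto simp: dual_ops)
      then have "\<phi> ?h - c * \<phi> f = c * (f a - \<phi> f) - (?h a - \<phi> ?h)" by (simp add: algebra_simps)
      also have "norm \<dots> \<le> norm c * norm (f a - \<phi> f) + norm (?h a - \<phi> ?h)"
        using norm_triangle_ineq4[of "c * (f a - \<phi> f)"] by (simp add: norm_mult)
      also have "\<dots> \<le> norm c * e + e" using a by (intro add_mono mult_left_mono) auto
      finally show "norm (\<phi> ?h - c * \<phi> f) \<le> (norm c + 1) * e" by (simp add: distrib_right)
    qed
    then show "\<phi> ?h = c * \<phi> f" by simp
  qed
qed

lemma approximable_bounded:
  assumes A: "A \<subseteq> vcarrier V" "\<And>a. a \<in> A \<Longrightarrow> vnorm V a \<le> K" and ap: "approximable V A \<phi>"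
    and f: "f \<in> vcarrier (dual_space V)"
  shows "norm (\<phi> f) \<le> K * vnorm (dual_space V) f"
proof (rule field_le_epsilon)
  fix e :: real assume "0 < e"
  then have "\<exists>a\<in>A. \<forall>k\<in>{f}. norm (k a - \<phi> k) < e" using ap f unfolding approximable_def by blast
  then obtain a where a: "a \<in> A" "norm (f a - \<phi> f) < e" by blast
  have "norm (f a) \<le> vnorm (dual_space V) f * vnorm V a" using dual_bound[OF f] a A by blast
  also have "\<dots> \<le> vnorm (dual_space V) f * K" using A(2)[OF a(1)] dual_norm_nonneg[OF f] by (rule mult_left_mono)
  finally show "norm (\<phi> f) \<le> K * vnorm (dual_space V) f + e"
    using a(2) norm_triangle_sub[of "\<phi> f" "f a"] by (simp add: norm_minus_commute mult.commute)
qed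

end

text \<open>A Banach space is closed in its bidual: evaluations tending to \<open>\<phi>\<close> come from a Cauchy sequence.\<close>

lemma (in banach_space) distance_to_evaluations:
  assumes nrep: "\<not> (\<exists>x\<in>vcarrier V. \<forall>f\<in>vcarrier (dual_space V). \<phi> f = f x)"
  obtains d where "0 < d"
    "\<And>x. x \<in> vcarrier V \<Longrightarrow> \<exists>f\<in>vcarrier (dual_space V). d * vnorm (dual_space V) f < norm (\<phi> f - f x)"
proof (rule ccontr)
  assume "\<not> thesis"
  then have "\<forall>n. \<exists>x\<in>vcarrier V. \<forall>f\<in>vcarrier (dual_space V).
      norm (\<phi> f - f x) \<le> inverse (real (Suc n)) * vnorm (dual_space V) f"
    using that[of "inverse (real (Suc n))" for n] by (metis not_le inverse_positive_iff_positive of_nat_0_less_iff zero_less_Suc)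
  then obtain x where x: "\<And>n. x n \<in> vcarrier V" "\<And>n f. f \<in> vcarrier (dual_space V) \<Longrightarrow>
      norm (\<phi> f - f (x n)) \<le> inverse (real (Suc n)) * vnorm (dual_space V) f" by metis
  have diff: "vnorm V (vsub V (x m) (x n)) \<le> inverse (real (Suc m)) + inverse (real (Suc n))" for m n
  proof (rule norm_leI)
    fix f assume f: "f \<in> vcarrier (dual_space V)" "vnorm (dual_space V) f \<le> 1"
    have b: "norm (\<phi> f - f (x k)) \<le> inverse (real (Suc k))" for k
    proof -
      have "inverse (real (Suc k)) * vnorm (dual_space V) f \<le> inverse (real (Suc k)) * 1"
        by (intro mult_left_mono f(2)) simp
      then show ?thesis using x(2)[OF f(1), of k] by (simp only: mult_1_right)
    qed
    have "f (vsub V (x m) (x n)) = (\<phi> f - f (x n)) - (\<phi> f - f (x m))" using f x by (simp add: dual_vsub)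
    then show "norm (f (vsub V (x m) (x n))) \<le> inverse (real (Suc m)) + inverse (real (Suc n))"
      using norm_triangle_ineq4[of "\<phi> f - f (x n)" "\<phi> f - f (x m)"] b[of n] b[of m] by simp
  qed (use x in \<open>simp add: closed\<close>)
  obtain l where l: "l \<in> vcarrier V" "(\<lambda>n. vnorm V (vsub V (x n) l)) \<longlonglongrightarrow> 0"
  proof (rule Cauchy_converges[of x, OF x(1)])
    fix e :: real assume "0 < e"
    then obtain N where N: "inverse (real (Suc N)) < e / 2" using reals_Archimedean[of "e/2"] by auto
    show "\<exists>N. \<forall>m\<ge>N. \<forall>n\<ge>N. vnorm V (vsub V (x m) (x n)) < e"
    proof (intro exI[of _ N] allI impI)
      fix m n assume "N \<le> m" "N \<le> n"
      then have "inverse (real (Suc m)) \<le> inverse (real (Suc N))" "inverse (real (Suc n)) \<le> inverse (real (Suc N))"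
        by simp_all
      then show "vnorm V (vsub V (x m) (x n)) < e" using diff[of m n] N by linarith
    qed
  qed
  have "\<phi> f = f l" if f: "f \<in> vcarrier (dual_space V)" for f
  proof -
    have "(\<lambda>n. vnorm (dual_space V) f * vnorm V (vsub V (x n) l)) \<longlonglongrightarrow> vnorm (dual_space V) f * 0"
      by (intro tendsto_mult tendsto_const l)
    then have lim: "(\<lambda>n. vnorm (dual_space V) f * vnorm V (vsub V (x n) l)) \<longlonglongrightarrow> 0" by simp
    have "norm (f (x n) - f l) \<le> vnorm (dual_space V) f * vnorm V (vsub V (x n) l)" for n
      using dual_bound[OF f, of "vsub V (x n) l"] f x l by (simp add: dual_vsub closed)
    then have "(\<lambda>n. f (x n) - f l) \<longlonglongrightarrow> 0"
      by (intro Lim_null_comparison[OF always_eventually lim] allI)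
    then have 1: "(\<lambda>n. f (x n)) \<longlonglongrightarrow> f l" by (simp add: LIM_zero_iff)
    have "(\<lambda>n. inverse (real (Suc n)) * vnorm (dual_space V) f) \<longlonglongrightarrow> 0 * vnorm (dual_space V) f"
      by (intro tendsto_mult tendsto_const LIMSEQ_inverse_real_of_nat)
    then have lim': "(\<lambda>n. inverse (real (Suc n)) * vnorm (dual_space V) f) \<longlonglongrightarrow> 0" by simp
    have "norm (f (x n) - \<phi> f) \<le> inverse (real (Suc n)) * vnorm (dual_space V) f" for n
      using x(2)[OF f, of n] by (simp only: norm_minus_commute)
    then have "(\<lambda>n. f (x n) - \<phi> f) \<longlonglongrightarrow> 0"
      by (intro Lim_null_comparison[OF always_eventually lim'] allI)
    then have "(\<lambda>n. f (x n)) \<longlonglongrightarrow> \<phi> f" by (simp add: LIM_zero_iff)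
    then show ?thesis using 1 LIMSEQ_unique by blast
  qed
  then show False using nrep l by blast
qed

text \<open>If \<open>\<phi>\<close> had norm at most \<open>d\<close> on the annihilator of \<open>B\<close>, the Hahn-Banach theorem in the dual would give a
\<open>\<psi>\<close> of norm at most \<open>d\<close> that agrees with \<open>\<phi>\<close> there. By the kernel lemma \<open>\<phi> - \<psi>\<close> would be the evaluation at
a combination of the points of \<open>B\<close>, so \<open>\<phi>\<close> would be too close to an evaluation.\<close>

lemma (in normed_space) functional_vanishing_on_finite:
  assumes B: "finite B" "B \<subseteq> vcarrier V" and \<phi>: "linear_between (dual_space V) scalar_space \<phi>"
    and \<phi>_le: "\<And>f. f \<in> vcarrier (dual_space V) \<Longrightarrow> norm (\<phi> f) \<le> K * vnorm (dual_space V) f"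
    and d: "0 < d" "\<And>x. x \<in> vcarrier V \<Longrightarrow>
      \<exists>f\<in>vcarrier (dual_space V). d * vnorm (dual_space V) f < norm (\<phi> f - f x)"
  obtains f where "f \<in> vcarrier (dual_space V)" "vnorm (dual_space V) f \<le> 1" "d \<le> norm (\<phi> f)"
    "\<And>b. b \<in> B \<Longrightarrow> f b = 0"
proof -
  interpret D: normed_space "dual_space V" by (rule normed_space_dual)
  define N where "N = {f \<in> vcarrier (dual_space V). \<forall>b\<in>B. f b = 0}"
  have bc: "b \<in> vcarrier V" if "b \<in> B" for b using B that by auto
  have \<phi>_lin: "\<phi> (vadd (dual_space V) f g) = \<phi> f + \<phi> g" "\<phi> (vscale (dual_space V) c f) = c * \<phi> f"
    if "f \<in> vcarrier (dual_space V)" "g \<in> vcarrier (dual_space V)" for f g c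
    using \<phi> that unfolding D.linear_scalar_iff by auto
  have "\<exists>f\<in>N. d * vnorm (dual_space V) f < norm (\<phi> f)"
  proof (rule ccontr)
    assume "\<not> ?thesis"
    then have le: "norm (\<phi> f) \<le> d * vnorm (dual_space V) f" if "f \<in> N" for f using that by force
    obtain \<psi> where \<psi>: "\<psi> \<in> vcarrier (dual_space (dual_space V))" "vnorm (dual_space (dual_space V)) \<psi> \<le> d"
      "\<And>f. f \<in> N \<Longrightarrow> \<psi> f = \<phi> f"
    proof (rule D.Hahn_Banach_bounded[of N \<phi> d])
      show "vadd (dual_space V) f g \<in> N" if "f \<in> N" "g \<in> N" for f g
        using that D.add_closed bc unfolding N_def by (auto simp: dual_ops)
      show "vscale (dual_space V) c f \<in> N" if "f \<in> N" for f c
        using that D.scale_closed bc unfolding N_def by (auto simp: dual_ops)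
      show "vzero (dual_space V) \<in> N" using D.zero_closed bc unfolding N_def by (auto simp: dual_ops)
    qed (use le d \<phi>_lin in \<open>auto simp: N_def\<close>)
    obtain b :: "nat \<Rightarrow> 'a" where b: "B = b ` {..<card B}"
      using ex_bij_betw_nat_finite[OF B(1)] unfolding bij_betw_def by (metis atLeast0LessThan)
    define \<theta> where "\<theta> f = \<phi> f - \<psi> f" for f
    have ev: "linear_between (dual_space V) scalar_space (\<lambda>f. f x)" if "x \<in> vcarrier V" for x
      using that unfolding D.linear_scalar_iff by (simp add: dual_ops)
    have "\<exists>c. \<forall>f\<in>vcarrier (dual_space V). \<theta> f = (\<Sum>i<card B. c i * f (b i))"
    proof (rule D.kernel_lemma)
      show "linear_between (dual_space V) scalar_space \<theta>"
        unfolding D.linear_scalar_iff \<theta>_def using \<psi>(1)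
        by (auto simp: \<phi>_lin D.dual_add D.dual_scale algebra_simps)
      show "\<theta> f = 0" if "f \<in> vcarrier (dual_space V)" "\<And>i. i < card B \<Longrightarrow> f (b i) = 0" for f
      proof -
        have "f z = 0" if "z \<in> B" for z
        proof -
          have "z \<in> b ` {..<card B}" using \<open>z \<in> B\<close> b by (rule subst[where P = "\<lambda>S. z \<in> S", rotated])
          then show ?thesis using \<open>\<And>i. i < card B \<Longrightarrow> f (b i) = 0\<close> by blast
        qed
        then have "f \<in> N" unfolding N_def using that(1) by blast
        then show ?thesis using \<psi>(3) by (simp add: \<theta>_def)
      qed
      show "linear_between (dual_space V) scalar_space (\<lambda>f. f (b i))" if "i < card B" for i
        using ev bc b that by blast
    qed
    then obtain c where c: "\<And>f. f \<in> vcarrier (dual_space V) \<Longrightarrow> \<theta> f = (\<Sum>i<card B. c i * f (b i))" by blast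
    define x where "x = vsum V c b (card B)"
    have bi: "b i \<in> vcarrier V" if "i < card B" for i using bc b that by blast
    have x: "x \<in> vcarrier V" unfolding x_def by (rule vsum_closed[OF bi])
    have fx: "f x = \<theta> f" if "f \<in> vcarrier (dual_space V)" for f
      unfolding x_def by (simp add: dual_vsum[OF that bi] c[OF that])
    obtain f where f: "f \<in> vcarrier (dual_space V)" "d * vnorm (dual_space V) f < norm (\<phi> f - f x)"
      using d(2)[OF x] by blast
    have "\<phi> f - f x = \<psi> f" using fx[OF f(1)] by (simp add: \<theta>_def)
    then show False using D.dual_ball_bound[OF \<psi>(1,2) f(1)] f(2) by simp
  qed
  then obtain g where g: "g \<in> N" "d * vnorm (dual_space V) g < norm (\<phi> g)" by blast
  have gD: "g \<in> vcarrier (dual_space V)" using g N_def by auto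
  have "vnorm (dual_space V) g \<noteq> 0" using \<phi>_le[OF gD] g(2) by auto
  then have pos: "0 < vnorm (dual_space V) g" using dual_norm_nonneg[OF gD] by simp
  define t where "t = inverse (vnorm (dual_space V) g)"
  have t: "0 < t" using pos by (simp add: t_def)
  define f where "f = vscale (dual_space V) (of_real t) g"
  show thesis
  proof (rule that[of f])
    show "f \<in> vcarrier (dual_space V)" using gD by (simp add: f_def D.closed)
    show "vnorm (dual_space V) f \<le> 1" using pos t unfolding f_def D.norm_scale[OF gD] by (simp add: t_def del: of_real_inverse)
    have "norm (\<phi> f) = t * norm (\<phi> g)" using t gD unfolding f_def by (simp add: \<phi>_lin norm_mult)
    moreover have "t * (d * vnorm (dual_space V) g) \<le> t * norm (\<phi> g)" using g(2) t by (intro mult_left_mono) auto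
    moreover have "t * (d * vnorm (dual_space V) g) = d" using pos by (simp add: t_def)
    ultimately show "d \<le> norm (\<phi> f)" by simp
    show "f b = 0" if b: "b \<in> B" for b
    proof -
      have "g b = 0" using g(1) b unfolding N_def by blast
      then show ?thesis using bc[OF b] by (simp add: f_def dual_ops)
    qed
  qed
qed

text \<open>A construction in the spirit of James. Functionals \<open>f n\<close> in the unit ball and points \<open>a n\<close> of \<open>A\<close> are chosen
alternately: \<open>f n\<close> vanishes at the earlier points while \<open>|\<phi> (f n)| \<ge> d\<close>, and \<open>a n\<close> nearly takes the values
of \<open>\<phi>\<close> on \<open>f 0, \<dots>, f n\<close>. At a cluster point \<open>x\<close> of the points one has \<open>f j x = \<phi> (f j)\<close> for all \<open>j\<close>. The
limit of the \<open>f n\<close> along the ultrafilter vanishes at all \<open>a n\<close>, hence at \<open>x\<close>; but its value there is the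
limit of the \<open>\<phi> (f n)\<close>.\<close>

theorem (in banach_space) unrepresented_imp_no_cluster_sequence:
  assumes A: "A \<subseteq> vcarrier V" "\<And>a. a \<in> A \<Longrightarrow> vnorm V a \<le> K" and ap: "approximable V A \<phi>"
    and nrep: "\<not> (\<exists>x\<in>vcarrier V. \<forall>f\<in>vcarrier (dual_space V). \<phi> f = f x)"
  obtains a where "\<And>n. a n \<in> A" "\<And>x. \<not> weak_cluster V a x"
proof -
  note \<phi>_lin = approximable_linear[OF A(1) ap]
  note \<phi>_le = approximable_bounded[OF A ap]
  obtain d where d: "0 < d"
    "\<And>x. x \<in> vcarrier V \<Longrightarrow> \<exists>f\<in>vcarrier (dual_space V). d * vnorm (dual_space V) f < norm (\<phi> f - f x)"
    using distance_to_evaluations[OF nrep] by blast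
  define P where "P = (\<lambda>(n::nat) (G, B, f, a). finite G \<and> G \<subseteq> vcarrier (dual_space V) \<and> finite B \<and> B \<subseteq> A \<and>
      f \<in> G \<and> vnorm (dual_space V) f \<le> 1 \<and> d \<le> norm (\<phi> f) \<and> a \<in> B \<and>
      (\<forall>g\<in>G. norm (g a - \<phi> g) < inverse (real (Suc n))))"
  define Q where "Q = (\<lambda>(n::nat) (G, B, f, a) (G', B', f', a').
      G \<subseteq> G' \<and> B \<subseteq> B' \<and> f \<in> G \<and> a \<in> B \<and> f' \<in> G' \<and> a' \<in> B' \<and> G \<subseteq> vcarrier (dual_space V) \<and> (\<forall>b\<in>B. f' b = 0))"
  have step: "\<exists>f' a'. P n (insert f' G, insert a' B, f', a') \<and> (\<forall>b\<in>B. f' b = 0)"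
    if G: "finite G" "G \<subseteq> vcarrier (dual_space V)" and B: "finite B" "B \<subseteq> A" for n G B
  proof -
    obtain f' where f': "f' \<in> vcarrier (dual_space V)" "vnorm (dual_space V) f' \<le> 1" "d \<le> norm (\<phi> f')"
      "\<And>b. b \<in> B \<Longrightarrow> f' b = 0"
      using functional_vanishing_on_finite[OF B(1) _ \<phi>_lin \<phi>_le d] B(2) A(1) by blast
    have "\<exists>a\<in>A. \<forall>g\<in>insert f' G. norm (g a - \<phi> g) < inverse (real (Suc n))"
      using ap G f'(1) unfolding approximable_def
      by (metis finite.insertI insert_subset inverse_positive_iff_positive of_nat_0_less_iff zero_less_Suc)
    then obtain a' where "a' \<in> A" "\<forall>g\<in>insert f' G. norm (g a' - \<phi> g) < inverse (real (Suc n))" by blast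
    then show ?thesis using G B f' unfolding P_def by (intro exI[of _ f'] exI[of _ a']) simp
  qed
  have "\<exists>S. \<forall>n. P n (S n) \<and> Q n (S n) (S (Suc n))"
  proof (rule dependent_nat_choice)
    show "\<exists>x. P 0 x" using step[of "{}" "{}" 0] by auto
  next
    fix x n assume P: "P n x"
    obtain G B f a where x: "x = (G, B, f, a)" by (metis prod_cases4)
    then have fa: "f \<in> G" "a \<in> B" and GB: "finite G" "G \<subseteq> vcarrier (dual_space V)" "finite B" "B \<subseteq> A"
      using P unfolding P_def by auto
    from step[OF GB, of "Suc n"] obtain f' a' where
      "P (Suc n) (insert f' G, insert a' B, f', a')" "\<forall>b\<in>B. f' b = 0" by blast
    then show "\<exists>y. P (Suc n) y \<and> Q n x y" using fa \<open>G \<subseteq> _\<close> unfolding x Q_def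
      by (intro exI[of _ "(insert f' G, insert a' B, f', a')"]) auto
  qed
  then obtain S where PS: "\<And>n. P n (S n)" and QS: "\<And>n. Q n (S n) (S (Suc n))" by blast
  define G where "G n = fst (S n)" for n
  define B where "B n = fst (snd (S n))" for n
  define f where "f n = fst (snd (snd (S n)))" for n
  define a where "a n = snd (snd (snd (S n)))" for n
  have P: "G n \<subseteq> vcarrier (dual_space V)" "B n \<subseteq> A" "f n \<in> G n" "vnorm (dual_space V) (f n) \<le> 1"
    "d \<le> norm (\<phi> (f n))" "a n \<in> B n" "\<And>g. g \<in> G n \<Longrightarrow> norm (g (a n) - \<phi> g) < inverse (real (Suc n))" for n
    using PS[of n] unfolding P_def G_def B_def f_def a_def by (auto simp: case_prod_unfold)
  have Q: "G n \<subseteq> G (Suc n)" "B n \<subseteq> B (Suc n)" "\<And>b. b \<in> B n \<Longrightarrow> f (Suc n) b = 0" for n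
    using QS[of n] unfolding Q_def G_def B_def f_def a_def by (auto simp: case_prod_unfold)
  have Gm: "G m \<subseteq> G n" and Bm: "B m \<subseteq> B n" if "m \<le> n" for m n
    using lift_Suc_mono_le[of G, OF Q(1) that] lift_Suc_mono_le[of B, OF Q(2) that] by auto
  have aA: "a n \<in> A" for n using P by blast
  have ac: "a n \<in> vcarrier V" for n using aA A by blast
  have fD: "f n \<in> vcarrier (dual_space V)" for n using P by blast
  have van: "f j (a n) = 0" if nj: "n < j" for n j
  proof -
    obtain i where i: "j = Suc i" "n \<le> i" using nj by (cases j) auto
    then have "a n \<in> B i" using P(6) Bm by blast
    then show ?thesis using Q(3) i by simp
  qed
  define F where "F = (\<lambda>x\<in>vcarrier V. ulim (\<lambda>n. f n x))"
  have FD: "F \<in> vcarrier (dual_space V)" unfolding F_def by (rule ulim_functional(1)[OF fD P(4)])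
  have Flim: "((\<lambda>n. f n x) \<longlongrightarrow> F x) uf" if "x \<in> vcarrier V" for x
    using ulim_functional(2)[OF fD P(4) that] that by (simp add: F_def)
  have Fa: "F (a n) = 0" for n
  proof -
    have "(\<lambda>j. f j (a n)) \<longlonglongrightarrow> 0"
      by (rule tendsto_eventually) (auto simp: eventually_sequentially intro!: exI[of _ "Suc n"] van)
    then have "((\<lambda>j. f j (a n)) \<longlongrightarrow> 0) uf" by (rule uf_tendsto)
    then show ?thesis using Flim[OF ac] tendsto_unique[OF uf_nontrivial] by blast
  qed
  show thesis
  proof (rule that[of a, OF aA])
    fix x show "\<not> weak_cluster V a x"
    proof
      assume cl: "weak_cluster V a x"
      then have x: "x \<in> vcarrier V"
        and cl: "\<And>g e N. g \<in> vcarrier (dual_space V) \<Longrightarrow> 0 < e \<Longrightarrow> \<exists>n\<ge>N. norm (g (a n) - g x) < e"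
        unfolding weak_cluster_def by auto
      have "f j x = \<phi> (f j)" for j
      proof -
        have "norm (f j x - \<phi> (f j)) \<le> 0"
        proof (rule field_le_epsilon)
          fix e :: real assume e: "0 < e"
          then obtain N where N: "inverse (real (Suc N)) < e / 2" using reals_Archimedean[of "e/2"] by auto
          obtain n where n: "n \<ge> max N j" "norm (f j (a n) - f j x) < e / 2"
            using cl[OF fD, of "e/2" "max N j" j] e by auto
          have "f j \<in> G n" using P(3) Gm n by (meson max.boundedE subsetD)
          then have "norm (f j (a n) - \<phi> (f j)) < inverse (real (Suc n))" by (rule P(7))
          also have "\<dots> \<le> inverse (real (Suc N))" using n by simp
          finally have "norm (f j (a n) - \<phi> (f j)) < e / 2" using N by simp
          then show "norm (f j x - \<phi> (f j)) \<le> 0 + e"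
            using norm_triangle_ineq4[of "f j (a n) - \<phi> (f j)" "f j (a n) - f j x"] n(2) by simp
        qed
        then show ?thesis by simp
      qed
      then have "d \<le> norm (f j x)" for j using P(5) by simp
      then have "d \<le> norm (F x)"
        by (intro tendsto_lowerbound[OF tendsto_norm[OF Flim[OF x]]]) auto
      moreover obtain n where "norm (F (a n) - F x) < d" using cl[OF FD d(1)] by blast
      ultimately show False using Fa by simp
    qed
  qed
qed

section \<open>Reflexivity\<close>

lemma (in normed_space) evaluation_in_bidual:
  assumes x: "x \<in> vcarrier V"
  shows "(\<lambda>f\<in>vcarrier (dual_space V). f x) \<in> vcarrier (dual_space (dual_space V))"
    and "vnorm (dual_space (dual_space V)) (\<lambda>f\<in>vcarrier (dual_space V). f x) \<le> vnorm V x"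
proof -
  interpret D: normed_space "dual_space V" by (rule normed_space_dual)
  have "linear_between (dual_space V) scalar_space (\<lambda>f. f x)"
    using x unfolding D.linear_scalar_iff by (simp add: dual_ops)
  moreover have b: "norm (f x) \<le> vnorm V x * vnorm (dual_space V) f" if "f \<in> vcarrier (dual_space V)" for f
    using dual_bound[OF that x] by (simp add: mult.commute)
  ultimately show "(\<lambda>f\<in>vcarrier (dual_space V). f x) \<in> vcarrier (dual_space (dual_space V))"
    by (rule D.dual_restrictI)
  show "vnorm (dual_space (dual_space V)) (\<lambda>f\<in>vcarrier (dual_space V). f x) \<le> vnorm V x"
    by (rule D.dual_norm_leI) (use b norm_nonneg[OF x] in auto)
qed

text \<open>The limit along the ultrafilter of the evaluations at \<open>y n\<close> belongs to the bidual, so it is an evaluation.\<close>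

lemma (in normed_space) reflexive_ulim:
  assumes r: "reflexive V" and y: "\<And>n. y n \<in> vcarrier V" "\<And>n. vnorm V (y n) \<le> K"
  obtains x where "x \<in> vcarrier V"
    "\<And>f. f \<in> vcarrier (dual_space V) \<Longrightarrow> ((\<lambda>n. f (y n)) \<longlongrightarrow> f x) uf"
proof -
  interpret D: normed_space "dual_space V" by (rule normed_space_dual)
  define J where "J n = (\<lambda>f\<in>vcarrier (dual_space V). f (y n))" for n
  have J: "J n \<in> vcarrier (dual_space (dual_space V))" "vnorm (dual_space (dual_space V)) (J n) \<le> K" for n
    unfolding J_def using evaluation_in_bidual[OF y(1)] y(2) by (auto intro: order.trans)
  have "(\<lambda>f\<in>vcarrier (dual_space V). ulim (\<lambda>n. J n f)) \<in> vcarrier (dual_space (dual_space V))"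
    by (rule D.ulim_functional(1)[OF J])
  then obtain x where x: "x \<in> vcarrier V"
    "(\<lambda>f\<in>vcarrier (dual_space V). ulim (\<lambda>n. J n f)) = (\<lambda>f\<in>vcarrier (dual_space V). f x)"
    unfolding r[unfolded reflexive_def, symmetric] by blast
  have "((\<lambda>n. f (y n)) \<longlongrightarrow> f x) uf" if f: "f \<in> vcarrier (dual_space V)" for f
  proof -
    have "ulim (\<lambda>n. J n f) = f x" using fun_cong[OF x(2), of f] f by simp
    then show ?thesis using D.ulim_functional(2)[of J K f, OF J f] f by (simp add: J_def)
  qed
  then show thesis using that x by blast
qed

text \<open>By Helly's theorem every element of the bidual is approximable by a ball (Goldstine), so the construction
of James applies to an element of the bidual that is not an evaluation.\<close>

lemma (in banach_space) nonreflexive_sequence: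
  assumes nr: "\<not> reflexive V"
  obtains a K where "\<And>n. a n \<in> vcarrier V" "\<And>n. vnorm V (a n) \<le> K" "\<And>x. \<not> weak_cluster V a x"
proof -
  interpret D: normed_space "dual_space V" by (rule normed_space_dual)
  obtain \<phi> where \<phi>: "\<phi> \<in> vcarrier (dual_space (dual_space V))"
    "\<phi> \<notin> (\<lambda>x. \<lambda>f\<in>vcarrier (dual_space V). f x) ` vcarrier V"
    using nr evaluation_in_bidual(1) unfolding reflexive_def by blast
  define K where "K = vnorm (dual_space (dual_space V)) \<phi>"
  define A where "A = {a \<in> vcarrier V. vnorm V a \<le> K + 1}"
  have "approximable V A \<phi>"
    unfolding approximable_def
  proof (intro allI impI, elim conjE)
    fix G and e :: real assume G: "finite G" "G \<subseteq> vcarrier (dual_space V)" "0 < e"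
    obtain g :: "nat \<Rightarrow> _" where g: "G = g ` {..<card G}"
      using ex_bij_betw_nat_finite[OF G(1)] unfolding bij_betw_def by (metis atLeast0LessThan)
    obtain a where a: "a \<in> vcarrier V" "vnorm V a < K + 1" "\<And>i. i < card G \<Longrightarrow> g i a = \<phi> (g i)"
    proof (rule Helly[of "card G" g \<phi> K 1])
      show "g i \<in> vcarrier (dual_space V)" if "i < card G" for i using that g G by blast
      show "norm (\<phi> h) \<le> K * vnorm (dual_space V) h" if "h \<in> vcarrier (dual_space V)" for h
        using D.dual_bound[OF \<phi>(1) that] by (simp add: K_def)
    qed (use D.dual_linear[OF \<phi>(1)] D.dual_norm_nonneg[OF \<phi>(1)] in \<open>auto simp: K_def\<close>)
    have "f a = \<phi> f" if "f \<in> G" for f using that a(3) g by (metis imageE lessThan_iff)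
    then show "\<exists>a\<in>A. \<forall>f\<in>G. norm (f a - \<phi> f) < e" using a G(3) by (intro bexI[of _ a]) (auto simp: A_def)
  qed
  moreover have "\<not> (\<exists>x\<in>vcarrier V. \<forall>f\<in>vcarrier (dual_space V). \<phi> f = f x)"
  proof
    assume "\<exists>x\<in>vcarrier V. \<forall>f\<in>vcarrier (dual_space V). \<phi> f = f x"
    then obtain x where x: "x \<in> vcarrier V" "\<And>f. f \<in> vcarrier (dual_space V) \<Longrightarrow> \<phi> f = f x" by blast
    have "\<phi> = (\<lambda>f\<in>vcarrier (dual_space V). f x)"
      by (rule D.dual_ext[OF \<phi>(1) evaluation_in_bidual(1)[OF x(1)]]) (simp add: x)
    then show False using \<phi>(2) x(1) by blast
  qed
  ultimately obtain a where "\<And>n. a n \<in> A" "\<And>x. \<not> weak_cluster V a x"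
    using unrepresented_imp_no_cluster_sequence[of A "K + 1" \<phi>] by (metis (no_types, lifting) A_def mem_Collect_eq subsetI)
  then show thesis using that[of a "K + 1"] by (auto simp: A_def)
qed

section \<open>The weak topology\<close>

context normed_space
begin

lemma topspace_weak [simp]: "topspace (weak_topology V) = vcarrier V"
proof -
  have "vcarrier V = {x \<in> vcarrier V. vzero (dual_space V) x \<in> UNIV}" by simp
  then have "vcarrier V \<in> {{x \<in> vcarrier V. f x \<in> U} | f U. f \<in> vcarrier (dual_space V) \<and> open U}"
    using normed_space.zero_closed[OF normed_space_dual] open_UNIV by blast
  then show ?thesis unfolding weak_topology_def topology_generated_by_topspace by blast
qed

lemma openin_weak_basic:
  assumes "f \<in> vcarrier (dual_space V)" "open U"
  shows "openin (weak_topology V) {x \<in> vcarrier V. f x \<in> U}"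
  unfolding weak_topology_def by (rule topology_generated_by_Basis) (use assms in blast)

lemma continuous_map_weak_dual:
  "f \<in> vcarrier (dual_space V) \<Longrightarrow> continuous_map (weak_topology V) euclidean f"
  unfolding continuous_map_def using openin_weak_basic by simp

lemma limitin_weak:
  assumes s: "\<And>n. s n \<in> vcarrier V"
  shows "limitin (weak_topology V) s l sequentially \<longleftrightarrow>
    l \<in> vcarrier V \<and> (\<forall>f\<in>vcarrier (dual_space V). (\<lambda>n. f (s n)) \<longlonglongrightarrow> f l)"
proof (intro iffI conjI ballI)
  assume L: "limitin (weak_topology V) s l sequentially"
  then show "l \<in> vcarrier V" using limitin_topspace by force
  fix f assume f: "f \<in> vcarrier (dual_space V)"
  have "limitin euclidean (f \<circ> s) (f l) sequentially"
    by (rule continuous_map_limit[OF continuous_map_weak_dual[OF f] L])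
  then show "(\<lambda>n. f (s n)) \<longlonglongrightarrow> f l" by (simp add: o_def)
next
  assume R: "l \<in> vcarrier V \<and> (\<forall>f\<in>vcarrier (dual_space V). (\<lambda>n. f (s n)) \<longlonglongrightarrow> f l)"
  show "limitin (weak_topology V) s l sequentially"
    unfolding limitin_def
  proof (intro conjI allI impI)
    show "l \<in> topspace (weak_topology V)" using R by simp
    fix U assume U: "openin (weak_topology V) U \<and> l \<in> U"
    then have "generate_topology_on {{x \<in> vcarrier V. f x \<in> U} | f U. f \<in> vcarrier (dual_space V) \<and> open U} U"
      unfolding weak_topology_def by (simp add: openin_topology_generated_by_iff)
    then have "l \<in> U \<longrightarrow> (\<forall>\<^sub>F n in sequentially. s n \<in> U)"
    proof induction
      case Empty
      then show ?case by simp
    next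
      case (Int a b)
      then show ?case by (auto intro: eventually_conj)
    next
      case (UN K)
      show ?case
      proof
        assume "l \<in> \<Union>K"
        then obtain k where k: "k \<in> K" "l \<in> k" by blast
        then have "\<forall>\<^sub>F n in sequentially. s n \<in> k" using UN.IH by blast
        then show "\<forall>\<^sub>F n in sequentially. s n \<in> \<Union>K" by (rule eventually_mono) (use k in blast)
      qed
    next
      case (Basis S)
      then obtain f T where S: "S = {x \<in> vcarrier V. f x \<in> T}" "f \<in> vcarrier (dual_space V)" "open T" by blast
      show ?case
      proof
        assume "l \<in> S"
        then have "\<forall>\<^sub>F n in sequentially. f (s n) \<in> T"
          using R S by (intro topological_tendstoD[of _ "f l"]) auto
        then show "\<forall>\<^sub>F n in sequentially. s n \<in> S" using s S(1) by simp
      qed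
    qed
    then show "\<forall>\<^sub>F n in sequentially. s n \<in> U" using U by blast
  qed
qed

text \<open>A point that is not a cluster point has a neighbourhood visited only finitely often; finitely many of
these cannot cover the whole sequence.\<close>

lemma relatively_weakly_compact_cluster:
  assumes A: "relatively_weakly_compact V A" and a: "\<And>n. a n \<in> A"
  shows "\<exists>x. weak_cluster V a x"
proof (rule ccontr)
  assume no: "\<not> ?thesis"
  define K where "K = weak_topology V closure_of A"
  have K: "compactin (weak_topology V) K" "A \<subseteq> vcarrier V"
    using A unfolding relatively_weakly_compact_def K_def by auto
  have KV: "K \<subseteq> vcarrier V" using closure_of_subset_topspace[of "weak_topology V" A] by (simp add: K_def)
  have AK: "A \<subseteq> K" unfolding K_def by (rule closure_of_subset) (simp add: K(2))
  define \<U> where "\<U> = {S. openin (weak_topology V) S \<and> (\<exists>N. \<forall>n\<ge>N. a n \<notin> S)}"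
  have "K \<subseteq> \<Union>\<U>"
  proof
    fix x assume "x \<in> K"
    then have x: "x \<in> vcarrier V" using KV by blast
    then obtain f e N where f: "f \<in> vcarrier (dual_space V)" "0 < e" "\<And>n. N \<le> n \<Longrightarrow> \<not> norm (f (a n) - f x) < e"
      using no unfolding weak_cluster_def by blast
    define S where "S = {y \<in> vcarrier V. f y \<in> ball (f x) e}"
    have "openin (weak_topology V) S" unfolding S_def by (rule openin_weak_basic[OF f(1) open_ball])
    moreover have "\<forall>n\<ge>N. a n \<notin> S" using f(3) by (auto simp: S_def dist_norm norm_minus_commute)
    ultimately have "S \<in> \<U>" unfolding \<U>_def by blast
    moreover have "x \<in> S" using x f(2) by (simp add: S_def)
    ultimately show "x \<in> \<Union>\<U>" by blast
  qed
  moreover have "\<And>S. S \<in> \<U> \<Longrightarrow> openin (weak_topology V) S" unfolding \<U>_def by blast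
  ultimately obtain \<F> where F: "finite \<F>" "\<F> \<subseteq> \<U>" "K \<subseteq> \<Union>\<F>" using K(1) unfolding compactin_def by meson
  have "\<exists>N. \<forall>n\<ge>N. \<forall>S\<in>\<F>. a n \<notin> S" using F(1,2)
  proof (induction \<F>)
    case (insert S \<F>)
    then obtain N M where "\<forall>n\<ge>N. \<forall>S\<in>\<F>. a n \<notin> S" "\<forall>n\<ge>M. a n \<notin> S" unfolding \<U>_def by auto
    then show ?case by (intro exI[of _ "max N M"]) auto
  qed simp
  then show False using F(3) AK a by blast
qed

end

text \<open>The space is embedded by \<open>J\<close> into the product of copies of the scalar field indexed by the dual. The
closure \<open>K\<close> of \<open>J ` A\<close> is compact by Tychonoff's theorem, and its elements are approximable by \<open>A\<close>. As all
sequences in \<open>A\<close> have cluster points, these elements are evaluations, so \<open>K\<close> lies in the range of \<open>J\<close>,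
where the inverse of \<open>J\<close> is continuous for the weak topology.\<close>

theorem (in banach_space) Eberlein:
  assumes A: "A \<subseteq> vcarrier V"
    and seq: "\<And>a. (\<And>n. a n \<in> A) \<Longrightarrow> \<exists>r x. strict_mono (r :: nat \<Rightarrow> nat) \<and> limitin (weak_topology V) (a \<circ> r) x sequentially"
  shows "relatively_weakly_compact V A"
proof -
  let ?D = "vcarrier (dual_space V)"
  have seq': "\<exists>r x. strict_mono (r :: nat \<Rightarrow> nat) \<and> x \<in> vcarrier V \<and> (\<forall>f\<in>?D. (\<lambda>n. f (a (r n))) \<longlonglongrightarrow> f x)"
    if a: "\<And>n. a n \<in> A" for a
  proof -
    obtain r x where "strict_mono (r :: nat \<Rightarrow> nat)" "limitin (weak_topology V) (a \<circ> r) x sequentially"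
      using seq[of a] a by blast
    moreover have "(a \<circ> r) n \<in> vcarrier V" for n using a A by auto
    ultimately show ?thesis using limitin_weak[of "a \<circ> r" x] by (auto simp: o_def)
  qed
  have cluster: "\<exists>x. weak_cluster V a x" if a: "\<And>n. a n \<in> A" for a
  proof -
    obtain r x where r: "strict_mono (r :: nat \<Rightarrow> nat)" and x: "x \<in> vcarrier V"
      and lim: "\<And>f. f \<in> ?D \<Longrightarrow> (\<lambda>n. f (a (r n))) \<longlonglongrightarrow> f x" using seq'[of a] a by blast
    have "\<exists>n\<ge>N. norm (f (a n) - f x) < e" if f: "f \<in> ?D" "0 < e" for f e N
    proof -
      obtain M where "\<forall>n\<ge>M. norm (f (a (r n)) - f x) < e" using LIMSEQ_D[OF lim[OF f(1)] f(2)] by blast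
      then show ?thesis using seq_suble[OF r, of "max M N"] by (intro exI[of _ "r (max M N)"]) auto
    qed
    then show ?thesis using x unfolding weak_cluster_def by blast
  qed
  have "\<exists>M. \<forall>x\<in>A. norm (f x) \<le> M" if f: "f \<in> ?D" for f
  proof (rule ccontr)
    assume "\<not> ?thesis"
    then have "\<forall>n. \<exists>x\<in>A. real n < norm (f x)" by (metis not_le)
    then obtain a where a: "\<And>n. a n \<in> A" "\<And>n. real n < norm (f (a n))" by metis
    obtain x where "weak_cluster V a x" using cluster[of a] a(1) by blast
    moreover obtain N where N: "norm (f x) + 1 < real N" using reals_Archimedean2 by blast
    ultimately obtain n where n: "N \<le> n" "norm (f (a n) - f x) < 1"
      using f unfolding weak_cluster_def by (meson zero_less_one)
    have "norm (f (a n)) \<le> norm (f x) + norm (f (a n) - f x)" by (rule norm_triangle_sub)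
    then show False using a(2)[of n] n N by (simp add: not_less[symmetric])
  qed
  then obtain M where M: "\<And>x. x \<in> A \<Longrightarrow> vnorm V x \<le> M"
    using pointwise_bounded_imp_bounded[OF A] by blast
  have rep: "\<exists>x\<in>vcarrier V. \<forall>f\<in>?D. \<phi> f = f x" if ap: "approximable V A \<phi>" for \<phi>
  proof (rule ccontr)
    assume nrep: "\<not> ?thesis"
    obtain a where "\<And>n. a n \<in> A" "\<And>x. \<not> weak_cluster V a x"
      using unrepresented_imp_no_cluster_sequence[of A M \<phi>, OF A M ap nrep] by blast
    then show False using cluster[of a] by blast
  qed
  define T where "T = product_topology (\<lambda>f. euclidean :: 'a topology) ?D"
  define J where "J x = (\<lambda>f\<in>?D. f x)" for x
  have J_cont: "continuous_map (weak_topology V) T J"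
    unfolding T_def J_def continuous_map_componentwise
    by (auto simp: continuous_map_weak_dual)
  have J_inj: "x = y" if "x \<in> vcarrier V" "y \<in> vcarrier V" "J x = J y" for x y
  proof (rule dual_separates[OF that(1,2)])
    fix f assume "f \<in> ?D"
    then show "f x = f y" using fun_cong[OF that(3), of f] by (simp add: J_def)
  qed
  define K where "K = T closure_of (J ` A)"
  have KJ: "K \<subseteq> J ` vcarrier V"
  proof
    fix \<phi> assume \<phi>: "\<phi> \<in> K"
    then have \<phi>E: "\<phi> \<in> extensional ?D"
      using closure_of_subset_topspace[of T "J ` A"] unfolding K_def T_def by (auto simp: PiE_def)
    have "approximable V A \<phi>"
      unfolding approximable_def
    proof (intro allI impI, elim conjE)
      fix G and e :: real assume G: "finite G" "G \<subseteq> ?D" "0 < e"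
      define W where "W = (\<Pi>\<^sub>E f\<in>?D. if f \<in> G then ball (\<phi> f) e else UNIV)"
      have "openin T W"
        unfolding T_def W_def
      proof (rule product_topology_basis)
        show "finite {i. (if i \<in> G then ball (\<phi> i) e else UNIV) \<noteq> topspace euclidean}"
          by (rule finite_subset[OF _ G(1)]) auto
      qed auto
      moreover have "\<phi> \<in> W" using \<phi>E G(3) unfolding W_def by (auto simp: PiE_def)
      ultimately obtain y where "y \<in> J ` A" "y \<in> W" using \<phi> unfolding K_def in_closure_of by blast
      then obtain a where a: "a \<in> A" "J a \<in> W" by blast
      have "norm (f a - \<phi> f) < e" if "f \<in> G" for f
      proof -
        have f: "f \<in> ?D" using that G by blast
        have "J a f \<in> (if f \<in> G then ball (\<phi> f) e else UNIV)" using a(2) f unfolding W_def by (rule PiE_mem)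
        then show ?thesis using f that by (simp add: J_def dist_norm norm_minus_commute)
      qed
      then show "\<exists>a\<in>A. \<forall>f\<in>G. norm (f a - \<phi> f) < e" using a(1) by blast
    qed
    then obtain x where x: "x \<in> vcarrier V" "\<And>f. f \<in> ?D \<Longrightarrow> \<phi> f = f x" using rep by blast
    have "\<phi> = J x" by (rule extensionalityI[OF \<phi>E]) (auto simp: J_def x)
    then show "\<phi> \<in> J ` vcarrier V" using x by blast
  qed
  have "compactin T K"
  proof (rule closed_compactin)
    show "compactin T (\<Pi>\<^sub>E f\<in>?D. cball 0 (vnorm (dual_space V) f * M))"
      unfolding T_def compactin_PiE by (simp add: compact_cball_scalar)
    have clT: "closedin T (\<Pi>\<^sub>E f\<in>?D. cball 0 (vnorm (dual_space V) f * M))"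
      unfolding T_def closedin_product_topology by simp
    have "J x \<in> (\<Pi>\<^sub>E f\<in>?D. cball 0 (vnorm (dual_space V) f * M))" if "x \<in> A" for x
    proof -
      have "norm (f x) \<le> vnorm (dual_space V) f * M" if f: "f \<in> ?D" for f
        using dual_bound[OF f, of x] \<open>x \<in> A\<close> A M mult_left_mono[OF M[OF \<open>x \<in> A\<close>] dual_norm_nonneg[OF f]]
        by (meson order.trans subsetD)
      then show ?thesis unfolding J_def by auto
    qed
    then show "K \<subseteq> (\<Pi>\<^sub>E f\<in>?D. cball 0 (vnorm (dual_space V) f * M))"
      unfolding K_def by (intro closure_of_minimal clT) blast
    show "closedin T K" unfolding K_def by simp
  qed
  define R where "R = inv_into (vcarrier V) J"
  have RJ: "R (J x) = x" if "x \<in> vcarrier V" for x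
    unfolding R_def by (rule inv_into_f_f[OF _ that]) (use J_inj in \<open>auto simp: inj_on_def\<close>)
  have R_cont: "continuous_map (subtopology T (J ` vcarrier V)) (weak_topology V) R"
    unfolding weak_topology_def
  proof (rule continuous_on_generated_topo)
    have top: "topspace (subtopology T (J ` vcarrier V)) = J ` vcarrier V"
      by (auto simp: T_def J_def)
    fix S assume "S \<in> {{x \<in> vcarrier V. f x \<in> U} | f U. f \<in> vcarrier (dual_space V) \<and> open U}"
    then obtain f U where f: "f \<in> ?D" "open U" "S = {x \<in> vcarrier V. f x \<in> U}" by blast
    have "openin T {y \<in> topspace T. y f \<in> U}"
      using openin_continuous_map_preimage[OF continuous_map_product_projection[OF f(1)], of "\<lambda>_. euclidean" U] f(2)
      unfolding T_def by simp
    moreover have "R -` S \<inter> topspace (subtopology T (J ` vcarrier V)) = {y \<in> topspace T. y f \<in> U} \<inter> J ` vcarrier V"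
    proof -
      have "J x f = f x" "J x \<in> topspace T" for x using f(1) by (auto simp: J_def T_def)
      then show ?thesis unfolding top f(3) by (auto simp: RJ)
    qed
    ultimately show "openin (subtopology T (J ` vcarrier V)) (R -` S \<inter> topspace (subtopology T (J ` vcarrier V)))"
      unfolding openin_subtopology by blast
  next
    have "R ` topspace (subtopology T (J ` vcarrier V)) \<subseteq> vcarrier V"
      by (auto simp: RJ)
    then show "R ` topspace (subtopology T (J ` vcarrier V))
      \<subseteq> \<Union>{{x \<in> vcarrier V. f x \<in> U} | f U. f \<in> vcarrier (dual_space V) \<and> open U}"
      using topspace_weak unfolding weak_topology_def topology_generated_by_topspace by simp
  qed
  have "compactin (subtopology T (J ` vcarrier V)) K"
    using \<open>compactin T K\<close> KJ by (simp add: compactin_subtopology)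
  then have RK: "compactin (weak_topology V) (R ` K)" by (rule image_compactin[OF _ R_cont])
  have "weak_topology V closure_of A \<subseteq> R ` K"
  proof
    fix x assume x: "x \<in> weak_topology V closure_of A"
    then have "J x \<in> K"
      using continuous_map_image_closure_subset[OF J_cont, of A] unfolding K_def by blast
    moreover have "x \<in> vcarrier V" using x closure_of_subset_topspace[of "weak_topology V" A] by auto
    ultimately show "x \<in> R ` K" using RJ by (metis image_eqI)
  qed
  then have "compactin (weak_topology V) (weak_topology V closure_of A)"
    by (rule closed_compactin[OF RK]) simp
  then show ?thesis using A unfolding relatively_weakly_compact_def by blast
qed

section \<open>The space of absolutely summable sequences\<close>

lemma l1_simps:
  "a \<in> vcarrier l1_space \<longleftrightarrow> summable (\<lambda>n. norm (a n))"
  "vadd l1_space a b = (\<lambda>n. a n + b n)"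
  "vzero l1_space = (\<lambda>n. 0)"
  "vscale l1_space c a = (\<lambda>n. c * a n)"
  "vnorm l1_space a = (\<Sum>n. norm (a n))"
  by (simp_all add: l1_space_def)

lemma summable_norm_add:
  assumes "summable (\<lambda>n. norm (a n))" "summable (\<lambda>n. norm (b n))"
  shows "summable (\<lambda>n. norm (a n + b n))"
  by (rule summable_comparison_test'[OF summable_add[OF assms], of 0]) (simp add: norm_triangle_ineq)

lemma normed_space_l1: "normed_space (l1_space :: ('k::real_or_complex, nat \<Rightarrow> 'k) nspace)"
proof
  fix a b :: "nat \<Rightarrow> 'k"
  assume a: "a \<in> vcarrier l1_space" and b: "b \<in> vcarrier l1_space"
  show "vnorm l1_space (vadd l1_space a b) \<le> vnorm l1_space a + vnorm l1_space b"
    using a b unfolding l1_simps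
    by (subst suminf_add) (auto intro!: suminf_le summable_add summable_norm_add norm_triangle_ineq)
next
  fix a :: "nat \<Rightarrow> 'k" assume a: "a \<in> vcarrier l1_space"
  show "vnorm l1_space a = 0 \<longleftrightarrow> a = vzero l1_space"
    using a suminf_eq_zero_iff[of "\<lambda>n. norm (a n)"] unfolding l1_simps by auto
  show "\<exists>b\<in>vcarrier l1_space. vadd l1_space a b = vzero l1_space"
    using a by (intro bexI[of _ "\<lambda>n. - a n"]) (auto simp: l1_simps)
  show "vnorm l1_space (vscale l1_space c a) = norm c * vnorm l1_space a" for c
    using a unfolding l1_simps by (simp add: norm_mult suminf_mult)
qed (auto simp: l1_simps algebra_simps norm_mult summable_norm_add summable_mult)

lemma l1_partial_le: "a \<in> vcarrier l1_space \<Longrightarrow> (\<Sum>i<n. norm (a i)) \<le> vnorm l1_space a"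
  unfolding l1_simps by (rule sum_le_suminf) auto

lemma l1_coord_le:
  assumes "a \<in> vcarrier l1_space" shows "norm (a i) \<le> vnorm l1_space a"
proof -
  have "norm (a i) \<le> (\<Sum>j<Suc i. norm (a j))" by (rule member_le_sum) auto
  then show ?thesis using l1_partial_le[OF assms, of "Suc i"] by simp
qed

lemma l1_boundedI:
  assumes "\<And>n. (\<Sum>i<n. norm (a i)) \<le> K"
  shows "a \<in> vcarrier l1_space" "vnorm l1_space a \<le> K"
proof -
  have s: "summable (\<lambda>i. norm (a i))" by (rule summableI_nonneg_bounded[OF _ assms]) auto
  then show "a \<in> vcarrier l1_space" by (simp add: l1_simps)
  show "vnorm l1_space a \<le> K" unfolding l1_simps by (rule suminf_le_const[OF s assms])
qed

lemma banach_space_l1: "banach_space (l1_space :: ('k::real_or_complex, nat \<Rightarrow> 'k) nspace)"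
proof -
  interpret L: normed_space "l1_space :: ('k, nat \<Rightarrow> 'k) nspace" by (rule normed_space_l1)
  show ?thesis
  proof (rule L.banach_spaceI)
    fix s :: "nat \<Rightarrow> nat \<Rightarrow> 'k"
    assume s: "\<And>n. s n \<in> vcarrier l1_space"
      and C: "\<And>e. 0 < e \<Longrightarrow> \<exists>N. \<forall>m\<ge>N. \<forall>n\<ge>N. vnorm l1_space (vsub l1_space (s m) (s n)) < e"
    have "\<exists>l. (\<lambda>n. s n i) \<longlonglongrightarrow> l" for i
    proof -
      have "Cauchy (\<lambda>n. s n i)"
      proof (rule metric_CauchyI)
        fix e :: real assume "0 < e"
        then obtain N where N: "\<And>m n. N \<le> m \<Longrightarrow> N \<le> n \<Longrightarrow> vnorm l1_space (vsub l1_space (s m) (s n)) < e"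
          using C by blast
        have "dist (s m i) (s n i) < e" if "N \<le> m" "N \<le> n" for m n
          using l1_coord_le[OF L.add_closed[OF s[of m] L.scale_closed[OF s[of n], of "-1"]], of i] N[OF that]
          by (simp add: dist_norm l1_simps(2,4))
        then show "\<exists>M. \<forall>m\<ge>M. \<forall>n\<ge>M. dist (s m i) (s n i) < e" by blast
      qed
      then show ?thesis using Cauchy_scalar_convergent by metis
    qed
    then obtain l where l: "\<And>i. (\<lambda>n. s n i) \<longlonglongrightarrow> l i" by metis
    have near: "\<exists>N. \<forall>m\<ge>N. vsub l1_space (s m) l \<in> vcarrier l1_space \<and> vnorm l1_space (vsub l1_space (s m) l) \<le> e"
      if e: "0 < e" for e
    proof -
      obtain N where N: "\<And>m n. N \<le> m \<Longrightarrow> N \<le> n \<Longrightarrow> vnorm l1_space (vsub l1_space (s m) (s n)) < e"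
        using C e by blast
      have "(\<Sum>i<k. norm (vsub l1_space (s m) l i)) \<le> e" if m: "N \<le> m" for m k
      proof (rule tendsto_upperbound)
        show "(\<lambda>n. \<Sum>i<k. norm (vsub l1_space (s m) (s n) i)) \<longlonglongrightarrow> (\<Sum>i<k. norm (vsub l1_space (s m) l i))"
          unfolding l1_simps by (intro tendsto_intros l)
        show "\<forall>\<^sub>F n in sequentially. (\<Sum>i<k. norm (vsub l1_space (s m) (s n) i)) \<le> e"
        proof (rule eventually_sequentiallyI)
          fix n assume "N \<le> n"
          then show "(\<Sum>i<k. norm (vsub l1_space (s m) (s n) i)) \<le> e"
            using l1_partial_le[of "vsub l1_space (s m) (s n)" k] N[OF m] s
            by (meson L.add_closed L.scale_closed less_imp_le order.trans)
        qed
      qed simp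
      then show ?thesis using l1_boundedI by blast
    qed
    obtain N where "vsub l1_space (s N) l \<in> vcarrier l1_space" using near[of 1] by auto
    then have "vsub l1_space (s N) (vsub l1_space (s N) l) \<in> vcarrier l1_space"
      using L.add_closed[OF s L.scale_closed] by blast
    then have lc: "l \<in> vcarrier l1_space" by (simp add: l1_simps)
    have "(\<lambda>n. vnorm l1_space (vsub l1_space (s n) l)) \<longlonglongrightarrow> 0"
    proof (rule LIMSEQ_I)
      fix r :: real assume "0 < r"
      then obtain N where "\<And>m. N \<le> m \<Longrightarrow> vnorm l1_space (vsub l1_space (s m) l) \<le> r / 2"
        using near[of "r/2"] by auto
      then show "\<exists>no. \<forall>n\<ge>no. norm (vnorm l1_space (vsub l1_space (s n) l) - 0) < r"
        using \<open>0 < r\<close> L.norm_nonneg[of "vsub l1_space (s n) l" for n] s lc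
        by (intro exI[of _ N]) (force simp: L.closed)
    qed
    then show "\<exists>l\<in>vcarrier l1_space. (\<lambda>n. vnorm l1_space (vsub l1_space (s n) l)) \<longlonglongrightarrow> 0" using lc by blast
  qed
qed

definition unit_seq :: "nat \<Rightarrow> nat \<Rightarrow> 'k::real_or_complex" where
  "unit_seq n = (\<lambda>i. if i = n then 1 else 0)"

lemma unit_seq_sums: "(\<lambda>i. norm (unit_seq n i :: 'k::real_or_complex)) sums 1"
proof -
  have "(\<lambda>i. norm (unit_seq n i :: 'k)) = (\<lambda>i. if i = n then (1::real) else 0)" by (auto simp: unit_seq_def)
  then show ?thesis using sums_single[of n "\<lambda>_. 1::real"] by simp
qed

lemma unit_seq_l1: "unit_seq n \<in> vcarrier l1_space" "vnorm l1_space (unit_seq n) = 1"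
  using unit_seq_sums sums_iff unfolding l1_simps by blast+

section \<open>Absolutely convergent series in a Banach space\<close>

text \<open>The synthesis operator: the sum of the series of the \<open>a n y\<^sub>n\<close>, for summable \<open>a\<close> and bounded \<open>y\<close>.\<close>

definition synth :: "('k::real_or_complex, 'a) nspace \<Rightarrow> (nat \<Rightarrow> 'a) \<Rightarrow> (nat \<Rightarrow> 'k) \<Rightarrow> 'a" where
  "synth V y a = (SOME x. x \<in> vcarrier V \<and> (\<lambda>n. vnorm V (vsub V (vsum V a y n) x)) \<longlonglongrightarrow> 0)"

context banach_space
begin

context
  fixes y :: "nat \<Rightarrow> 'b" and K :: real
  assumes y: "\<And>n. y n \<in> vcarrier V" "\<And>n. vnorm V (y n) \<le> K"
begin

lemma synth_limit:
  assumes a: "a \<in> vcarrier l1_space"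
  shows "synth V y a \<in> vcarrier V" "(\<lambda>n. vnorm V (vsub V (vsum V a y n) (synth V y a))) \<longlonglongrightarrow> 0"
proof -
  have K0: "0 \<le> K" using y norm_nonneg order.trans by blast
  have vc: "vsum V a y n \<in> vcarrier V" for n using y vsum_closed by blast
  have diff: "vnorm V (vsub V (vsum V a y m) (vsum V a y n)) \<le> K * (\<Sum>i\<in>{n..<m}. norm (a i))" if nm: "n \<le> m" for m n
  proof (rule norm_leI)
    fix f assume f: "f \<in> vcarrier (dual_space V)" "vnorm (dual_space V) f \<le> 1"
    have "f (vsub V (vsum V a y m) (vsum V a y n)) = (\<Sum>i<m. a i * f (y i)) - (\<Sum>i<n. a i * f (y i))"
      using f vc y by (simp add: dual_vsub dual_vsum)
    also have "\<dots> = (\<Sum>i\<in>{n..<m}. a i * f (y i))" using nm by (simp add: sum_diff_nat_ivl lessThan_atLeast0)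
    also have "norm \<dots> \<le> (\<Sum>i\<in>{n..<m}. norm (a i) * K)"
    proof (intro order.trans[OF norm_sum] sum_mono)
      fix i
      have "norm (f (y i)) \<le> K" using dual_ball_bound[OF f y(1)[of i]] y(2)[of i] by simp
      then show "norm (a i * f (y i)) \<le> norm (a i) * K" by (simp add: norm_mult mult_left_mono)
    qed
    finally show "norm (f (vsub V (vsum V a y m) (vsum V a y n))) \<le> K * (\<Sum>i\<in>{n..<m}. norm (a i))"
      by (simp add: sum_distrib_left mult.commute)
  qed (simp add: closed vc)
  obtain l where "l \<in> vcarrier V" "(\<lambda>n. vnorm V (vsub V (vsum V a y n) l)) \<longlonglongrightarrow> 0"
  proof (rule Cauchy_converges[of "vsum V a y", OF vc])
    fix e :: real assume e: "0 < e"
    have "0 < e / (K + 1)" using e K0 by simp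
    moreover have "summable (\<lambda>i. norm (a i))" using a by (simp add: l1_simps)
    ultimately obtain N where N: "\<And>m n. N \<le> m \<Longrightarrow> norm (\<Sum>i\<in>{m..<n}. norm (a i)) < e / (K + 1)"
      unfolding summable_Cauchy by blast
    have ord: "vnorm V (vsub V (vsum V a y m) (vsum V a y n)) < e" if "N \<le> n" "n \<le> m" for m n
    proof -
      have "K * (\<Sum>i\<in>{n..<m}. norm (a i)) \<le> (K + 1) * (\<Sum>i\<in>{n..<m}. norm (a i))"
        by (intro mult_right_mono sum_nonneg) auto
      also have "\<dots> < (K + 1) * (e / (K + 1))" using N[OF that(1), of m] K0 by (intro mult_strict_left_mono) auto
      also have "\<dots> = e" using K0 by simp
      finally show ?thesis using diff[OF that(2)] by simp
    qed
    show "\<exists>N. \<forall>m\<ge>N. \<forall>n\<ge>N. vnorm V (vsub V (vsum V a y m) (vsum V a y n)) < e"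
    proof (intro exI[of _ N] allI impI)
      fix m n assume "N \<le> m" "N \<le> n"
      then show "vnorm V (vsub V (vsum V a y m) (vsum V a y n)) < e"
        using ord[of n m] ord[of m n] norm_vsub_commute[OF vc vc] by (metis nle_le)
    qed
  qed
  then have "\<exists>x. x \<in> vcarrier V \<and> (\<lambda>n. vnorm V (vsub V (vsum V a y n) x)) \<longlonglongrightarrow> 0" by blast
  from someI_ex[OF this]
  show "synth V y a \<in> vcarrier V" "(\<lambda>n. vnorm V (vsub V (vsum V a y n) (synth V y a))) \<longlonglongrightarrow> 0"
    unfolding synth_def by auto
qed

text \<open>Together with the separation of points by functionals, this reduces the properties of \<open>synth\<close> to those of
scalar series.\<close>

lemma dual_synth:
  assumes a: "a \<in> vcarrier l1_space" and f: "f \<in> vcarrier (dual_space V)"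
  shows "(\<lambda>i. a i * f (y i)) sums f (synth V y a)"
proof -
  have vc: "vsum V a y n \<in> vcarrier V" for n using y vsum_closed by blast
  have "(\<lambda>n. vnorm (dual_space V) f * vnorm V (vsub V (vsum V a y n) (synth V y a))) \<longlonglongrightarrow> vnorm (dual_space V) f * 0"
    by (intro tendsto_mult tendsto_const synth_limit a)
  then have lim: "(\<lambda>n. vnorm (dual_space V) f * vnorm V (vsub V (vsum V a y n) (synth V y a))) \<longlonglongrightarrow> 0" by simp
  have "norm ((\<Sum>i<n. a i * f (y i)) - f (synth V y a))
      \<le> vnorm (dual_space V) f * vnorm V (vsub V (vsum V a y n) (synth V y a))" for n
    using dual_bound[OF f, of "vsub V (vsum V a y n) (synth V y a)"] f vc y synth_limit(1)[OF a]
    by (simp add: closed dual_vsub dual_vsum)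
  then have "(\<lambda>n. (\<Sum>i<n. a i * f (y i)) - f (synth V y a)) \<longlonglongrightarrow> 0"
    by (intro Lim_null_comparison[OF always_eventually lim] allI)
  then show ?thesis unfolding sums_def by (simp add: LIM_zero_iff)
qed

lemma synth_linear: "linear_between l1_space V (synth V y)"
  unfolding linear_between_def
proof (intro conjI ballI allI)
  interpret L: normed_space "l1_space :: ('a, nat \<Rightarrow> 'a) nspace" by (rule normed_space_l1)
  show "synth V y a \<in> vcarrier V" if "a \<in> vcarrier l1_space" for a using synth_limit that by blast
  fix a :: "nat \<Rightarrow> 'a" assume a: "a \<in> vcarrier l1_space"
  show "synth V y (vadd l1_space a b) = vadd V (synth V y a) (synth V y b)" if b: "b \<in> vcarrier l1_space" for b
  proof (rule dual_separates)
    fix f assume f: "f \<in> vcarrier (dual_space V)"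
    have "(\<lambda>i. a i * f (y i) + b i * f (y i)) sums (f (synth V y a) + f (synth V y b))"
      by (intro sums_add dual_synth a b f)
    moreover have "(\<lambda>i. a i * f (y i) + b i * f (y i)) sums f (synth V y (vadd l1_space a b))"
      using dual_synth[OF L.add_closed[OF a b] f] by (simp add: l1_simps distrib_right)
    ultimately show "f (synth V y (vadd l1_space a b)) = f (vadd V (synth V y a) (synth V y b))"
      using sums_unique2 f a b synth_limit(1) by (simp add: dual_add)
  qed (use a b in \<open>simp_all add: closed synth_limit L.closed\<close>)
  show "synth V y (vscale l1_space c a) = vscale V c (synth V y a)" for c
  proof (rule dual_separates)
    fix f assume f: "f \<in> vcarrier (dual_space V)"
    have "(\<lambda>i. c * (a i * f (y i))) sums (c * f (synth V y a))"
      by (intro sums_mult dual_synth a f)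
    moreover have "(\<lambda>i. c * (a i * f (y i))) sums f (synth V y (vscale l1_space c a))"
      using dual_synth[OF L.scale_closed[OF a] f, of c] by (simp add: l1_simps mult.assoc)
    ultimately show "f (synth V y (vscale l1_space c a)) = f (vscale V c (synth V y a))"
      using sums_unique2 f a synth_limit(1) by (simp add: dual_scale)
  qed (use a in \<open>simp_all add: closed synth_limit L.closed\<close>)
qed

lemma synth_bound:
  assumes a: "a \<in> vcarrier l1_space"
  shows "vnorm V (synth V y a) \<le> K * vnorm l1_space a"
proof (rule norm_leI[OF synth_limit(1)[OF a]])
  have K0: "0 \<le> K" using y norm_nonneg order.trans by blast
  fix f assume f: "f \<in> vcarrier (dual_space V)" "vnorm (dual_space V) f \<le> 1"
  have b: "norm (f (y i)) \<le> K" for i using dual_ball_bound[OF f y(1)[of i]] y(2)[of i] by simp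
  have "(\<lambda>n. norm (\<Sum>i<n. a i * f (y i))) \<longlonglongrightarrow> norm (f (synth V y a))"
    using dual_synth[OF a f(1)] unfolding sums_def by (rule tendsto_norm)
  moreover have "norm (\<Sum>i<n. a i * f (y i)) \<le> K * vnorm l1_space a" for n
  proof -
    have "norm (\<Sum>i<n. a i * f (y i)) \<le> (\<Sum>i<n. norm (a i) * K)"
      by (intro order.trans[OF norm_sum] sum_mono) (simp add: norm_mult mult_left_mono b)
    also have "\<dots> = K * (\<Sum>i<n. norm (a i))" by (simp add: sum_distrib_left mult.commute)
    also have "\<dots> \<le> K * vnorm l1_space a" by (rule mult_left_mono[OF l1_partial_le[OF a] K0])
    finally show ?thesis .
  qed
  ultimately show "norm (f (synth V y a)) \<le> K * vnorm l1_space a"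
    by (intro tendsto_upperbound[where F = sequentially]) auto
qed

lemma synth_unit: "synth V y (unit_seq n) = y n"
proof (rule dual_separates[OF synth_limit(1)[OF unit_seq_l1(1)] y(1)])
  fix f assume f: "f \<in> vcarrier (dual_space V)"
  have "(\<lambda>i. unit_seq n i * f (y i)) = (\<lambda>i. if i = n then f (y i) else 0)" by (auto simp: unit_seq_def)
  then have "(\<lambda>i. unit_seq n i * f (y i)) sums f (y n)" using sums_single[of n "\<lambda>i. f (y i)"] by simp
  then show "f (synth V y (unit_seq n)) = f (y n)" using dual_synth[OF unit_seq_l1(1) f] sums_unique2 by blast
qed

end

end

section \<open>Copies of \<open>\<ell>\<^sub>1\<close>\<close>

lemma (in normed_space) normed_space_subspace:
  assumes "M \<subseteq> vcarrier V" "vzero V \<in> M" "\<And>x y. x \<in> M \<Longrightarrow> y \<in> M \<Longrightarrow> vadd V x y \<in> M"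
    "\<And>c x. x \<in> M \<Longrightarrow> vscale V c x \<in> M"
  shows "normed_space (V\<lparr>vcarrier := M\<rparr>)"
proof
  fix x assume "x \<in> vcarrier (V\<lparr>vcarrier := M\<rparr>)"
  then have "vscale V (-1) x \<in> M" "vadd V x (vscale V (-1) x) = vzero V" using assms add_minus by auto
  then show "\<exists>y\<in>vcarrier (V\<lparr>vcarrier := M\<rparr>). vadd (V\<lparr>vcarrier := M\<rparr>) x y = vzero (V\<lparr>vcarrier := M\<rparr>)"
    by auto
qed (use assms in \<open>auto simp: subset_iff add_ac add_zero scale_add_right scale_add_left
  scale_scale scale_one norm_eq_zero norm_scale norm_triangle\<close>)

text \<open>If \<open>T\<close> is an isomorphism from a subspace onto \<open>\<ell>\<^sub>1\<close>, the functional \<open>y \<mapsto> \<Sum>\<^sub>n \<epsilon>\<^sub>n (T y)\<^sub>n\<close> has norm at most that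
of \<open>T\<close> and extends to the whole space.\<close>

lemma (in normed_space) l1_copy_interpolation:
  assumes "contains_copy_of_l1 V"
  obtains x K C where "\<And>n. x n \<in> vcarrier V" "\<And>n. vnorm V (x n) \<le> K"
    "\<And>\<epsilon> :: nat \<Rightarrow> 'k. (\<And>n. norm (\<epsilon> n) \<le> 1) \<Longrightarrow>
      \<exists>g\<in>vcarrier (dual_space V). vnorm (dual_space V) g \<le> C \<and> (\<forall>n. g (x n) = \<epsilon> n)"
proof -
  interpret L: normed_space "l1_space :: ('k, nat \<Rightarrow> 'k) nspace" by (rule normed_space_l1)
  obtain M T where M: "closed_subspace V M" and T: "linear_between (V\<lparr>vcarrier := M\<rparr>) l1_space T"
    "homeomorphic_map (norm_topology (V\<lparr>vcarrier := M\<rparr>)) (norm_topology (l1_space :: ('k, nat \<Rightarrow> 'k) nspace)) T"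
    using assms unfolding contains_copy_of_l1_def isomorphic_nspace_def by blast
  have Ms: "M \<subseteq> vcarrier V" "vzero V \<in> M" "\<And>x y. x \<in> M \<Longrightarrow> y \<in> M \<Longrightarrow> vadd V x y \<in> M"
    "\<And>c x. x \<in> M \<Longrightarrow> vscale V c x \<in> M" using M unfolding closed_subspace_def by auto
  interpret M: normed_space "V\<lparr>vcarrier := M\<rparr>" by (rule normed_space_subspace[OF Ms])
  obtain g where g: "homeomorphic_maps (norm_topology (V\<lparr>vcarrier := M\<rparr>)) (norm_topology (l1_space :: ('k, nat \<Rightarrow> 'k) nspace)) T g"
    using T(2) homeomorphic_map_maps by blast
  have gT: "g (T x) = x" if "x \<in> M" for x using g that unfolding homeomorphic_maps_def by simp
  have Tg: "T (g a) = a" if "a \<in> vcarrier l1_space" for a using g that unfolding homeomorphic_maps_def by simp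
  have gM: "g a \<in> M" if "a \<in> vcarrier l1_space" for a
    using g that unfolding homeomorphic_maps_def continuous_map_def by auto
  have TM: "T x \<in> vcarrier l1_space" and T_add: "y \<in> M \<Longrightarrow> T (vadd V x y) = vadd l1_space (T x) (T y)"
    and T_scale: "T (vscale V c x) = vscale l1_space c (T x)" if "x \<in> M" for x y c
    using linear_betweenD[OF T(1)] that by simp_all
  have g_lin: "linear_between l1_space (V\<lparr>vcarrier := M\<rparr>) g"
    unfolding linear_between_def
  proof (intro conjI ballI allI)
    show "g (vadd l1_space a b) = vadd (V\<lparr>vcarrier := M\<rparr>) (g a) (g b)"
      if "a \<in> vcarrier l1_space" "b \<in> vcarrier l1_space" for a b
      using gT[OF Ms(3)[OF gM[OF that(1)] gM[OF that(2)]]] by (simp add: T_add gM Tg that)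
    show "g (vscale l1_space c a) = vscale (V\<lparr>vcarrier := M\<rparr>) c (g a)" if "a \<in> vcarrier l1_space" for a c
      using gT[OF Ms(4)[OF gM[OF that]], of c] by (simp add: T_scale gM Tg that)
  qed (simp add: gM)
  obtain K where K: "\<And>a. a \<in> vcarrier l1_space \<Longrightarrow> vnorm V (g a) \<le> K * vnorm l1_space a"
    using L.linear_continuous_iff[OF M.normed_space_axioms g_lin] g unfolding homeomorphic_maps_def by auto
  obtain C0 where C0: "\<And>y. y \<in> M \<Longrightarrow> vnorm l1_space (T y) \<le> C0 * vnorm V y"
    using M.linear_continuous_iff[OF L.normed_space_axioms T(1)] g unfolding homeomorphic_maps_def by auto
  define C where "C = \<bar>C0\<bar>"
  have C: "vnorm l1_space (T y) \<le> C * vnorm V y" if "y \<in> M" for y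
  proof -
    have "C0 * vnorm V y \<le> C * vnorm V y" unfolding C_def using norm_nonneg Ms(1) that
      by (intro mult_right_mono) auto
    then show ?thesis using C0[OF that] by simp
  qed
  define x where "x n = g (unit_seq n)" for n
  show thesis
  proof (rule that)
    show "x n \<in> vcarrier V" for n using gM[OF unit_seq_l1(1)] Ms(1) by (auto simp: x_def)
    show "vnorm V (x n) \<le> K" for n using K[OF unit_seq_l1(1)[of n]] by (simp add: x_def unit_seq_l1(2))
    fix \<epsilon> :: "nat \<Rightarrow> 'k" assume e: "\<And>n. norm (\<epsilon> n) \<le> 1"
    have le: "norm (\<epsilon> n * a n) \<le> norm (a n)" for a n
      using e[of n] by (simp add: norm_mult mult_left_le_one_le)
    have sn: "summable (\<lambda>n. norm (\<epsilon> n * a n))" if "a \<in> vcarrier l1_space" for a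
      by (rule summable_comparison_test'[of "\<lambda>n. norm (a n)" 0]) (use that le in \<open>auto simp: l1_simps\<close>)
    have s: "summable (\<lambda>n. \<epsilon> n * a n)" if "a \<in> vcarrier l1_space" for a
      by (rule summable_norm_scalar[OF sn[OF that]])
    have bd: "norm (\<Sum>n. \<epsilon> n * a n) \<le> vnorm l1_space a" if a: "a \<in> vcarrier l1_space" for a
    proof (rule tendsto_upperbound)
      show "(\<lambda>k. norm (\<Sum>n<k. \<epsilon> n * a n)) \<longlonglongrightarrow> norm (\<Sum>n. \<epsilon> n * a n)"
        using summable_sums[OF s[OF a]] unfolding sums_def by (rule tendsto_norm)
      have "norm (\<Sum>n<k. \<epsilon> n * a n) \<le> vnorm l1_space a" for k
      proof -
        have "norm (\<Sum>n<k. \<epsilon> n * a n) \<le> (\<Sum>n<k. norm (a n))"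
          by (rule order.trans[OF norm_sum sum_mono]) (rule le)
        then show ?thesis using l1_partial_le[OF a, of k] by simp
      qed
      then show "\<forall>\<^sub>F k in sequentially. norm (\<Sum>n<k. \<epsilon> n * a n) \<le> vnorm l1_space a" by simp
    qed simp
    define h where "h y = (\<Sum>n. \<epsilon> n * T y n)" for y
    obtain f where f: "f \<in> vcarrier (dual_space V)" "vnorm (dual_space V) f \<le> C" "\<And>y. y \<in> M \<Longrightarrow> f y = h y"
    proof (rule Hahn_Banach_bounded[OF Ms, of h C])
      show "h (vadd V y z) = h y + h z" if "y \<in> M" "z \<in> M" for y z
        unfolding h_def T_add[OF that] l1_simps using suminf_add[OF s[OF TM[OF that(1)]] s[OF TM[OF that(2)]]]
        by (simp add: distrib_left)
      show "h (vscale V c y) = c * h y" if "y \<in> M" for c y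
        unfolding h_def T_scale[OF that] l1_simps using suminf_mult[OF s[OF TM[OF that]], of c]
        by (simp add: mult.left_commute)
      show "norm (h y) \<le> C * vnorm V y" if "y \<in> M" for y
        unfolding h_def using bd[OF TM[OF that]] C[OF that] by simp
      show "0 \<le> C" by (simp add: C_def)
    qed auto
    have "f (x n) = \<epsilon> n" for n
    proof -
      have "f (x n) = (\<Sum>i. \<epsilon> i * unit_seq n i)"
        using f(3)[OF gM[OF unit_seq_l1(1)[of n]]] Tg[OF unit_seq_l1(1)[of n]] by (simp add: x_def h_def)
      also have "(\<lambda>i. \<epsilon> i * unit_seq n i) = (\<lambda>i. if i = n then \<epsilon> i else 0)" by (auto simp: unit_seq_def)
      also have "(\<Sum>i. if i = n then \<epsilon> i else 0) = \<epsilon> n" using sums_single[of n \<epsilon>] sums_iff by blast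
      finally show ?thesis .
    qed
    then show "\<exists>g\<in>vcarrier (dual_space V). vnorm (dual_space V) g \<le> C \<and> (\<forall>n. g (x n) = \<epsilon> n)" using f by blast
  qed
qed

text \<open>The lower estimate makes the synthesis operator an isomorphism onto its range, and the range is closed
because \<open>\<ell>\<^sub>1\<close> is complete.\<close>

lemma (in banach_space) l1_basis_imp_copy:
  assumes x: "\<And>n. x n \<in> vcarrier V" "\<And>n. vnorm V (x n) \<le> K"
    and c: "0 < c" and low: "\<And>a n. c * (\<Sum>i<n. norm (a i)) \<le> vnorm V (vsum V a x n)"
  shows "contains_copy_of_l1 V"
proof -
  let ?l1 = "l1_space :: ('a, nat \<Rightarrow> 'a) nspace"
  interpret L: banach_space ?l1 by (rule banach_space_l1)
  define S where "S = synth V x"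
  have S_lin: "linear_between l1_space V S" unfolding S_def by (rule synth_linear[OF x])
  note S = linear_betweenD[OF S_lin]
  have S_low: "c * vnorm l1_space a \<le> vnorm V (S a)" if a: "a \<in> vcarrier l1_space" for a
  proof (rule tendsto_le[OF trivial_limit_sequentially])
    have vc: "vsum V a x n \<in> vcarrier V" for n using x vsum_closed by blast
    have "(\<lambda>n. vnorm V (S a) + vnorm V (vsub V (vsum V a x n) (S a))) \<longlonglongrightarrow> vnorm V (S a) + 0"
      unfolding S_def by (intro tendsto_add tendsto_const synth_limit(2)[OF x a])
    then show "(\<lambda>n. vnorm V (S a) + vnorm V (vsub V (vsum V a x n) (S a))) \<longlonglongrightarrow> vnorm V (S a)" by simp
    have "summable (\<lambda>i. norm (a i))" using a by (simp add: l1_simps)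
    then show "(\<lambda>n. c * (\<Sum>i<n. norm (a i))) \<longlonglongrightarrow> c * vnorm l1_space a"
      unfolding l1_simps by (intro tendsto_mult tendsto_const summable_LIMSEQ)
    have "c * (\<Sum>i<n. norm (a i)) \<le> vnorm V (S a) + vnorm V (vsub V (vsum V a x n) (S a))" for n
    proof -
      have "vadd V (S a) (vsub V (vsum V a x n) (S a)) = vadd V (vsum V a x n) (vadd V (S a) (vscale V (-1) (S a)))"
        using vc S(1)[OF a] by (simp add: add_ac closed)
      also have "\<dots> = vsum V a x n" using vc S(1)[OF a] by (simp add: add_minus add_zero)
      finally show ?thesis using low[of a n] norm_triangle[of "S a" "vsub V (vsum V a x n) (S a)"] vc S(1)[OF a]
        by (simp add: closed)
    qed
    then show "\<forall>\<^sub>F n in sequentially. c * (\<Sum>i<n. norm (a i)) \<le> vnorm V (S a) + vnorm V (vsub V (vsum V a x n) (S a))"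
      by simp
  qed
  have S_sub: "S (vsub l1_space a b) = vsub V (S a) (S b)" if "a \<in> vcarrier l1_space" "b \<in> vcarrier l1_space" for a b
    using that by (simp add: S L.closed)
  have S_inj: "a = b" if "a \<in> vcarrier l1_space" "b \<in> vcarrier l1_space" "S a = S b" for a b
  proof -
    have ab: "vsub l1_space a b \<in> vcarrier l1_space" using that by (simp add: L.closed)
    have "c * vnorm l1_space (vsub l1_space a b) \<le> 0"
      using S_low[OF ab] S_sub[OF that(1,2)] that S(1) by (simp add: add_minus)
    then have "vnorm l1_space (vsub l1_space a b) = 0" using c L.norm_nonneg[OF ab] by (simp add: mult_le_0_iff)
    then show ?thesis using L.norm_eq_zero[OF ab] by (auto simp: l1_simps fun_eq_iff)
  qed
  define M where "M = S ` vcarrier l1_space"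
  have Ms: "M \<subseteq> vcarrier V" "vzero V \<in> M" "\<And>x y. x \<in> M \<Longrightarrow> y \<in> M \<Longrightarrow> vadd V x y \<in> M"
    "\<And>c x. x \<in> M \<Longrightarrow> vscale V c x \<in> M"
    unfolding M_def using S L.closed L.linear_between_zero[OF normed_space_axioms S_lin]
    by (auto simp flip: S(2,3)) (metis L.zero_closed image_eqI)
  interpret M: normed_space "V\<lparr>vcarrier := M\<rparr>" by (rule normed_space_subspace[OF Ms])
  have "closedin (norm_topology V) M"
  proof -
    interpret MS: Metric_space "vcarrier V" "vdist V" by (rule Metric_space_vdist)
    show ?thesis
      unfolding norm_topology_def MS.metric_closedin_iff_sequentially_closed
    proof (intro conjI allI impI Ms(1), elim conjE)
      fix \<sigma> l assume \<sigma>: "range \<sigma> \<subseteq> M" and lim: "limitin MS.mtopology \<sigma> l sequentially"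
      have \<sigma>c: "\<sigma> n \<in> vcarrier V" for n using \<sigma> Ms(1) by auto
      have l: "l \<in> vcarrier V" "(\<lambda>n. vnorm V (vsub V (\<sigma> n) l)) \<longlonglongrightarrow> 0"
        using lim limitin_norm[of \<sigma> l] \<sigma>c unfolding norm_topology_def by auto
      have "\<forall>n. \<exists>a\<in>vcarrier l1_space. \<sigma> n = S a" using \<sigma> unfolding M_def by auto
      then obtain a where a: "\<And>n. a n \<in> vcarrier l1_space" "\<And>n. \<sigma> n = S (a n)" by metis
      obtain b where b: "b \<in> vcarrier l1_space" "(\<lambda>n. vnorm l1_space (vsub l1_space (a n) b)) \<longlonglongrightarrow> 0"
      proof (rule L.Cauchy_converges[of a, OF a(1)])
        fix e :: real assume e: "0 < e"
        then obtain N where N: "\<And>n. N \<le> n \<Longrightarrow> vnorm V (vsub V (\<sigma> n) l) < c * e / 2"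
          using LIMSEQ_D[OF l(2), of "c * e / 2"] c norm_nonneg[of "vsub V (\<sigma> n) l" for n] \<sigma>c l(1)
          by (auto simp: closed)
        have "vnorm l1_space (vsub l1_space (a m) (a n)) < e" if "N \<le> m" "N \<le> n" for m n
        proof -
          have ab: "vsub l1_space (a m) (a n) \<in> vcarrier l1_space" using a by (simp add: L.closed)
          have "vadd V (vsub V (\<sigma> m) l) (vsub V l (\<sigma> n)) = vadd V (vsub V (\<sigma> m) (\<sigma> n)) (vadd V l (vscale V (-1) l))"
            using \<sigma>c l(1) by (simp add: add_ac closed)
          also have "\<dots> = vsub V (\<sigma> m) (\<sigma> n)" using \<sigma>c l(1) by (simp add: add_minus add_zero closed)
          finally have "vnorm V (vsub V (\<sigma> m) (\<sigma> n)) \<le> vnorm V (vsub V (\<sigma> m) l) + vnorm V (vsub V l (\<sigma> n))"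
            using norm_triangle[of "vsub V (\<sigma> m) l" "vsub V l (\<sigma> n)"] \<sigma>c l(1) by (simp add: closed)
          then have "vnorm V (vsub V (\<sigma> m) (\<sigma> n)) < c * e"
            using N[OF that(1)] N[OF that(2)] norm_vsub_commute[OF l(1) \<sigma>c[of n]] by simp
          then have "c * vnorm l1_space (vsub l1_space (a m) (a n)) < c * e"
            using S_low[OF ab] S_sub[OF a(1) a(1)] a(2) by simp
          then show ?thesis using c by simp
        qed
        then show "\<exists>N. \<forall>m\<ge>N. \<forall>n\<ge>N. vnorm l1_space (vsub l1_space (a m) (a n)) < e" by blast
      qed
      have "(\<lambda>n. K * vnorm l1_space (vsub l1_space (a n) b)) \<longlonglongrightarrow> K * 0" by (intro tendsto_mult tendsto_const b)
      then have lim0: "(\<lambda>n. K * vnorm l1_space (vsub l1_space (a n) b)) \<longlonglongrightarrow> 0" by simp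
      have "norm (vnorm V (vsub V (\<sigma> n) (S b))) \<le> K * vnorm l1_space (vsub l1_space (a n) b)" for n
        using synth_bound[of x K "vsub l1_space (a n) b", OF x, folded S_def] S_sub[OF a(1) b(1), of n] a(1)[of n] b(1)
          norm_nonneg[of "vsub V (\<sigma> n) (S b)"] \<sigma>c S(1)[OF b(1)]
        by (simp add: L.closed closed a(2))
      then have "(\<lambda>n. vnorm V (vsub V (\<sigma> n) (S b))) \<longlonglongrightarrow> 0"
        by (intro Lim_null_comparison[OF always_eventually lim0] allI)
      then have "limitin MS.mtopology \<sigma> (S b) sequentially"
        using limitin_norm[of \<sigma> "S b"] \<sigma>c S(1)[OF b(1)] unfolding norm_topology_def by blast
      then have "l = S b" using MS.limitin_metric_unique lim trivial_limit_sequentially by blast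
      then show "l \<in> M" using b(1) unfolding M_def by blast
    qed
  qed
  then have "closed_subspace V M" using Ms unfolding closed_subspace_def by blast
  moreover have "isomorphic_nspace (V\<lparr>vcarrier := M\<rparr>) ?l1"
  proof -
    define T where "T = inv_into (vcarrier l1_space) S"
    have TS: "T (S a) = a" if "a \<in> vcarrier l1_space" for a
      unfolding T_def by (rule inv_into_f_f[OF _ that]) (use S_inj in \<open>auto simp: inj_on_def\<close>)
    have ST: "S (T z) = z" "T z \<in> vcarrier l1_space" if "z \<in> M" for z
      using that TS unfolding M_def by auto
    have T_lin: "linear_between (V\<lparr>vcarrier := M\<rparr>) ?l1 T"
      unfolding linear_between_def
    proof (intro conjI ballI allI)
      show "T (vadd (V\<lparr>vcarrier := M\<rparr>) z w) = vadd l1_space (T z) (T w)"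
        if "z \<in> vcarrier (V\<lparr>vcarrier := M\<rparr>)" "w \<in> vcarrier (V\<lparr>vcarrier := M\<rparr>)" for z w
        using that TS[of "vadd l1_space (T z) (T w)"] by (simp add: ST L.closed S)
      show "T (vscale (V\<lparr>vcarrier := M\<rparr>) d z) = vscale l1_space d (T z)"
        if "z \<in> vcarrier (V\<lparr>vcarrier := M\<rparr>)" for d z
        using that TS[of "vscale l1_space d (T z)"] by (simp add: ST L.closed S)
    qed (simp add: ST)
    have S_lin': "linear_between ?l1 (V\<lparr>vcarrier := M\<rparr>) S"
      using S_lin unfolding linear_between_def M_def by auto
    have "\<exists>K. \<forall>z\<in>vcarrier (V\<lparr>vcarrier := M\<rparr>). vnorm l1_space (T z) \<le> K * vnorm (V\<lparr>vcarrier := M\<rparr>) z"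
    proof (intro exI[of _ "1 / c"] ballI)
      fix z assume "z \<in> vcarrier (V\<lparr>vcarrier := M\<rparr>)"
      then show "vnorm l1_space (T z) \<le> 1 / c * vnorm (V\<lparr>vcarrier := M\<rparr>) z"
        using S_low[of "T z"] ST[of z] c by (simp add: field_simps)
    qed
    then have "continuous_map (norm_topology (V\<lparr>vcarrier := M\<rparr>)) (norm_topology ?l1) T"
      using M.linear_continuous_iff[OF L.normed_space_axioms T_lin] by blast
    moreover have "continuous_map (norm_topology ?l1) (norm_topology (V\<lparr>vcarrier := M\<rparr>)) S"
      using L.linear_continuous_iff[OF M.normed_space_axioms S_lin'] synth_bound[of x K, OF x, folded S_def] by auto
    ultimately have "homeomorphic_maps (norm_topology (V\<lparr>vcarrier := M\<rparr>)) (norm_topology ?l1) T S"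
      unfolding homeomorphic_maps_def using TS ST by simp
    then show ?thesis unfolding isomorphic_nspace_def using T_lin homeomorphic_map_maps by blast
  qed
  ultimately show ?thesis unfolding contains_copy_of_l1_def by blast
qed

section \<open>Rosenthal's theorem\<close>

lemma uf_infinite: "eventually P uf \<Longrightarrow> infinite {n. P n}"
proof
  assume P: "eventually P uf" and "finite {n. P n}"
  then have "eventually (\<lambda>n. \<not> P n) sequentially"
    by (simp add: eventually_cofinite flip: cofinite_eq_sequentially)
  then have "eventually (\<lambda>n. \<not> P n) uf" by (rule uf_eventually)
  with P have "eventually (\<lambda>n. False) uf" by eventually_elim simp
  then show False by (simp add: trivial_limit_def[symmetric])
qed

text \<open>One value is the limit \<open>u\<close> along the ultrafilter, the other the limit along it of a subsequence that stays
away from \<open>u\<close>.\<close>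

lemma two_cluster_values:
  fixes s :: "nat \<Rightarrow> 'k::real_or_complex"
  assumes b: "\<And>n. norm (s n) \<le> K" and nc: "\<not> Cauchy s"
  obtains u v where "u \<noteq> v"
    "\<And>S. open S \<Longrightarrow> u \<in> S \<Longrightarrow> infinite {n. s n \<in> S}" "\<And>S. open S \<Longrightarrow> v \<in> S \<Longrightarrow> infinite {n. s n \<in> S}"
proof -
  define u where "u = ulim s"
  have u: "(s \<longlongrightarrow> u) uf" unfolding u_def by (rule ulim_scalar[OF b])
  have "\<not> s \<longlonglongrightarrow> u" using nc LIMSEQ_imp_Cauchy by blast
  then obtain e where e: "0 < e" "\<not> (\<exists>N. \<forall>n\<ge>N. norm (s n - u) < e)" using LIMSEQ_I by blast
  have inf: "infinite {n. e \<le> norm (s n - u)}"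
    unfolding infinite_nat_iff_unbounded_le using e(2) by (auto simp: not_less)
  define r where "r = enumerate {n. e \<le> norm (s n - u)}"
  have r: "strict_mono r" "\<And>n. e \<le> norm (s (r n) - u)"
    using strict_mono_enumerate[OF inf] enumerate_in_set[OF inf] unfolding r_def by auto
  define v where "v = ulim (s \<circ> r)"
  have v: "((s \<circ> r) \<longlongrightarrow> v) uf" unfolding v_def by (rule ulim_scalar[of _ K]) (simp add: b)
  have "((\<lambda>n. norm ((s \<circ> r) n - u)) \<longlongrightarrow> norm (v - u)) uf" by (intro tendsto_intros v)
  then have "e \<le> norm (v - u)" by (rule tendsto_lowerbound) (use r(2) in auto)
  then have "u \<noteq> v" using e(1) by auto
  moreover have "infinite {n. s n \<in> S}" if "open S" "u \<in> S" for S
    using uf_infinite[OF topological_tendstoD[OF u that]] .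
  moreover have "infinite {n. s n \<in> S}" if "open S" "v \<in> S" for S
  proof
    assume fin: "finite {n. s n \<in> S}"
    have "finite (r -` {n. s n \<in> S})"
      using fin strict_mono_imp_inj_on[OF r(1)] by (rule finite_vimageI)
    moreover have "infinite {n. (s \<circ> r) n \<in> S}" by (rule uf_infinite[OF topological_tendstoD[OF v that]])
    ultimately show False by (simp add: vimage_def)
  qed
  ultimately show thesis using that by blast
qed

definition rational_scalars :: "'k::real_or_complex set" where
  "rational_scalars = (\<lambda>(a, b). of_real a + of_real b * iu) ` (\<rat> \<times> \<rat>)"

lemma countable_rational_scalars: "countable rational_scalars"
  unfolding rational_scalars_def by (intro countable_image countable_SIGMA) (simp_all add: countable_rat)

lemma rational_scalars_dense:
  assumes "0 < e" obtains p :: "'k::real_or_complex" where "p \<in> rational_scalars" "norm (x - p) < e"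
proof -
  obtain a b where ab: "a \<in> \<rat>" "b \<in> \<rat>" "norm (x - (of_real a + of_real b * iu)) < e"
    by (rule scalar_dense[OF assms])
  have "of_real a + of_real b * iu \<in> (rational_scalars :: 'k set)"
    unfolding rational_scalars_def by (rule image_eqI[of _ _ "(a, b)"]) (use ab in auto)
  then show thesis using that ab(3) by blast
qed

text \<open>Countably many pairs of disks with centres \<open>p\<close>, \<open>q\<close> and common radius \<open>\<rho>\<close> that separate any two scalars.
The factor 8 keeps the error made by replacing values in the disks by the centres small compared with
\<open>|p - q|\<close>, even after half of it has been lost to the choice of signs.\<close>

definition separated_disks :: "('k::real_or_complex \<times> 'k \<times> real) set" where
  "separated_disks = {(p, q, \<rho>). p \<in> rational_scalars \<and> q \<in> rational_scalars \<and> \<rho> \<in> \<rat> \<and> 0 < \<rho> \<and> 8 * \<rho> \<le> norm (p - q)}"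

lemma countable_separated_disks: "countable separated_disks"
  by (rule countable_subset[of _ "rational_scalars \<times> rational_scalars \<times> \<rat>"])
     (auto simp: separated_disks_def intro!: countable_SIGMA countable_rational_scalars countable_rat)

lemma separated_disks_exist:
  fixes u v :: "'k::real_or_complex"
  assumes "u \<noteq> v"
  obtains p q \<rho> where "(p, q, \<rho>) \<in> separated_disks" "u \<in> ball p \<rho>" "v \<in> ball q \<rho>"
proof -
  have "0 < norm (u - v) / 10" using assms by simp
  then obtain \<rho> where \<rho>: "\<rho> \<in> \<rat>" "0 < \<rho>" "\<rho> < norm (u - v) / 10" using Rats_dense_in_real by blast
  obtain p where p: "p \<in> rational_scalars" "norm (u - p) < \<rho>" using rational_scalars_dense[OF \<rho>(2)] by blast
  obtain q where q: "q \<in> rational_scalars" "norm (v - q) < \<rho>" using rational_scalars_dense[OF \<rho>(2)] by blast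
  have "u - v = (u - p) + (p - q) - (v - q)" by simp
  then have "norm (u - v) \<le> norm (u - p) + norm (p - q) + norm (v - q)"
    using norm_triangle_ineq4[of "(u - p) + (p - q)" "v - q"] norm_triangle_ineq[of "u - p" "p - q"] by simp
  then have "8 * \<rho> \<le> norm (p - q)" using \<rho> p q by simp
  then show thesis using that[of p q \<rho>] \<rho> p q
    by (auto simp: separated_disks_def dist_norm norm_minus_commute)
qed

text \<open>For complex scalars this is due to Dor. Choose signs \<open>\<sigma>\<^sub>i\<close> with \<open>|\<Sum> \<sigma>\<^sub>i a\<^sub>i|\<close> at least half of \<open>\<Sum> |a\<^sub>i|\<close>, and
functionals \<open>f\<close>, \<open>g\<close> whose values at \<open>y\<^sub>i\<close> lie in opposite disks according to \<open>\<sigma>\<^sub>i\<close>. Then \<open>f - g\<close> has norm at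
most \<open>2\<close> and takes at \<open>y\<^sub>i\<close> the value \<open>\<sigma>\<^sub>i (p - q)\<close> up to an error \<open>2 \<rho>\<close>.\<close>

lemma (in normed_space) independent_lower_bound:
  assumes y: "\<And>n. y n \<in> vcarrier V" and \<rho>: "8 * \<rho> \<le> norm (p - q)"
    and ind: "\<And>\<epsilon> n. \<exists>f\<in>vcarrier (dual_space V). vnorm (dual_space V) f \<le> 1 \<and>
      (\<forall>i<n. f (y i) \<in> ball (if \<epsilon> i then p else q) \<rho>)"
  shows "norm (p - q) / 8 * (\<Sum>i<n. norm (a i)) \<le> vnorm V (vsum V a y n)"
proof -
  define z where "z = vsum V a y n"
  have z: "z \<in> vcarrier V" unfolding z_def by (rule vsum_closed[OF y])
  obtain \<epsilon> where \<epsilon>: "(\<Sum>i<n. norm (a i)) / 2 \<le> norm (\<Sum>i<n. (if \<epsilon> i then 1 else -1) * a i)"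
    by (rule signs_half)
  define \<sigma> :: "nat \<Rightarrow> 'k" where "\<sigma> i = (if \<epsilon> i then 1 else -1)" for i
  obtain f where f: "f \<in> vcarrier (dual_space V)" "vnorm (dual_space V) f \<le> 1"
    "\<And>i. i < n \<Longrightarrow> f (y i) \<in> ball (if \<epsilon> i then p else q) \<rho>" using ind[of n \<epsilon>] by blast
  obtain g where g: "g \<in> vcarrier (dual_space V)" "vnorm (dual_space V) g \<le> 1"
    "\<And>i. i < n \<Longrightarrow> g (y i) \<in> ball (if \<not> \<epsilon> i then p else q) \<rho>" using ind[of n "\<lambda>i. \<not> \<epsilon> i"] by blast
  have err: "norm (f (y i) - g (y i) - \<sigma> i * (p - q)) \<le> 2 * \<rho>" if "i < n" for i
  proof -
    define s where "s = (if \<epsilon> i then p else q)"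
    define t where "t = (if \<epsilon> i then q else p)"
    have "norm (f (y i) - s) < \<rho>" "norm (g (y i) - t) < \<rho>"
      using f(3)[OF that] g(3)[OF that] by (auto simp: s_def t_def dist_norm norm_minus_commute)
    then have "norm ((f (y i) - s) - (g (y i) - t)) \<le> 2 * \<rho>"
      using norm_triangle_ineq4[of "f (y i) - s" "g (y i) - t"] by linarith
    moreover have "f (y i) - g (y i) - \<sigma> i * (p - q) = (f (y i) - s) - (g (y i) - t)"
      by (simp add: s_def t_def \<sigma>_def)
    ultimately show ?thesis by (simp only:)
  qed
  have "f z - g z = (p - q) * (\<Sum>i<n. \<sigma> i * a i) + (\<Sum>i<n. a i * (f (y i) - g (y i) - \<sigma> i * (p - q)))"
  proof -
    have "f z - g z = (\<Sum>i<n. a i * (f (y i) - g (y i)))"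
      unfolding z_def using f(1) g(1) y by (simp add: dual_vsum right_diff_distrib sum_subtractf)
    also have "\<dots> = (\<Sum>i<n. (p - q) * (\<sigma> i * a i) + a i * (f (y i) - g (y i) - \<sigma> i * (p - q)))"
      by (intro sum.cong) (simp_all add: algebra_simps)
    finally show ?thesis by (simp add: sum.distrib sum_distrib_left)
  qed
  then have "norm (p - q) * norm (\<Sum>i<n. \<sigma> i * a i)
      \<le> norm (f z - g z) + norm (\<Sum>i<n. a i * (f (y i) - g (y i) - \<sigma> i * (p - q)))"
    using norm_triangle_ineq4[of "f z - g z" "\<Sum>i<n. a i * (f (y i) - g (y i) - \<sigma> i * (p - q))"]
    by (simp add: norm_mult)
  also have "norm (f z - g z) \<le> 2 * vnorm V z"
    using norm_triangle_ineq4[of "f z" "g z"] dual_ball_bound[OF f(1,2) z] dual_ball_bound[OF g(1,2) z] by simp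
  also have "norm (\<Sum>i<n. a i * (f (y i) - g (y i) - \<sigma> i * (p - q))) \<le> (\<Sum>i<n. norm (a i) * (2 * \<rho>))"
    by (intro order.trans[OF norm_sum] sum_mono) (simp add: norm_mult mult_left_mono err)
  also have "\<dots> = 2 * \<rho> * (\<Sum>i<n. norm (a i))" by (simp add: sum_distrib_left mult.commute)
  also have "\<dots> \<le> norm (p - q) / 4 * (\<Sum>i<n. norm (a i))"
    using \<rho> by (intro mult_right_mono sum_nonneg) auto
  finally have "norm (p - q) * norm (\<Sum>i<n. \<sigma> i * a i) \<le> 2 * vnorm V z + norm (p - q) / 4 * (\<Sum>i<n. norm (a i))"
    by simp
  moreover have "norm (p - q) * ((\<Sum>i<n. norm (a i)) / 2) \<le> norm (p - q) * norm (\<Sum>i<n. \<sigma> i * a i)"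
    using \<epsilon> unfolding \<sigma>_def by (intro mult_left_mono) auto
  ultimately show ?thesis unfolding z_def by (simp add: field_simps)
qed

text \<open>For a pair of disks, consider the functionals in the dual ball whose value at \<open>x n\<close> is in the first or in
the second disk. An independent subsequence would span a copy of \<open>\<ell>\<^sub>1\<close>, so every subsequence has
a subsequence along which no functional is infinitely often in both disks. A diagonal subsequence has
this property for all pairs of disks, and then the values of a functional cannot have two cluster points.\<close>

theorem (in banach_space) Rosenthal:
  assumes x: "\<And>n. x n \<in> vcarrier V" "\<And>n. vnorm V (x n) \<le> K" and no: "\<not> contains_copy_of_l1 V"
  obtains r :: "nat \<Rightarrow> nat" where "strict_mono r" "weakly_Cauchy V (x \<circ> r)"
proof -
  define t :: "nat \<Rightarrow> 'a \<times> 'a \<times> real" where "t = from_nat_into separated_disks"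
  define p where "p k = fst (t k)" for k
  define q where "q k = fst (snd (t k))" for k
  define \<rho> where "\<rho> k = snd (snd (t k))" for k
  obtain p0 q0 :: 'a and \<rho>0 where "(p0, q0, \<rho>0) \<in> separated_disks"
    by (rule separated_disks_exist[of "0::'a" 1]) auto
  then have ne: "(separated_disks :: ('a \<times> 'a \<times> real) set) \<noteq> {}" by blast
  then have "t k \<in> separated_disks" for k unfolding t_def by (rule from_nat_into)
  then have tk: "8 * \<rho> k \<le> norm (p k - q k)" "0 < \<rho> k" for k
    unfolding separated_disks_def p_def q_def \<rho>_def by (auto simp: case_prod_unfold)
  define A where "A k n = {f \<in> vcarrier (dual_space V). vnorm (dual_space V) f \<le> 1 \<and> f (x n) \<in> ball (p k) (\<rho> k)}" for k n
  define B where "B k n = {f \<in> vcarrier (dual_space V). vnorm (dual_space V) f \<le> 1 \<and> f (x n) \<in> ball (q k) (\<rho> k)}" for k n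
  define P where "P k s \<longleftrightarrow> (\<forall>f. finite {n. f \<in> A k (s n)} \<or> finite {n. f \<in> B k (s n)})" for k and s :: "nat \<Rightarrow> nat"
  interpret subseqs P
  proof
    fix k and s :: "nat \<Rightarrow> nat" assume s: "strict_mono s"
    show "\<exists>r. strict_mono r \<and> P k (s \<circ> r)"
    proof (rule convergent_or_independent_pairs[of "A k \<circ> s" "B k \<circ> s"])
      fix r :: "nat \<Rightarrow> nat"
      assume "strict_mono r" "\<And>f. finite {n. f \<in> (A k \<circ> s) (r n)} \<or> finite {n. f \<in> (B k \<circ> s) (r n)}"
      then show ?thesis unfolding P_def by (auto simp: o_def)
    next
      fix r :: "nat \<Rightarrow> nat"
      assume ind: "\<And>\<epsilon> n. \<exists>f. \<forall>i<n. f \<in> (if \<epsilon> i then (A k \<circ> s) (r i) else (B k \<circ> s) (r i))"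
      have "contains_copy_of_l1 V"
      proof (rule l1_basis_imp_copy)
        show "x (s (r n)) \<in> vcarrier V" "vnorm V (x (s (r n))) \<le> K" for n by (rule x)+
        show "0 < norm (p k - q k) / 8" using tk[of k] by linarith
        show "norm (p k - q k) / 8 * (\<Sum>i<n. norm (a i)) \<le> vnorm V (vsum V a (\<lambda>n. x (s (r n))) n)" for a n
        proof (rule independent_lower_bound[OF x(1) tk(1)])
          fix \<epsilon> :: "nat \<Rightarrow> bool" and n
          \<comment> \<open>\<open>Suc n\<close> ensures that \<open>f\<close> is in the dual ball even for \<open>n = 0\<close>\<close>
          obtain f where f: "\<And>i. i < Suc n \<Longrightarrow> f \<in> (if \<epsilon> i then (A k \<circ> s) (r i) else (B k \<circ> s) (r i))"
            using ind[of "Suc n" \<epsilon>] by blast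
          have "f \<in> vcarrier (dual_space V)" "vnorm (dual_space V) f \<le> 1"
            using f[of 0] by (auto simp: A_def B_def split: if_splits)
          moreover have "f (x (s (r i))) \<in> ball (if \<epsilon> i then p k else q k) (\<rho> k)" if "i < n" for i
            using f[of i] that by (auto simp: A_def B_def split: if_splits)
          ultimately show "\<exists>f\<in>vcarrier (dual_space V). vnorm (dual_space V) f \<le> 1 \<and>
            (\<forall>i<n. f (x (s (r i))) \<in> ball (if \<epsilon> i then p k else q k) (\<rho> k))" by blast
        qed
      qed
      then show ?thesis using no by blast
    qed
  qed
  have stable: "P k (s \<circ> r)" if "strict_mono r" "P k s" for r s k
    unfolding P_def
  proof
    fix f
    have *: "finite {n. Q ((s \<circ> r) n)}" if "finite {n. Q (s n)}" for Q
    proof -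
      have "finite (r -` {n. Q (s n)})" using that strict_mono_imp_inj_on[OF \<open>strict_mono r\<close>] by (rule finite_vimageI)
      then show ?thesis by (simp add: vimage_def)
    qed
    show "finite {n. f \<in> A k ((s \<circ> r) n)} \<or> finite {n. f \<in> B k ((s \<circ> r) n)}"
      using \<open>P k s\<close> *[of "\<lambda>n. f \<in> A k n"] *[of "\<lambda>n. f \<in> B k n"] unfolding P_def by blast
  qed
  have shift: "finite {n. Q n}" if fin: "finite {n. Q (Suc k + n)}" for Q and k :: nat
  proof (rule finite_subset)
    show "{n. Q n} \<subseteq> {..k} \<union> (+) (Suc k) ` {n. Q (Suc k + n)}"
    proof
      fix n assume "n \<in> {n. Q n}"
      then show "n \<in> {..k} \<union> (+) (Suc k) ` {n. Q (Suc k + n)}"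
        by (cases "n \<le> k") (auto intro!: image_eqI[of _ _ "n - Suc k"])
    qed
    show "finite ({..k} \<union> (+) (Suc k) ` {n. Q (Suc k + n)})" using fin by simp
  qed
  have diag: "finite {n. f \<in> A k (diagseq n)} \<or> finite {n. f \<in> B k (diagseq n)}" for f k
    using diagseq_holds[OF stable, of k] shift[of "\<lambda>n. f \<in> A k (diagseq n)" k] shift[of "\<lambda>n. f \<in> B k (diagseq n)" k]
    unfolding P_def by (auto simp: o_def)
  have ball_Cauchy: "Cauchy (\<lambda>n. f (x (diagseq n)))"
    if f: "f \<in> vcarrier (dual_space V)" "vnorm (dual_space V) f \<le> 1" for f
  proof (rule ccontr)
    assume nc: "\<not> Cauchy (\<lambda>n. f (x (diagseq n)))"
    have "norm (f (x n)) \<le> K" for n using dual_ball_bound[OF f x(1)[of n]] x(2)[of n] by simp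
    then obtain u v where uv: "u \<noteq> v" "\<And>S. open S \<Longrightarrow> u \<in> S \<Longrightarrow> infinite {n. f (x (diagseq n)) \<in> S}"
      "\<And>S. open S \<Longrightarrow> v \<in> S \<Longrightarrow> infinite {n. f (x (diagseq n)) \<in> S}"
      using two_cluster_values[OF _ nc] by metis
    obtain p' q' \<rho>' where T: "(p', q', \<rho>') \<in> separated_disks" "u \<in> ball p' \<rho>'" "v \<in> ball q' \<rho>'"
      using separated_disks_exist[OF uv(1)] by blast
    obtain k where "t k = (p', q', \<rho>')"
      using from_nat_into_surj[OF countable_separated_disks T(1)] unfolding t_def by blast
    then have k: "p k = p'" "q k = q'" "\<rho> k = \<rho>'" by (simp_all add: p_def q_def \<rho>_def)
    have "infinite {n. f \<in> A k (diagseq n)}" "infinite {n. f \<in> B k (diagseq n)}"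
      using uv(2)[OF open_ball T(2)] uv(3)[OF open_ball T(3)] f by (simp_all add: A_def B_def k)
    then show False using diag by blast
  qed
  interpret D: normed_space "dual_space V" by (rule normed_space_dual)
  have "Cauchy (\<lambda>n. f (x (diagseq n)))" if f: "f \<in> vcarrier (dual_space V)" for f
  proof -
    define M where "M = vnorm (dual_space V) f + 1"
    have M: "0 < M" "vnorm (dual_space V) f \<le> M" using dual_norm_nonneg[OF f] by (auto simp: M_def)
    define g where "g = vscale (dual_space V) (of_real (inverse M)) f"
    have g: "g \<in> vcarrier (dual_space V)" using f by (simp add: g_def D.closed)
    have "vnorm (dual_space V) g = inverse M * vnorm (dual_space V) f"
      using M(1) D.norm_scale[OF f, of "of_real (inverse M)"] by (simp add: g_def del: of_real_inverse)
    also have "\<dots> \<le> 1" using M by (simp add: field_simps)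
    finally have "vnorm (dual_space V) g \<le> 1" .
    then have "Cauchy (\<lambda>n. g (x (diagseq n)))" by (rule ball_Cauchy[OF g])
    then have "Cauchy (\<lambda>n. of_real M * g (x (diagseq n)))"
      by (rule bounded_linear.Cauchy[OF bounded_linear_mult_right])
    moreover have "of_real M * g (x (diagseq n)) = f (x (diagseq n))" for n
      using M(1) x(1) by (simp add: g_def dual_ops)
    ultimately show ?thesis by simp
  qed
  then have "weakly_Cauchy V (x \<circ> diagseq)" unfolding weakly_Cauchy_def using x(1) by auto
  then show thesis using that subseq_diagseq by blast
qed

section \<open>Random signs\<close>

definition sign_of :: "nat set \<Rightarrow> nat \<Rightarrow> real" where
  "sign_of S n = (if n \<in> S then 1 else -1)"

text \<open>The mean over all sign patterns of length \<open>N\<close>: a set \<open>S\<close> stands for the pattern that is \<open>1\<close> on \<open>S\<close> and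
\<open>-1\<close> off \<open>S\<close>.\<close>

definition avg :: "nat \<Rightarrow> (nat set \<Rightarrow> 'v::real_vector) \<Rightarrow> 'v" where
  "avg N h = (1 / 2 ^ N) *\<^sub>R (\<Sum>S\<in>Pow {..<N}. h S)"

lemma avg_add: "avg N (\<lambda>S. h S + k S) = avg N h + avg N k"
  by (simp add: avg_def sum.distrib scaleR_add_right)

lemma avg_sum: "avg N (\<lambda>S. \<Sum>i\<in>I. h i S) = (\<Sum>i\<in>I. avg N (h i))"
  unfolding avg_def by (subst sum.swap) (simp add: scaleR_sum_right)

lemma avg_mult: "avg N (\<lambda>S. c * h S) = c * avg N (h :: nat set \<Rightarrow> 'v::real_algebra)"
  by (simp add: avg_def sum_distrib_left)

lemma avg_const: "avg N (\<lambda>S. c) = c"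
  by (simp add: avg_def card_Pow sum_constant_scaleR)

lemma avg_mono: "(\<And>S. h S \<le> k S) \<Longrightarrow> avg N h \<le> avg N (k :: nat set \<Rightarrow> real)"
  unfolding avg_def by (intro scaleR_left_mono sum_mono) auto

lemma norm_avg_le:
  assumes "\<And>S. norm (h S) \<le> B" shows "norm (avg N h) \<le> B"
proof -
  have "norm (avg N h) \<le> avg N (\<lambda>S. norm (h S))"
    unfolding avg_def by (auto intro!: divide_right_mono norm_sum)
  also have "\<dots> \<le> avg N (\<lambda>S. B)" by (rule avg_mono[OF assms])
  finally show ?thesis by (simp add: avg_const)
qed

lemma avg_sign_self: "avg N (\<lambda>S. sign_of S n * sign_of S n) = 1"
  using avg_const[of N "1::real"] by (simp add: sign_of_def if_distrib cong: if_cong)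

text \<open>Changing the \<open>n\<close>-th sign is an involution that reverses the product of the two signs.\<close>

lemma avg_sign_orthogonal:
  assumes "n < N" "n \<noteq> m"
  shows "avg N (\<lambda>S. sign_of S n * sign_of S m) = 0"
proof -
  define flip where "flip S = (if n \<in> S then S - {n} else insert n S)" for S :: "nat set"
  have inv: "flip (flip S) = S" for S by (auto simp: flip_def)
  have "(\<Sum>S\<in>Pow {..<N}. sign_of S n * sign_of S m) = (\<Sum>S\<in>Pow {..<N}. sign_of (flip S) n * sign_of (flip S) m)"
    by (rule sum.reindex_bij_witness[of _ flip flip]) (use assms in \<open>auto simp: inv, auto simp: flip_def split: if_splits\<close>)
  also have "\<dots> = (\<Sum>S\<in>Pow {..<N}. - (sign_of S n * sign_of S m))"
    using assms(2) by (intro sum.cong) (auto simp: sign_of_def flip_def)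
  finally show ?thesis by (simp add: avg_def sum_negf)
qed

lemma Bessel_signs:
  fixes h :: "nat set \<Rightarrow> real"
  assumes "L \<le> N"
  shows "(\<Sum>n<L. (avg N (\<lambda>S. sign_of S n * h S))\<^sup>2) \<le> avg N (\<lambda>S. (h S)\<^sup>2)"
proof -
  define c where "c n = avg N (\<lambda>S. sign_of S n * h S)" for n
  define g where "g S = (\<Sum>n<L. c n * sign_of S n)" for S
  have hg: "avg N (\<lambda>S. h S * g S) = (\<Sum>n<L. (c n)\<^sup>2)"
  proof -
    have "avg N (\<lambda>S. h S * g S) = avg N (\<lambda>S. \<Sum>n<L. c n * (sign_of S n * h S))"
      by (simp add: g_def sum_distrib_left algebra_simps)
    also have "\<dots> = (\<Sum>n<L. (c n)\<^sup>2)" unfolding avg_sum avg_mult by (simp add: c_def power2_eq_square)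
    finally show ?thesis .
  qed
  have gg: "avg N (\<lambda>S. g S * g S) = (\<Sum>n<L. (c n)\<^sup>2)"
  proof -
    have "avg N (\<lambda>S. g S * g S) = avg N (\<lambda>S. \<Sum>n<L. \<Sum>m<L. (c n * c m) * (sign_of S n * sign_of S m))"
      by (simp add: g_def sum_product algebra_simps)
    also have "\<dots> = (\<Sum>n<L. \<Sum>m<L. c n * c m * avg N (\<lambda>S. sign_of S n * sign_of S m))"
      unfolding avg_sum avg_mult ..
    also have "\<dots> = (\<Sum>n<L. \<Sum>m<L. if m = n then (c n)\<^sup>2 else 0)"
    proof (intro sum.cong refl)
      fix n m assume "n \<in> {..<L}"
      then show "c n * c m * avg N (\<lambda>S. sign_of S n * sign_of S m) = (if m = n then (c n)\<^sup>2 else 0)"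
        using assms avg_sign_orthogonal[of n N m] avg_sign_self[of N n] by (auto simp: power2_eq_square)
    qed
    also have "\<dots> = (\<Sum>n<L. (c n)\<^sup>2)" by simp
    finally show ?thesis .
  qed
  have "0 \<le> avg N (\<lambda>S. (h S - g S)\<^sup>2)" using avg_mono[of "\<lambda>S. 0" "\<lambda>S. (h S - g S)\<^sup>2" N] by (simp add: avg_const)
  also have "(\<lambda>S. (h S - g S)\<^sup>2) = (\<lambda>S. (h S)\<^sup>2 + ((-2) * (h S * g S) + g S * g S))"
    by (auto simp: power2_eq_square algebra_simps)
  also have "avg N \<dots> = avg N (\<lambda>S. (h S)\<^sup>2) - (\<Sum>n<L. (c n)\<^sup>2)"
    unfolding avg_add avg_mult hg gg by simp
  finally show ?thesis by (simp add: c_def)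
qed

lemma avg_kre: "kre (avg N h) = avg N (\<lambda>S. kre (h S))"
  and avg_kim: "kim (avg N h) = avg N (\<lambda>S. kim (h S))"
proof -
  have "kre (sum h A) = (\<Sum>S\<in>A. kre (h S))" if "finite A" for A
    using that by (induction A) (use kre_of_real[of 0, where 'a = 'a] in \<open>auto simp: kre_add\<close>)
  then show "kre (avg N h) = avg N (\<lambda>S. kre (h S))"
    by (simp only: avg_def scaleR_conv_of_real kre_mult_real) simp
  have "kim (sum h A) = (\<Sum>S\<in>A. kim (h S))" if "finite A" for A
    using that by (induction A) (use kim_of_real[of 0, where 'k = 'a] in \<open>auto simp: kim_add\<close>)
  then show "kim (avg N h) = avg N (\<lambda>S. kim (h S))"
    by (simp only: avg_def scaleR_conv_of_real kim_mult_real) simp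
qed

text \<open>Bessel's inequality for the real and for the imaginary part.\<close>

lemma Bessel_signs_scalar:
  fixes h :: "nat set \<Rightarrow> 'k::real_or_complex"
  assumes "L \<le> N"
  shows "(\<Sum>n<L. (norm (avg N (\<lambda>S. of_real (sign_of S n) * h S)))\<^sup>2) \<le> avg N (\<lambda>S. (norm (h S))\<^sup>2)"
proof -
  have "(\<Sum>n<L. (norm (avg N (\<lambda>S. of_real (sign_of S n) * h S)))\<^sup>2)
    = (\<Sum>n<L. (avg N (\<lambda>S. sign_of S n * kre (h S)))\<^sup>2) + (\<Sum>n<L. (avg N (\<lambda>S. sign_of S n * kim (h S)))\<^sup>2)"
    by (simp add: norm_parts avg_kre avg_kim kre_mult_real kim_mult_real sum.distrib)
  also have "\<dots> \<le> avg N (\<lambda>S. (kre (h S))\<^sup>2) + avg N (\<lambda>S. (kim (h S))\<^sup>2)"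
    by (intro add_mono Bessel_signs assms)
  also have "\<dots> = avg N (\<lambda>S. (norm (h S))\<^sup>2)" by (simp add: norm_parts avg_add)
  finally show ?thesis .
qed

section \<open>A completely continuous operator onto square summable sequences\<close>

text \<open>A mean defined for all bounded functions of the signs. The functionals to which it is applied are chosen
by the Hahn-Banach theorem without any regularity in the signs, so the product measure on the sign
sequences would not do.\<close>

definition mean :: "(nat set \<Rightarrow> real) \<Rightarrow> real" where
  "mean h = ulim (\<lambda>N. avg N h)"

lemma mean_tendsto:
  assumes "\<And>S. \<bar>h S\<bar> \<le> B" shows "((\<lambda>N. avg N h) \<longlongrightarrow> mean h) uf"
  unfolding mean_def by (rule ulim_scalar[of _ B]) (rule norm_avg_le, simp add: assms)

definition sign_measure :: "nat set set \<Rightarrow> real" where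
  "sign_measure A = mean (indicator A)"

lemma sign_measure_tendsto: "((\<lambda>N. avg N (indicator A)) \<longlongrightarrow> sign_measure A) uf"
  unfolding sign_measure_def by (rule mean_tendsto[of _ 1]) (simp add: indicator_def)

lemma sign_measure_nonneg: "0 \<le> sign_measure A"
proof (rule tendsto_lowerbound[OF sign_measure_tendsto])
  show "\<forall>\<^sub>F N in uf. 0 \<le> avg N (indicator A :: _ \<Rightarrow> real)"
    using avg_mono[of "\<lambda>S. 0" "indicator A"] by (simp add: avg_const)
qed simp

lemma sign_measure_add:
  assumes "A \<inter> B = {}" shows "sign_measure (A \<union> B) = sign_measure A + sign_measure B"
proof -
  have "(indicator (A \<union> B) :: nat set \<Rightarrow> real) = (\<lambda>S. indicator A S + indicator B S)"
    using assms by (auto simp: indicator_def fun_eq_iff)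
  then have "avg N (indicator (A \<union> B)) = avg N (indicator A) + (avg N (indicator B) :: real)" for N
    by (simp add: avg_add)
  then have "((\<lambda>N. avg N (indicator (A \<union> B))) \<longlongrightarrow> sign_measure A + sign_measure B) uf"
    using tendsto_add[OF sign_measure_tendsto[of A] sign_measure_tendsto[of B]] by simp
  then show ?thesis using sign_measure_tendsto[of "A \<union> B"] tendsto_unique[OF uf_nontrivial] by blast
qed

lemma sign_measure_UNIV: "sign_measure UNIV \<le> 1"
proof (rule tendsto_upperbound[OF sign_measure_tendsto])
  have "indicator UNIV = (\<lambda>S::nat set. 1 :: real)" by auto
  then show "\<forall>\<^sub>F N in uf. avg N (indicator UNIV) \<le> (1::real)" by (simp add: avg_const)
qed simp

context normed_space
begin

text \<open>The substitute for dominated convergence. If all means are at least \<open>d\<close>, the sets \<open>A j\<close> of those \<open>S\<close> with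
\<open>|g S (z j)|\<^sup>2 \<ge> d / 2\<close> have measure bounded below, so infinitely many of them have the finite intersection
property. Take \<open>g S\<close> with \<open>S\<close> in larger and larger finite intersections; the limit along the ultrafilter is
a functional that stays away from \<open>0\<close> on a subsequence of \<open>z\<close>.\<close>

lemma weakly_null_mean_small:
  fixes g :: "nat set \<Rightarrow> 'a \<Rightarrow> 'k"
  assumes g: "\<And>S. g S \<in> vcarrier (dual_space V)" "\<And>S. vnorm (dual_space V) (g S) \<le> C"
    and z: "\<And>j. z j \<in> vcarrier V" "\<And>j. vnorm V (z j) \<le> K"
    and null: "\<And>f. f \<in> vcarrier (dual_space V) \<Longrightarrow> (\<lambda>j. f (z j)) \<longlonglongrightarrow> 0"
    and d: "0 < d"
  shows "\<exists>j. mean (\<lambda>S. (norm (g S (z j)))\<^sup>2) < d"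
proof (rule ccontr)
  assume "\<not> ?thesis"
  then have big: "d \<le> mean (\<lambda>S. (norm (g S (z j)))\<^sup>2)" for j by (simp add: not_less)
  have C0: "0 \<le> C" using g dual_norm_nonneg order.trans by blast
  have K0: "0 \<le> K" using z norm_nonneg order.trans by blast
  \<comment> \<open>the summand \<open>1\<close> makes \<open>R\<close> positive\<close>
  define R where "R = (C * K)\<^sup>2 + 1"
  have R: "0 < R" by (simp add: R_def add_nonneg_pos)
  have gz: "(norm (g S (z j)))\<^sup>2 \<le> R" for S j
  proof -
    have "norm (g S (z j)) \<le> C * vnorm V (z j)" by (rule dual_ball_bound[OF g z(1)])
    also have "\<dots> \<le> C * K" by (rule mult_left_mono[OF z(2) C0])
    finally have "(norm (g S (z j)))\<^sup>2 \<le> (C * K)\<^sup>2" by (rule power_mono) simp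
    then show ?thesis by (simp add: R_def)
  qed
  define A where "A j = {S. d / 2 \<le> (norm (g S (z j)))\<^sup>2}" for j
  have "d / (2 * R) \<le> sign_measure (A j)" for j
  proof -
    have "mean (\<lambda>S. (norm (g S (z j)))\<^sup>2) \<le> R * sign_measure (A j) + d / 2"
    proof (rule tendsto_le[OF uf_nontrivial])
      show "((\<lambda>N. R * avg N (indicator (A j)) + d / 2) \<longlongrightarrow> R * sign_measure (A j) + d / 2) uf"
        by (intro tendsto_intros sign_measure_tendsto)
      show "((\<lambda>N. avg N (\<lambda>S. (norm (g S (z j)))\<^sup>2)) \<longlongrightarrow> mean (\<lambda>S. (norm (g S (z j)))\<^sup>2)) uf"
        by (rule mean_tendsto[of _ R]) (use gz in simp)
      have "avg N (\<lambda>S. (norm (g S (z j)))\<^sup>2) \<le> avg N (\<lambda>S. R * indicator (A j) S + d / 2)" for N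
        by (rule avg_mono) (use gz[of _ j] R d in \<open>auto simp: A_def indicator_def not_le add_increasing2\<close>)
      then show "\<forall>\<^sub>F N in uf. avg N (\<lambda>S. (norm (g S (z j)))\<^sup>2) \<le> R * avg N (indicator (A j)) + d / 2"
        by (simp add: avg_add avg_mult avg_const)
    qed
    then have "d / 2 \<le> R * sign_measure (A j)" using big[of j] by simp
    then show ?thesis using R by (simp add: field_simps)
  qed
  moreover have "0 < d / (2 * R)" using d R by simp
  ultimately obtain r :: "nat \<Rightarrow> nat" where r: "strict_mono r" "\<And>n. (\<Inter>i\<le>n. A (r i)) \<noteq> {}"
    using finitely_additive_fip[of sign_measure "d / (2 * R)" A] sign_measure_nonneg sign_measure_add sign_measure_UNIV
    by metis
  then have "\<forall>n. \<exists>S. S \<in> (\<Inter>i\<le>n. A (r i))" by blast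
  then obtain T where T: "\<And>n. T n \<in> (\<Inter>i\<le>n. A (r i))" by metis
  have TA: "T n \<in> A (r i)" if "i \<le> n" for i n using T[of n] that by blast
  define f where "f = (\<lambda>x\<in>vcarrier V. ulim (\<lambda>n. g (T n) x))"
  have f: "f \<in> vcarrier (dual_space V)" unfolding f_def by (rule ulim_functional(1)[of "\<lambda>n. g (T n)" C]) (rule g)+
  have low: "d / 2 \<le> (norm (f (z (r i))))\<^sup>2" for i
  proof (rule tendsto_lowerbound)
    show "((\<lambda>n. (norm (g (T n) (z (r i))))\<^sup>2) \<longlongrightarrow> (norm (f (z (r i))))\<^sup>2) uf"
      using ulim_functional(2)[of "\<lambda>n. g (T n)" C "z (r i)"] g z(1) by (intro tendsto_intros) (simp add: f_def)
    show "\<forall>\<^sub>F n in uf. d / 2 \<le> (norm (g (T n) (z (r i))))\<^sup>2"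
      by (rule uf_eventually, rule eventually_sequentiallyI[of i]) (use TA in \<open>simp add: A_def\<close>)
  qed simp
  have "(\<lambda>i. (norm (f (z (r i))))\<^sup>2) \<longlonglongrightarrow> (norm (0::'k))\<^sup>2"
    using LIMSEQ_subseq_LIMSEQ[OF null[OF f] r(1)] by (intro tendsto_intros) (simp add: o_def)
  then have "d / 2 \<le> (norm (0::'k))\<^sup>2"
    by (rule tendsto_lowerbound[OF _ always_eventually]) (use low in auto)
  then show False using d by simp
qed

lemma weakly_Cauchy_bounded:
  assumes "weakly_Cauchy V s" shows "\<exists>K. \<forall>n. vnorm V (s n) \<le> K"
proof -
  have s: "range s \<subseteq> vcarrier V" "\<And>f. f \<in> vcarrier (dual_space V) \<Longrightarrow> Cauchy (\<lambda>n. f (s n))"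
    using assms unfolding weakly_Cauchy_def by auto
  have "\<exists>K. \<forall>x\<in>range s. norm (f x) \<le> K" if "f \<in> vcarrier (dual_space V)" for f
    using cauchy_imp_bounded[OF s(2)[OF that]] unfolding bounded_iff by auto
  then show ?thesis using pointwise_bounded_imp_bounded[OF s(1)] by auto
qed

text \<open>The functional \<open>\<phi> n\<close> is the mean over the signs of the \<open>n\<close>-th sign times \<open>g S\<close>, where \<open>g S\<close> takes the
signs \<open>S\<close> on the basis \<open>x\<close> of the copy. Orthogonality of the signs gives the values on the basis, Bessel's
inequality the estimates. For the last one, if it failed there would be differences \<open>s (m N) - s (l N)\<close> of
a weakly Cauchy sequence, hence a bounded weakly null sequence, on which the means of \<open>|g S|\<^sup>2\<close> stay large.\<close>

theorem l1_copy_operator: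
  assumes "contains_copy_of_l1 V"
  obtains x :: "nat \<Rightarrow> 'a" and K :: real and \<phi> :: "nat \<Rightarrow> 'a \<Rightarrow> 'k" and C :: real
    where "\<And>n. x n \<in> vcarrier V" "\<And>n. vnorm V (x n) \<le> K"
    "\<And>n. \<phi> n \<in> vcarrier (dual_space V)" "\<And>n m. \<phi> n (x m) = (if n = m then 1 else 0)" "0 \<le> C"
    "\<And>z L. z \<in> vcarrier V \<Longrightarrow> (\<Sum>n<L. (norm (\<phi> n z))\<^sup>2) \<le> (C * vnorm V z)\<^sup>2"
    "\<And>s e. weakly_Cauchy V s \<Longrightarrow> 0 < e \<Longrightarrow>
      \<exists>N. \<forall>m\<ge>N. \<forall>l\<ge>N. \<forall>L. (\<Sum>n<L. (norm (\<phi> n (s m) - \<phi> n (s l)))\<^sup>2) \<le> e"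
proof -
  obtain x K C where x: "\<And>n. x n \<in> vcarrier V" "\<And>n. vnorm V (x n) \<le> K"
    and ip: "\<And>\<epsilon> :: nat \<Rightarrow> 'k. (\<And>n. norm (\<epsilon> n) \<le> 1) \<Longrightarrow>
      \<exists>g\<in>vcarrier (dual_space V). vnorm (dual_space V) g \<le> C \<and> (\<forall>n. g (x n) = \<epsilon> n)"
    using l1_copy_interpolation[OF assms] by blast
  have "\<forall>S. \<exists>g\<in>vcarrier (dual_space V). vnorm (dual_space V) g \<le> C \<and> (\<forall>n. g (x n) = of_real (sign_of S n))"
    by (intro allI ip) (simp add: sign_of_def)
  then obtain g where g: "\<And>S. g S \<in> vcarrier (dual_space V)" "\<And>S. vnorm (dual_space V) (g S) \<le> C"
    and gx: "\<And>S n. g S (x n) = of_real (sign_of S n)" by metis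
  have C0: "0 \<le> C" using g dual_norm_nonneg order.trans by blast
  have gb: "norm (g S z) \<le> C * vnorm V z" if "z \<in> vcarrier V" for S z by (rule dual_ball_bound[OF g that])
  define F where "F n N = (\<lambda>z\<in>vcarrier V. avg N (\<lambda>S. of_real (sign_of S n) * g S z))" for n N
  have Fb: "norm (avg N (\<lambda>S. of_real (sign_of S n) * g S z)) \<le> C * vnorm V z" if "z \<in> vcarrier V" for n N z
    by (rule norm_avg_le) (use gb[OF that] in \<open>simp add: norm_mult sign_of_def\<close>)
  have FD: "F n N \<in> vcarrier (dual_space V)" for n N
    unfolding F_def
  proof (rule dual_restrictI[OF _ Fb])
    have "avg N (\<lambda>S. of_real (sign_of S n) * g S (vscale V c y)) = c * avg N (\<lambda>S. of_real (sign_of S n) * g S y)"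
      if "y \<in> vcarrier V" for c y
      unfolding avg_mult[symmetric] by (simp add: dual_scale[OF g(1) that] mult.left_commute)
    then show "linear_between V scalar_space (\<lambda>z. avg N (\<lambda>S. of_real (sign_of S n) * g S z))"
      unfolding linear_scalar_iff by (auto simp: dual_add[OF g(1)] distrib_left avg_add)
  qed
  have FC: "vnorm (dual_space V) (F n N) \<le> C" for n N
    by (rule dual_norm_leI) (use Fb C0 in \<open>auto simp: F_def\<close>)
  define \<phi> where "\<phi> n = (\<lambda>z\<in>vcarrier V. ulim (\<lambda>N. F n N z))" for n
  have \<phi>: "\<phi> n \<in> vcarrier (dual_space V)" for n unfolding \<phi>_def by (rule ulim_functional(1)[OF FD FC])
  have lim: "((\<lambda>N. avg N (\<lambda>S. of_real (sign_of S n) * g S z)) \<longlongrightarrow> \<phi> n z) uf" if z: "z \<in> vcarrier V" for n z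
    using ulim_functional(2)[of "F n" C z, OF FD FC z] z by (simp add: \<phi>_def F_def)
  define \<mu> where "\<mu> z = mean (\<lambda>S. (norm (g S z))\<^sup>2)" for z
  have gb2: "(norm (g S z))\<^sup>2 \<le> (C * vnorm V z)\<^sup>2" if "z \<in> vcarrier V" for S z
    by (rule power_mono[OF gb[OF that]]) simp
  have \<mu>_lim: "((\<lambda>N. avg N (\<lambda>S. (norm (g S z))\<^sup>2)) \<longlongrightarrow> \<mu> z) uf" if "z \<in> vcarrier V" for z
    unfolding \<mu>_def by (rule mean_tendsto[of _ "(C * vnorm V z)\<^sup>2"]) (use gb2[OF that] in simp)
  have Bessel: "(\<Sum>n<L. (norm (\<phi> n z))\<^sup>2) \<le> \<mu> z" if z: "z \<in> vcarrier V" for z L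
  proof (rule tendsto_le[OF uf_nontrivial \<mu>_lim[OF z]])
    show "((\<lambda>N. \<Sum>n<L. (norm (avg N (\<lambda>S. of_real (sign_of S n) * g S z)))\<^sup>2) \<longlongrightarrow> (\<Sum>n<L. (norm (\<phi> n z))\<^sup>2)) uf"
      by (intro tendsto_intros lim z)
    show "\<forall>\<^sub>F N in uf. (\<Sum>n<L. (norm (avg N (\<lambda>S. of_real (sign_of S n) * g S z)))\<^sup>2) \<le> avg N (\<lambda>S. (norm (g S z))\<^sup>2)"
      by (rule uf_eventually, rule eventually_sequentiallyI[of L], rule Bessel_signs_scalar)
  qed
  have \<mu>_le: "\<mu> z \<le> (C * vnorm V z)\<^sup>2" if z: "z \<in> vcarrier V" for z
  proof (rule tendsto_upperbound[OF \<mu>_lim[OF z]])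
    have "avg N (\<lambda>S. (norm (g S z))\<^sup>2) \<le> avg N (\<lambda>S. (C * vnorm V z)\<^sup>2)" for N
      by (rule avg_mono) (rule gb2[OF z])
    then show "\<forall>\<^sub>F N in uf. avg N (\<lambda>S. (norm (g S z))\<^sup>2) \<le> (C * vnorm V z)\<^sup>2" by (simp add: avg_const)
  qed simp
  show thesis
  proof (rule that[of x K \<phi> C, OF x \<phi> _ C0])
    fix n m
    have "((\<lambda>N. avg N (\<lambda>S. of_real (sign_of S n) * g S (x m))) \<longlongrightarrow> (if n = m then 1 else 0)) uf"
    proof (rule tendsto_eventually, rule uf_eventually, rule eventually_sequentiallyI[of "Suc n"])
      fix N assume "Suc n \<le> N"
      have "avg N (\<lambda>S. of_real (sign_of S n) * g S (x m)) = of_real (avg N (\<lambda>S. sign_of S n * sign_of S m))"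
        by (simp add: avg_def gx scaleR_conv_of_real)
      also have "\<dots> = (if n = m then 1 else 0)"
        using avg_sign_orthogonal[of n N m] avg_sign_self[of N n] \<open>Suc n \<le> N\<close> by auto
      finally show "avg N (\<lambda>S. of_real (sign_of S n) * g S (x m)) = (if n = m then 1 else 0)" .
    qed
    then show "\<phi> n (x m) = (if n = m then 1 else 0)" using lim[OF x(1)] tendsto_unique[OF uf_nontrivial] by blast
  next
    show "(\<Sum>n<L. (norm (\<phi> n z))\<^sup>2) \<le> (C * vnorm V z)\<^sup>2" if "z \<in> vcarrier V" for z L
      using Bessel[OF that] \<mu>_le[OF that] order.trans by blast
  next
    fix s and e :: real assume s: "weakly_Cauchy V s" and e: "0 < e"
    have sc: "s n \<in> vcarrier V" for n using s unfolding weakly_Cauchy_def by auto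
    obtain M where M: "\<And>n. vnorm V (s n) \<le> M" using weakly_Cauchy_bounded[OF s] by blast
    have "\<exists>N. \<forall>m\<ge>N. \<forall>l\<ge>N. \<mu> (vsub V (s m) (s l)) < e"
    proof (rule ccontr)
      assume "\<not> ?thesis"
      then have "\<forall>N. \<exists>m l. N \<le> m \<and> N \<le> l \<and> \<not> \<mu> (vsub V (s m) (s l)) < e" by blast
      then obtain m l where ml: "\<And>N::nat. N \<le> m N" "\<And>N. N \<le> l N" "\<And>N. \<not> \<mu> (vsub V (s (m N)) (s (l N))) < e" by metis
      have "\<exists>j. \<mu> (vsub V (s (m j)) (s (l j))) < e"
        unfolding \<mu>_def
      proof (rule weakly_null_mean_small[OF g _ _ _ e])
        show "vsub V (s (m j)) (s (l j)) \<in> vcarrier V" for j by (simp add: closed sc)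
        show "vnorm V (vsub V (s (m j)) (s (l j))) \<le> M + M" for j
          using norm_triangle[of "s (m j)" "vscale V (-1) (s (l j))"] M[of "m j"] M[of "l j"] sc
          by (simp add: closed norm_scale)
        fix f assume f: "f \<in> vcarrier (dual_space V)"
        have "Cauchy (\<lambda>n. f (s n))" using s f unfolding weakly_Cauchy_def by blast
        show "(\<lambda>j. f (vsub V (s (m j)) (s (l j)))) \<longlonglongrightarrow> 0"
        proof (rule LIMSEQ_I)
          fix d :: real assume "0 < d"
          then obtain N where N: "\<And>i j. N \<le> i \<Longrightarrow> N \<le> j \<Longrightarrow> norm (f (s i) - f (s j)) < d"
            using \<open>Cauchy (\<lambda>n. f (s n))\<close> unfolding Cauchy_iff by blast
          show "\<exists>no. \<forall>n\<ge>no. norm (f (vsub V (s (m n)) (s (l n))) - 0) < d"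
          proof (intro exI[of _ N] allI impI)
            fix n assume "N \<le> n"
            then have "N \<le> m n" "N \<le> l n" using ml(1,2)[of n] by auto
            then show "norm (f (vsub V (s (m n)) (s (l n))) - 0) < d" using N f sc by (simp add: dual_vsub)
          qed
        qed
      qed
      then show False using ml(3) by blast
    qed
    then obtain N where N: "\<And>m l. N \<le> m \<Longrightarrow> N \<le> l \<Longrightarrow> \<mu> (vsub V (s m) (s l)) < e" by blast
    show "\<exists>N. \<forall>m\<ge>N. \<forall>l\<ge>N. \<forall>L. (\<Sum>n<L. (norm (\<phi> n (s m) - \<phi> n (s l)))\<^sup>2) \<le> e"
    proof (intro exI[of _ N] allI impI)
      fix m l L assume "N \<le> m" "N \<le> l"
      have "(\<Sum>n<L. (norm (\<phi> n (vsub V (s m) (s l))))\<^sup>2) \<le> \<mu> (vsub V (s m) (s l))"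
        by (rule Bessel) (simp add: closed sc)
      also have "\<dots> \<le> e" using N[OF \<open>N \<le> m\<close> \<open>N \<le> l\<close>] by simp
      finally show "(\<Sum>n<L. (norm (\<phi> n (s m) - \<phi> n (s l)))\<^sup>2) \<le> e" by (simp add: dual_vsub[OF \<phi> sc sc])
    qed
  qed
qed

end

section \<open>A nonreflexive space on a given type\<close>

definition transport :: "('a \<Rightarrow> 'b) \<Rightarrow> ('k::real_or_complex, 'a) nspace \<Rightarrow> ('k, 'b) nspace" where
  "transport \<iota> V =
     \<lparr>vcarrier = \<iota> ` vcarrier V,
      vadd = (\<lambda>x y. \<iota> (vadd V (inv \<iota> x) (inv \<iota> y))),
      vzero = \<iota> (vzero V),
      vscale = (\<lambda>c x. \<iota> (vscale V c (inv \<iota> x))),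
      vnorm = (\<lambda>x. vnorm V (inv \<iota> x))\<rparr>"

lemma transport_simps:
  assumes "inj \<iota>"
  shows "vcarrier (transport \<iota> V) = \<iota> ` vcarrier V"
    "vadd (transport \<iota> V) (\<iota> x) (\<iota> y) = \<iota> (vadd V x y)"
    "vzero (transport \<iota> V) = \<iota> (vzero V)"
    "vscale (transport \<iota> V) c (\<iota> x) = \<iota> (vscale V c x)"
    "vnorm (transport \<iota> V) (\<iota> x) = vnorm V x"
  using assms by (simp_all add: transport_def)

lemma banach_space_transport:
  fixes \<iota> :: "'a \<Rightarrow> 'b"
  assumes \<iota>: "inj \<iota>" and V: "banach_space V"
  shows "banach_space (transport \<iota> V)"
proof -
  interpret banach_space V by fact
  note t = transport_simps[OF \<iota>]
  interpret T: normed_space "transport \<iota> V"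
  proof
    fix x assume "x \<in> vcarrier (transport \<iota> V)"
    then obtain x' where x: "x = \<iota> x'" "x' \<in> vcarrier V" by (auto simp: t)
    show "\<exists>y\<in>vcarrier (transport \<iota> V). vadd (transport \<iota> V) x y = vzero (transport \<iota> V)"
    proof -
      obtain y where "y \<in> vcarrier V" "vadd V x' y = vzero V" using add_inverse[OF x(2)] by blast
      then show ?thesis by (intro bexI[of _ "\<iota> y"]) (simp_all add: t x(1))
    qed
  qed (use \<iota> in \<open>auto simp: t closed add_assoc add_zero scale_add_right scale_add_left scale_scale
      scale_one norm_eq_zero norm_scale norm_triangle inj_eq intro: add_commute arg_cong[where f = \<iota>]\<close>)
  show ?thesis
  proof (rule T.banach_spaceI)
    fix s :: "nat \<Rightarrow> 'b" assume s: "\<And>n. s n \<in> vcarrier (transport \<iota> V)"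
      and C: "\<And>e. 0 < e \<Longrightarrow> \<exists>N. \<forall>m\<ge>N. \<forall>n\<ge>N. vnorm (transport \<iota> V) (vsub (transport \<iota> V) (s m) (s n)) < e"
    have "\<forall>n. \<exists>x\<in>vcarrier V. s n = \<iota> x" using s by (auto simp: t)
    then obtain u where u: "\<And>n. u n \<in> vcarrier V" "\<And>n. s n = \<iota> (u n)" by metis
    obtain l where "l \<in> vcarrier V" "(\<lambda>n. vnorm V (vsub V (u n) l)) \<longlonglongrightarrow> 0"
      by (rule Cauchy_converges[of u, OF u(1)]) (use C in \<open>simp_all add: u(2) t\<close>)
    then show "\<exists>l\<in>vcarrier (transport \<iota> V).
        (\<lambda>n. vnorm (transport \<iota> V) (vsub (transport \<iota> V) (s n) l)) \<longlonglongrightarrow> 0"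
      by (intro bexI[of _ "\<iota> l"]) (simp_all add: u(2) t)
  qed
qed

text \<open>Were \<open>\<ell>\<^sub>1\<close> reflexive, the unit vectors would have a weak limit \<open>a\<close> along the ultrafilter. All coordinates of
\<open>a\<close> would be \<open>0\<close>, and their sum would be \<open>1\<close>.\<close>

lemma ex_nonreflexive:
  assumes "\<exists>\<iota> :: (nat \<Rightarrow> 'k::real_or_complex) \<Rightarrow> 'b. inj \<iota>"
  shows "\<exists>F :: ('k, 'b) nspace. banach_space F \<and> \<not> reflexive F"
proof -
  obtain \<iota> :: "(nat \<Rightarrow> 'k) \<Rightarrow> 'b" where \<iota>: "inj \<iota>" using assms by blast
  define F where "F = transport \<iota> (l1_space :: ('k, nat \<Rightarrow> 'k) nspace)"
  interpret F: banach_space F unfolding F_def by (rule banach_space_transport[OF \<iota> banach_space_l1])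
  note t = transport_simps[OF \<iota>, of l1_space, folded F_def]
  have "\<not> reflexive F"
  proof
    assume r: "reflexive F"
    have in_dual: "(\<lambda>x\<in>vcarrier F. h (inv \<iota> x)) \<in> vcarrier (dual_space F)"
      if h: "\<And>a b. a \<in> vcarrier l1_space \<Longrightarrow> b \<in> vcarrier l1_space \<Longrightarrow> h (vadd l1_space a b) = h a + h b"
        "\<And>c a. a \<in> vcarrier l1_space \<Longrightarrow> h (vscale l1_space c a) = c * h a"
        "\<And>a. a \<in> vcarrier l1_space \<Longrightarrow> norm (h a) \<le> vnorm l1_space a" for h :: "(nat \<Rightarrow> 'k) \<Rightarrow> 'k"
    proof (rule F.dual_restrictI[of _ 1])
      show "linear_between F scalar_space (\<lambda>x. h (inv \<iota> x))"
        unfolding F.linear_scalar_iff using \<iota> h(1,2) by (auto simp: t)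
      show "norm (h (inv \<iota> x)) \<le> 1 * vnorm F x" if "x \<in> vcarrier F" for x
        using that \<iota> h(3) by (auto simp: t)
    qed
    have yF: "\<iota> (unit_seq n) \<in> vcarrier F" "vnorm F (\<iota> (unit_seq n)) \<le> 1" for n
      by (simp_all add: t unit_seq_l1)
    obtain x where x: "x \<in> vcarrier F"
      "\<And>f. f \<in> vcarrier (dual_space F) \<Longrightarrow> ((\<lambda>n. f (\<iota> (unit_seq n))) \<longlongrightarrow> f x) uf"
      using F.reflexive_ulim[OF r, of "\<lambda>n. \<iota> (unit_seq n)" 1] yF by blast
    obtain a where a: "a \<in> vcarrier l1_space" "x = \<iota> a" using x(1) by (auto simp: t)
    have lim: "((\<lambda>n. h (unit_seq n)) \<longlongrightarrow> h a) uf"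
      if h: "\<And>a b. a \<in> vcarrier l1_space \<Longrightarrow> b \<in> vcarrier l1_space \<Longrightarrow> h (vadd l1_space a b) = h a + h b"
        "\<And>c a. a \<in> vcarrier l1_space \<Longrightarrow> h (vscale l1_space c a) = c * h a"
        "\<And>a. a \<in> vcarrier l1_space \<Longrightarrow> norm (h a) \<le> vnorm l1_space a" for h :: "(nat \<Rightarrow> 'k) \<Rightarrow> 'k"
      using x(2)[OF in_dual[OF h]] yF(1) x(1) \<iota> by (simp add: a(2))
    have "a i = 0" for i
    proof -
      have "((\<lambda>n. unit_seq n i) \<longlongrightarrow> a i) uf"
        by (rule lim[of "\<lambda>a. a i"]) (simp_all add: l1_simps(2,4) l1_coord_le)
      moreover have "((\<lambda>n. unit_seq n i) \<longlongrightarrow> (0::'k)) uf"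
        by (rule tendsto_eventually, rule uf_eventually, rule eventually_sequentiallyI[of "Suc i"])
          (simp add: unit_seq_def)
      ultimately show ?thesis using tendsto_unique[OF uf_nontrivial] by blast
    qed
    then have a0: "a = (\<lambda>i. 0)" by auto
    have sm: "summable a" if "a \<in> vcarrier l1_space" for a :: "nat \<Rightarrow> 'k"
      using that by (simp add: l1_simps(1) summable_norm_scalar)
    have "((\<lambda>n. \<Sum>i. unit_seq n i) \<longlongrightarrow> (\<Sum>i. a i)) uf"
    proof (rule lim[of suminf])
      show "suminf (vadd l1_space a b) = suminf a + suminf b"
        if "a \<in> vcarrier l1_space" "b \<in> vcarrier l1_space" for a b :: "nat \<Rightarrow> 'k"
        using suminf_add[OF sm[OF that(1)] sm[OF that(2)]] by (simp add: l1_simps(2))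
      show "suminf (vscale l1_space c a) = c * suminf a" if "a \<in> vcarrier l1_space" for c and a :: "nat \<Rightarrow> 'k"
        using suminf_mult[OF sm[OF that], of c] by (simp add: l1_simps(4))
      show "norm (suminf a) \<le> vnorm l1_space a" if "a \<in> vcarrier l1_space" for a :: "nat \<Rightarrow> 'k"
      proof (rule tendsto_upperbound)
        show "(\<lambda>n. norm (\<Sum>i<n. a i)) \<longlonglongrightarrow> norm (suminf a)"
          using summable_LIMSEQ[OF sm[OF that]] by (rule tendsto_norm)
        show "\<forall>\<^sub>F n in sequentially. norm (\<Sum>i<n. a i) \<le> vnorm l1_space a"
          using l1_partial_le[OF that] norm_sum order.trans by (intro always_eventually allI) blast
      qed simp
    qed
    moreover have "(\<Sum>i. unit_seq n i) = (1::'k)" for n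
      using sums_single[of n "\<lambda>i. 1::'k"] unfolding unit_seq_def sums_iff by simp
    ultimately have "((\<lambda>n::nat. 1::'k) \<longlongrightarrow> 0) uf" by (simp add: a0)
    then show False using tendsto_unique[OF uf_nontrivial _ tendsto_const] by fastforce
  qed
  then show ?thesis using F.banach_space_axioms by blast
qed

section \<open>Polynomials on spaces without copies of \<open>\<ell>\<^sub>1\<close>\<close>

lemma polynomials_maps_to: "P \<in> polynomials k E F \<Longrightarrow> normed_space E \<Longrightarrow> normed_space F
    \<Longrightarrow> x \<in> vcarrier E \<Longrightarrow> P x \<in> vcarrier F"
proof -
  assume P: "P \<in> polynomials k E F" and E: "normed_space E" and F: "normed_space F" and x: "x \<in> vcarrier E"
  have "continuous_map (norm_topology E) (norm_topology F) P" using P unfolding polynomials_def by blast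
  then have "P ` vcarrier E \<subseteq> vcarrier F"
    using continuous_map_image_subset_topspace normed_space.topspace_norm_topology[OF E]
      normed_space.topspace_norm_topology[OF F] by metis
  then show ?thesis using x by blast
qed

lemma P_cc_subset_P_wcc:
  assumes E: "normed_space E" and F: "normed_space F"
  shows "P_cc k E F \<subseteq> P_wcc k E F"
proof
  interpret F: normed_space F by fact
  fix P assume P: "P \<in> P_cc k E F"
  then have Pp: "P \<in> polynomials k E F" unfolding P_cc_def by blast
  have "\<exists>l. limitin (weak_topology F) (P \<circ> s) l sequentially" if s: "weakly_Cauchy E s" for s
  proof -
    have "s n \<in> vcarrier E" for n using s unfolding weakly_Cauchy_def by auto
    then have Ps: "(P \<circ> s) n \<in> vcarrier F" for n using polynomials_maps_to[OF Pp E F] by simp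
    obtain l where "limitin (norm_topology F) (P \<circ> s) l sequentially" using P s unfolding P_cc_def by blast
    then have l: "l \<in> vcarrier F" "(\<lambda>n. vnorm F (vsub F ((P \<circ> s) n) l)) \<longlonglongrightarrow> 0"
      using F.limitin_norm[of "P \<circ> s" l] Ps by blast+
    have "(\<lambda>n. f ((P \<circ> s) n)) \<longlonglongrightarrow> f l" if f: "f \<in> vcarrier (dual_space F)" for f
    proof -
      have "(\<lambda>n. vnorm (dual_space F) f * vnorm F (vsub F ((P \<circ> s) n) l)) \<longlonglongrightarrow> vnorm (dual_space F) f * 0"
        by (intro tendsto_mult tendsto_const l)
      then have lim: "(\<lambda>n. vnorm (dual_space F) f * vnorm F (vsub F ((P \<circ> s) n) l)) \<longlonglongrightarrow> 0" by simp
      have "norm (f ((P \<circ> s) n) - f l) \<le> vnorm (dual_space F) f * vnorm F (vsub F ((P \<circ> s) n) l)" for n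
        using F.dual_bound[OF f F.add_closed[OF Ps[of n] F.scale_closed[OF l(1), of "-1"]]]
          F.dual_vsub[OF f Ps[of n] l(1)] by simp
      then have "(\<lambda>n. f ((P \<circ> s) n) - f l) \<longlonglongrightarrow> 0"
        by (intro Lim_null_comparison[OF always_eventually lim] allI)
      then show ?thesis by (simp add: LIM_zero_iff)
    qed
    then show ?thesis using F.limitin_weak[of "P \<circ> s" l] Ps l(1) by blast
  qed
  then show "P \<in> P_wcc k E F" using Pp unfolding P_wcc_def by blast
qed

theorem P_wcc_subset_P_wco:
  fixes E :: "('k::real_or_complex, 'a) nspace" and F :: "('k, 'b) nspace"
  assumes E: "banach_space E" and F: "banach_space F" and no: "\<not> contains_copy_of_l1 E"
  shows "P_wcc k E F \<subseteq> P_wco k E F"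
proof
  interpret E: banach_space E by fact
  interpret F: banach_space F by fact
  fix P assume P: "P \<in> P_wcc k E F"
  then have Pp: "P \<in> polynomials k E F" unfolding P_wcc_def by blast
  have "relatively_weakly_compact F (P ` B)" if B: "norm_bounded E B" for B
  proof (rule F.Eberlein)
    obtain K where BE: "B \<subseteq> vcarrier E" and K: "\<And>x. x \<in> B \<Longrightarrow> vnorm E x \<le> K"
      using B unfolding norm_bounded_def by blast
    show "P ` B \<subseteq> vcarrier F"
      using polynomials_maps_to[OF Pp E.normed_space_axioms F.normed_space_axioms] BE by blast
    fix a :: "nat \<Rightarrow> 'b" assume "\<And>n. a n \<in> P ` B"
    then have "\<forall>n. \<exists>b\<in>B. a n = P b" by blast
    then obtain b where b: "\<And>n. b n \<in> B" "\<And>n. a n = P (b n)" by metis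
    have bE: "b n \<in> vcarrier E" "vnorm E (b n) \<le> K" for n using b(1) BE K by blast+
    obtain r where r: "strict_mono r" "weakly_Cauchy E (b \<circ> r)"
      using E.Rosenthal[of b K, OF bE no] by blast
    then obtain l where "limitin (weak_topology F) (P \<circ> (b \<circ> r)) l sequentially"
      using P unfolding P_wcc_def by blast
    moreover have "P \<circ> (b \<circ> r) = a \<circ> r" by (auto simp: b(2))
    ultimately show "\<exists>r x. strict_mono (r :: nat \<Rightarrow> nat) \<and> limitin (weak_topology F) (a \<circ> r) x sequentially"
      using r(1) by metis
  qed
  then show "P \<in> P_wco k E F" using Pp unfolding P_wco_def by blast
qed

section \<open>Polynomials on spaces with copies of \<open>\<ell>\<^sub>1\<close>\<close>

lemma power_diff_bound:
  fixes a b :: "'k::real_normed_field"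
  assumes "norm a \<le> R" "norm b \<le> R"
  shows "norm (a ^ (m + 2) - b ^ (m + 2)) \<le> real (m + 2) * R ^ m * (norm (a - b) * (norm a + norm b))"
proof (induction m)
  case 0
  have "a ^ 2 - b ^ 2 = (a - b) * (a + b)" by (simp add: power2_eq_square algebra_simps)
  then have "norm (a ^ 2 - b ^ 2) \<le> norm (a - b) * (norm a + norm b)"
    by (simp add: norm_mult norm_triangle_ineq mult_left_mono)
  also have "\<dots> \<le> 2 * (norm (a - b) * (norm a + norm b))" by simp
  finally show ?case by (simp add: numeral_2_eq_2)
next
  case (Suc m)
  have R: "0 \<le> R" using assms(1) norm_ge_zero order.trans by blast
  define D where "D = norm (a - b) * (norm a + norm b)"
  have "a ^ (Suc m + 2) - b ^ (Suc m + 2) = a * (a ^ (m + 2) - b ^ (m + 2)) + (a - b) * b ^ (m + 2)"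
    by (simp add: algebra_simps)
  then have "norm (a ^ (Suc m + 2) - b ^ (Suc m + 2))
      \<le> norm a * norm (a ^ (m + 2) - b ^ (m + 2)) + norm (a - b) * norm b ^ (m + 2)"
    using norm_triangle_ineq[of "a * (a ^ (m + 2) - b ^ (m + 2))" "(a - b) * b ^ (m + 2)"]
    by (simp only: norm_mult norm_power)
  also have "norm a * norm (a ^ (m + 2) - b ^ (m + 2)) \<le> R * (real (m + 2) * R ^ m * D)"
    using Suc assms(1) R unfolding D_def by (intro mult_mono) auto
  also have "norm (a - b) * norm b ^ (m + 2) \<le> R ^ Suc m * D"
  proof -
    have "norm b ^ (m + 2) = norm b ^ Suc m * norm b" by simp
    also have "\<dots> \<le> R ^ Suc m * (norm a + norm b)"
      using assms R by (intro mult_mono power_mono) auto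
    finally have "norm (a - b) * norm b ^ (m + 2) \<le> norm (a - b) * (R ^ Suc m * (norm a + norm b))"
      by (rule mult_left_mono) simp
    then show ?thesis by (simp add: D_def mult.left_commute)
  qed
  finally show ?case by (simp add: D_def algebra_simps)
qed

lemma l2_coord_le:
  fixes w :: "nat \<Rightarrow> 'k::real_normed_field"
  assumes w: "\<And>L. (\<Sum>n<L. (norm (w n))\<^sup>2) \<le> R\<^sup>2" and R: "0 \<le> R"
  shows "norm (w n) \<le> R"
proof -
  have "(norm (w n))\<^sup>2 \<le> (\<Sum>n<Suc n. (norm (w n))\<^sup>2)" by (rule member_le_sum) auto
  then have "(norm (w n))\<^sup>2 \<le> R\<^sup>2" using w[of "Suc n"] by linarith
  then show ?thesis using R by (rule power2_le_imp_le)
qed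

text \<open>Taking powers of degree at least two, whence the form \<open>m + 2\<close>, is Lipschitz on bounded sets from \<open>\<ell>\<^sub>2\<close> to
\<open>\<ell>\<^sub>1\<close>: one factor of the power is paired with the difference by the Cauchy-Schwarz inequality, the others
are bounded by \<open>R\<close>.\<close>

lemma sum_power_diff_bound:
  fixes u v :: "nat \<Rightarrow> 'k::real_normed_field"
  assumes R: "0 \<le> R" and \<eta>: "0 \<le> \<eta>"
    and u: "\<And>L. (\<Sum>n<L. (norm (u n))\<^sup>2) \<le> R\<^sup>2" and v: "\<And>L. (\<Sum>n<L. (norm (v n))\<^sup>2) \<le> R\<^sup>2"
    and d: "\<And>L. (\<Sum>n<L. (norm (u n - v n))\<^sup>2) \<le> \<eta>\<^sup>2"
  shows "(\<Sum>n<L. norm (u n ^ (m + 2) - v n ^ (m + 2))) \<le> real (m + 2) * R ^ m * (2 * R * \<eta>)"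
proof -
  define S where "S = (\<Sum>n<L. norm (u n - v n) * (norm (u n) + norm (v n)))"
  have "S\<^sup>2 \<le> (\<Sum>n<L. (norm (u n - v n))\<^sup>2) * (\<Sum>n<L. (norm (u n) + norm (v n))\<^sup>2)"
    unfolding S_def by (rule Cauchy_Schwarz_ineq_sum)
  also have "\<dots> \<le> \<eta>\<^sup>2 * (2 * R)\<^sup>2"
  proof (intro mult_mono d)
    have "(norm (u n) + norm (v n))\<^sup>2 \<le> 2 * (norm (u n))\<^sup>2 + 2 * (norm (v n))\<^sup>2" for n
      using sum_squares_bound[of "norm (u n)" "norm (v n)"] by (simp add: power2_sum)
    then have "(\<Sum>n<L. (norm (u n) + norm (v n))\<^sup>2) \<le> (\<Sum>n<L. 2 * (norm (u n))\<^sup>2 + 2 * (norm (v n))\<^sup>2)"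
      by (intro sum_mono)
    also have "\<dots> = 2 * (\<Sum>n<L. (norm (u n))\<^sup>2) + 2 * (\<Sum>n<L. (norm (v n))\<^sup>2)"
      by (simp add: sum.distrib sum_distrib_left)
    also have "\<dots> \<le> (2 * R)\<^sup>2" using u[of L] v[of L] by (simp add: power_mult_distrib)
    finally show "(\<Sum>n<L. (norm (u n) + norm (v n))\<^sup>2) \<le> (2 * R)\<^sup>2" .
  qed (auto intro: sum_nonneg)
  also have "\<dots> = (2 * R * \<eta>)\<^sup>2" by (simp add: power_mult_distrib)
  finally have S: "S \<le> 2 * R * \<eta>" by (rule power2_le_imp_le) (use R \<eta> in simp)
  have "(\<Sum>n<L. norm (u n ^ (m + 2) - v n ^ (m + 2)))
      \<le> (\<Sum>n<L. real (m + 2) * R ^ m * (norm (u n - v n) * (norm (u n) + norm (v n))))"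
    by (intro sum_mono power_diff_bound l2_coord_le R u v)
  also have "\<dots> = real (m + 2) * R ^ m * S" by (simp add: S_def sum_distrib_left)
  also have "\<dots> \<le> real (m + 2) * R ^ m * (2 * R * \<eta>)" using S R by (intro mult_left_mono) auto
  finally show ?thesis .
qed

lemma sum_prod_bound:
  fixes u :: "nat \<Rightarrow> nat \<Rightarrow> 'k::real_normed_field"
  assumes k: "2 \<le> k" and R: "0 \<le> R"
    and u: "\<And>i L. i < k \<Longrightarrow> (\<Sum>n<L. (norm (u i n))\<^sup>2) \<le> R\<^sup>2"
  shows "(\<Sum>n<L. norm (\<Prod>i<k. u i n)) \<le> R ^ (k - 2) * (2 * R\<^sup>2)"
proof -
  have coord: "norm (u i n) \<le> R" if "i < k" for i n
    by (rule l2_coord_le[OF u[OF that] R])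
  have pt: "norm (\<Prod>i<k. u i n) \<le> R ^ (k - 2) * ((norm (u 0 n))\<^sup>2 + (norm (u 1 n))\<^sup>2)" for n
  proof -
    have "{..<k} = insert 0 (insert 1 {2..<k})" using k by auto
    then have "norm (\<Prod>i<k. u i n) = norm (u 0 n) * (norm (u 1 n) * (\<Prod>i\<in>{2..<k}. norm (u i n)))"
      by (simp add: norm_mult prod_norm)
    also have "\<dots> = (\<Prod>i\<in>{2..<k}. norm (u i n)) * (norm (u 0 n) * norm (u 1 n))" by simp
    also have "\<dots> \<le> (\<Prod>i\<in>{2..<k}. R) * ((norm (u 0 n))\<^sup>2 + (norm (u 1 n))\<^sup>2)"
    proof (intro mult_mono prod_mono)
      show "norm (u 0 n) * norm (u 1 n) \<le> (norm (u 0 n))\<^sup>2 + (norm (u 1 n))\<^sup>2"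
        using sum_squares_bound[of "norm (u 0 n)" "norm (u 1 n)"]
          mult_nonneg_nonneg[OF norm_ge_zero norm_ge_zero, of "u 0 n" "u 1 n"] by linarith
    qed (use coord R in \<open>auto intro: prod_nonneg\<close>)
    finally show ?thesis by simp
  qed
  have "(\<Sum>n<L. norm (\<Prod>i<k. u i n)) \<le> R ^ (k - 2) * ((\<Sum>n<L. (norm (u 0 n))\<^sup>2) + (\<Sum>n<L. (norm (u 1 n))\<^sup>2))"
    using sum_mono[of "{..<L}", OF pt] by (simp add: sum_distrib_left sum.distrib distrib_left)
  also have "\<dots> \<le> R ^ (k - 2) * (2 * R\<^sup>2)"
    using u[of 0 L] u[of 1 L] k R by (intro mult_left_mono) auto
  finally show ?thesis .
qed

text \<open>The polynomial is \<open>P z = \<Sum>\<^sub>n (\<phi>\<^sub>n z)\<^sup>k y\<^sub>n\<close>, with \<open>\<phi>\<^sub>n\<close> from the copy of \<open>\<ell>\<^sub>1\<close> with basis \<open>x\<^sub>n\<close>, and \<open>y\<^sub>n\<close> a bounded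
sequence without weak cluster points. The powers form a sequence in \<open>\<ell>\<^sub>1\<close> that depends continuously on
\<open>(\<phi>\<^sub>n z)\<^sub>n\<close> in \<open>\<ell>\<^sub>2\<close>, so \<open>P\<close> is continuous and inherits complete continuity from \<open>z \<mapsto> (\<phi>\<^sub>n z)\<^sub>n\<close>. But \<open>P\<close> maps
the bounded sequence \<open>x\<^sub>n\<close> to \<open>y\<^sub>n\<close>.\<close>

theorem P_cc_not_subset_P_wco:
  fixes E :: "('k::real_or_complex, 'a) nspace" and F :: "('k, 'b) nspace"
  assumes E: "normed_space E" and F: "banach_space F" and copy: "contains_copy_of_l1 E"
    and nr: "\<not> reflexive F" and k: "1 < k"
  shows "\<not> P_cc k E F \<subseteq> P_wco k E F"
proof -
  interpret E: normed_space E by fact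
  interpret F: banach_space F by fact
  obtain x :: "nat \<Rightarrow> 'a" and K :: real and \<phi> :: "nat \<Rightarrow> 'a \<Rightarrow> 'k" and C :: real
    where x: "\<And>n. x n \<in> vcarrier E" "\<And>n. vnorm E (x n) \<le> K"
    and \<phi>: "\<And>n. \<phi> n \<in> vcarrier (dual_space E)" and \<phi>x: "\<And>n m. \<phi> n (x m) = (if n = m then 1 else 0)"
    and C: "0 \<le> C" and \<phi>2: "\<And>z L. z \<in> vcarrier E \<Longrightarrow> (\<Sum>n<L. (norm (\<phi> n z))\<^sup>2) \<le> (C * vnorm E z)\<^sup>2"
    and \<phi>cc: "\<And>s e. weakly_Cauchy E s \<Longrightarrow> 0 < e \<Longrightarrow>
      \<exists>N. \<forall>m\<ge>N. \<forall>l\<ge>N. \<forall>L. (\<Sum>n<L. (norm (\<phi> n (s m) - \<phi> n (s l)))\<^sup>2) \<le> e"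
    by (rule E.l1_copy_operator[OF copy]) (rule that)
  obtain y :: "nat \<Rightarrow> 'b" and Ky where y: "\<And>n. y n \<in> vcarrier F" "\<And>n. vnorm F (y n) \<le> Ky" and ycl: "\<And>z. \<not> weak_cluster F y z"
    using F.nonreflexive_sequence[OF nr] by blast
  have Ky: "0 \<le> Ky" using order.trans[OF F.norm_nonneg[OF y(1)[of 0]] y(2)[of 0]] .
  define S where "S = synth F y"
  have S_lin: "linear_between l1_space F S" unfolding S_def by (rule F.synth_linear[OF y])
  have S_bd: "vnorm F (S a) \<le> Ky * vnorm l1_space a" if "a \<in> vcarrier l1_space" for a
    unfolding S_def by (rule F.synth_bound[OF y that])
  note S = linear_betweenD[OF S_lin]
  interpret L: normed_space "l1_space :: ('k, nat \<Rightarrow> 'k) nspace" by (rule normed_space_l1)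
  have l1prod: "(\<lambda>n. \<Prod>i<k. \<phi> n (w i)) \<in> vcarrier l1_space" if w: "\<And>i. i < k \<Longrightarrow> w i \<in> vcarrier E" for w
  proof -
    define R where "R = (\<Sum>i<k. C * vnorm E (w i))"
    have R: "0 \<le> R" unfolding R_def using C w E.norm_nonneg by (intro sum_nonneg mult_nonneg_nonneg) auto
    have wR: "C * vnorm E (w i) \<le> R" if "i < k" for i
      unfolding R_def by (rule member_le_sum) (use that C w E.norm_nonneg in auto)
    show ?thesis
    proof (rule l1_boundedI(1))
      show "(\<Sum>n<L. norm (\<Prod>i<k. \<phi> n (w i))) \<le> R ^ (k - 2) * (2 * R\<^sup>2)" for L
      proof (rule sum_prod_bound)
        show "(\<Sum>n<L. (norm (\<phi> n (w i)))\<^sup>2) \<le> R\<^sup>2" if "i < k" for i L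
          by (rule order.trans[OF \<phi>2[OF w[OF that]] power_mono[OF wR[OF that]]])
             (use C w[OF that] E.norm_nonneg in auto)
      qed (use k R in auto)
    qed
  qed
  define A where "A w = S (\<lambda>n. \<Prod>i<k. \<phi> n (w i))" for w
  define P where "P = (\<lambda>z\<in>vcarrier E. S (\<lambda>n. \<phi> n z ^ k))"
  have l1pow: "(\<lambda>n. \<phi> n z ^ k) \<in> vcarrier l1_space" if "z \<in> vcarrier E" for z
    using l1prod[of "\<lambda>_. z"] that by simp
  have PF: "P z \<in> vcarrier F" if "z \<in> vcarrier E" for z using S(1)[OF l1pow[OF that]] that by (simp add: P_def)
  have A_mult: "multilinear_map k E F A"
    unfolding multilinear_map_def
  proof (intro ballI allI impI)
    fix w i assume w: "w \<in> {..<k} \<rightarrow>\<^sub>E vcarrier E" and i: "i < k"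
    define c where "c n = (\<Prod>j\<in>{..<k} - {i}. \<phi> n (w j))" for n
    have split: "(\<Prod>j<k. \<phi> n ((w(i := u)) j)) = \<phi> n u * c n" for n u
    proof -
      have "(\<Prod>j<k. \<phi> n ((w(i := u)) j)) = \<phi> n u * (\<Prod>j\<in>{..<k} - {i}. \<phi> n ((w(i := u)) j))"
        using i by (subst prod.remove[of _ i]) auto
      also have "(\<Prod>j\<in>{..<k} - {i}. \<phi> n ((w(i := u)) j)) = c n"
        unfolding c_def by (intro prod.cong) auto
      finally show ?thesis .
    qed
    have l1: "(\<lambda>n. \<phi> n u * c n) \<in> vcarrier l1_space" if "u \<in> vcarrier E" for u
    proof -
      have "(w(i := u)) j \<in> vcarrier E" if "j < k" for j using w that \<open>u \<in> _\<close> by (auto simp: PiE_iff)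
      then show ?thesis using l1prod[of "w(i := u)"] unfolding split by blast
    qed
    show "linear_between E F (\<lambda>u. A (w(i := u)))"
      unfolding linear_between_def A_def split
    proof (intro conjI ballI allI)
      show "S (\<lambda>n. \<phi> n u * c n) \<in> vcarrier F" if "u \<in> vcarrier E" for u using S(1) l1 that by blast
      show "S (\<lambda>n. \<phi> n (vadd E u v) * c n) = vadd F (S (\<lambda>n. \<phi> n u * c n)) (S (\<lambda>n. \<phi> n v * c n))"
        if "u \<in> vcarrier E" "v \<in> vcarrier E" for u v
        using S(2)[OF l1[OF that(1)] l1[OF that(2)]]
        by (simp add: l1_simps(2) E.dual_add[OF \<phi> that] distrib_right)
      show "S (\<lambda>n. \<phi> n (vscale E d u) * c n) = vscale F d (S (\<lambda>n. \<phi> n u * c n))"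
        if "u \<in> vcarrier E" for d u
        using S(3)[OF l1[OF that], of d] by (simp add: l1_simps(4) E.dual_scale[OF \<phi> that] mult.assoc)
    qed
  qed
  obtain m where m: "k = m + 2" using k by (metis add.commute le_Suc_ex less_eq_Suc_le numeral_2_eq_2 One_nat_def)
  define \<Lambda> where "\<Lambda> R = Ky * (real k * R ^ m * (2 * R))" for R
  have \<Lambda>0: "0 \<le> \<Lambda> R" if "0 \<le> R" for R using Ky that by (simp add: \<Lambda>_def)
  have Pdiff: "vnorm F (vsub F (P z) (P w)) \<le> \<Lambda> R * \<eta>"
    if z: "z \<in> vcarrier E" "C * vnorm E z \<le> R" and w: "w \<in> vcarrier E" "C * vnorm E w \<le> R" and \<eta>: "0 \<le> \<eta>"
      and d: "\<And>L. (\<Sum>n<L. (norm (\<phi> n z - \<phi> n w))\<^sup>2) \<le> \<eta>\<^sup>2" for z w R \<eta>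
  proof -
    have R: "0 \<le> R" using C E.norm_nonneg[OF z(1)] z(2) by (meson mult_nonneg_nonneg order.trans)
    define a where "a = vsub l1_space (\<lambda>n. \<phi> n z ^ k) (\<lambda>n. \<phi> n w ^ k)"
    have a: "a \<in> vcarrier l1_space" unfolding a_def by (intro L.closed l1pow z w)
    have "S a = vsub F (P z) (P w)"
      unfolding a_def P_def using z w l1pow by (simp add: S L.closed)
    moreover have "vnorm l1_space a \<le> real (m + 2) * R ^ m * (2 * R * \<eta>)"
    proof (rule l1_boundedI(2))
      fix L
      have sq: "(\<Sum>n<L. (norm (\<phi> n q))\<^sup>2) \<le> R\<^sup>2" if "q \<in> vcarrier E" "C * vnorm E q \<le> R" for q L
        by (rule order.trans[OF \<phi>2[OF that(1)] power_mono[OF that(2)]]) (use C E.norm_nonneg[OF that(1)] in simp)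
      have "(\<Sum>i<L. norm (\<phi> i z ^ (m + 2) - \<phi> i w ^ (m + 2))) \<le> real (m + 2) * R ^ m * (2 * R * \<eta>)"
        by (rule sum_power_diff_bound[OF R \<eta> sq[OF z] sq[OF w] d])
      then show "(\<Sum>i<L. norm (a i)) \<le> real (m + 2) * R ^ m * (2 * R * \<eta>)"
        by (simp add: a_def l1_simps(2,4) m)
    qed
    then have "Ky * vnorm l1_space a \<le> \<Lambda> R * \<eta>"
      using mult_left_mono[OF _ Ky] by (fastforce simp: \<Lambda>_def m mult.assoc)
    ultimately show ?thesis using S_bd[OF a] by simp
  qed
  have cont: "continuous_map (norm_topology E) (norm_topology F) P"
    unfolding E.continuous_map_norm[OF F.normed_space_axioms]
  proof (intro conjI ballI allI impI)
    show "P ` vcarrier E \<subseteq> vcarrier F" using PF by blast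
    fix a and e :: real assume a: "a \<in> vcarrier E" and e: "0 < e"
    define R where "R = C * (vnorm E a + 1)"
    have R: "0 \<le> R" using C E.norm_nonneg[OF a] by (simp add: R_def)
    define d where "d = min 1 (e / (\<Lambda> R * C + 1))"
    have LC: "0 \<le> \<Lambda> R * C" using \<Lambda>0[OF R] C by simp
    show "\<exists>d>0. \<forall>z\<in>vcarrier E. vnorm E (vsub E a z) < d \<longrightarrow> vnorm F (vsub F (P a) (P z)) < e"
    proof (intro exI[of _ d] conjI ballI impI)
      show "0 < d" using e LC by (simp add: d_def)
      fix z assume z: "z \<in> vcarrier E" and az: "vnorm E (vsub E a z) < d"
      have azE: "vsub E a z \<in> vcarrier E" using a z by (simp add: E.closed)
      have "z = vadd E a (vscale E (-1) (vsub E a z))"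
      proof (rule E.dual_separates)
        show "f z = f (vadd E a (vscale E (-1) (vsub E a z)))" if "f \<in> vcarrier (dual_space E)" for f
          using that a z by (simp add: E.dual_add E.dual_scale E.closed)
      qed (use a z in \<open>auto simp: E.closed\<close>)
      then have "vnorm E z \<le> vnorm E a + vnorm E (vsub E a z)"
        using E.norm_triangle[OF a E.scale_closed[OF azE, of "-1"]] E.norm_scale[OF azE, of "-1"] by simp
      then have "vnorm E z \<le> vnorm E a + 1" using az by (simp add: d_def)
      then have zR: "C * vnorm E z \<le> R" unfolding R_def by (rule mult_left_mono[OF _ C])
      have aR: "C * vnorm E a \<le> R" unfolding R_def by (rule mult_left_mono[OF _ C]) simp
      have "vnorm F (vsub F (P a) (P z)) \<le> \<Lambda> R * (C * vnorm E (vsub E a z))"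
      proof (rule Pdiff[OF a aR z zR])
        show "0 \<le> C * vnorm E (vsub E a z)" using C E.norm_nonneg[OF azE] by simp
        show "(\<Sum>n<L. (norm (\<phi> n a - \<phi> n z))\<^sup>2) \<le> (C * vnorm E (vsub E a z))\<^sup>2" for L
          using \<phi>2[OF azE, of L] by (simp add: E.dual_vsub[OF \<phi> a z])
      qed
      also have "\<dots> \<le> (\<Lambda> R * C + 1) * vnorm E (vsub E a z)"
        using E.norm_nonneg[OF azE] by (simp add: algebra_simps)
      also have "\<dots> < e" using az LC by (simp add: d_def field_simps)
      finally show "vnorm F (vsub F (P a) (P z)) < e" .
    qed
  qed
  have Pp: "P \<in> polynomials k E F"
    unfolding polynomials_def
  proof (intro CollectI conjI exI[of _ A])
    show "\<forall>z\<in>vcarrier E. P z = A (\<lambda>i\<in>{..<k}. z)"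
    proof
      fix z assume z: "z \<in> vcarrier E"
      have "(\<Prod>i<k. \<phi> n ((\<lambda>i\<in>{..<k}. z) i)) = \<phi> n z ^ k" for n by simp
      then show "P z = A (\<lambda>i\<in>{..<k}. z)" using z by (simp add: P_def A_def)
    qed
  qed (use cont A_mult in \<open>auto simp: P_def\<close>)
  have "P \<in> P_cc k E F"
    unfolding P_cc_def
  proof (intro CollectI conjI allI impI Pp)
    fix s assume s: "weakly_Cauchy E s"
    have sE: "s n \<in> vcarrier E" for n using s unfolding weakly_Cauchy_def by auto
    obtain M where M: "\<And>n. vnorm E (s n) \<le> M" using E.weakly_Cauchy_bounded[OF s] by blast
    define R where "R = C * M"
    have sR: "C * vnorm E (s n) \<le> R" for n unfolding R_def by (rule mult_left_mono[OF M C])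
    have R: "0 \<le> R" using sR[of 0] C E.norm_nonneg[OF sE[of 0]] by (meson mult_nonneg_nonneg order.trans)
    obtain l where "l \<in> vcarrier F" "(\<lambda>n. vnorm F (vsub F (P (s n)) l)) \<longlonglongrightarrow> 0"
    proof (rule F.Cauchy_converges[of "\<lambda>n. P (s n)"])
      fix e :: real assume e: "0 < e"
      define \<eta> where "\<eta> = e / (\<Lambda> R + 1)"
      have \<eta>: "0 < \<eta>" using e \<Lambda>0[OF R] by (simp add: \<eta>_def)
      obtain N where N: "\<And>i j L. N \<le> i \<Longrightarrow> N \<le> j \<Longrightarrow> (\<Sum>n<L. (norm (\<phi> n (s i) - \<phi> n (s j)))\<^sup>2) \<le> \<eta>\<^sup>2"
        using \<phi>cc[OF s, of "\<eta>\<^sup>2"] \<eta> by auto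
      have "vnorm F (vsub F (P (s i)) (P (s j))) < e" if "N \<le> i" "N \<le> j" for i j
      proof -
        have "vnorm F (vsub F (P (s i)) (P (s j))) \<le> \<Lambda> R * \<eta>"
          by (rule Pdiff[OF sE sR sE sR _ N[OF that]]) (use \<eta> in simp)
        also have "\<dots> < (\<Lambda> R + 1) * \<eta>" using \<eta> by simp
        also have "\<dots> = e" using \<Lambda>0[OF R] by (simp add: \<eta>_def)
        finally show ?thesis .
      qed
      then show "\<exists>N. \<forall>m\<ge>N. \<forall>n\<ge>N. vnorm F (vsub F (P (s m)) (P (s n))) < e" by blast
    qed (use PF sE in auto)
    then show "\<exists>l. limitin (norm_topology F) (P \<circ> s) l sequentially"
      using F.limitin_norm[of "P \<circ> s" l] PF sE by (auto simp: o_def)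
  qed
  moreover have "P \<notin> P_wco k E F"
  proof
    assume "P \<in> P_wco k E F"
    moreover have "norm_bounded E (range x)" unfolding norm_bounded_def using x by auto
    ultimately have "relatively_weakly_compact F (P ` range x)" unfolding P_wco_def by blast
    moreover have "y n \<in> P ` range x" for n
    proof -
      have "(\<lambda>i. \<phi> i (x n) ^ k) = unit_seq n" using k by (auto simp: \<phi>x unit_seq_def)
      then have "P (x n) = y n" using x(1) F.synth_unit[OF y] by (simp add: P_def S_def)
      then show ?thesis by (metis image_eqI rangeI)
    qed
    ultimately show False using F.relatively_weakly_compact_cluster ycl by blast
  qed
  ultimately show ?thesis by blast
qed

section \<open>Characterization of the spaces without copies of \<open>\<ell>\<^sub>1\<close>\<close>

theorem proposition14:
  fixes E :: "('k::real_or_complex, 'a) nspace"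
  assumes "banach_space E"
    and "\<exists>\<iota> :: (nat \<Rightarrow> 'k) \<Rightarrow> 'b. inj \<iota>"
  shows
    "(\<not> contains_copy_of_l1 E \<longleftrightarrow>
        (\<forall>k\<ge>1. \<forall>F :: ('k, 'b) nspace. banach_space F \<longrightarrow> P_wcc k E F \<subseteq> P_wco k E F)) \<and>
     (\<not> contains_copy_of_l1 E \<longleftrightarrow>
        (\<forall>k\<ge>1. \<forall>F :: ('k, 'b) nspace. banach_space F \<longrightarrow> P_cc k E F \<subseteq> P_wco k E F)) \<and>
     (\<not> contains_copy_of_l1 E \<longleftrightarrow>
        (\<exists>k>1. \<exists>F :: ('k, 'b) nspace. banach_space F \<and> \<not> reflexive F \<and> P_cc k E F \<subseteq> P_wco k E F))"
proof -
  have E: "normed_space E" using assms(1) by (rule banach_space.axioms)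
  have F: "normed_space F" if "banach_space F" for F :: "('k, 'b) nspace"
    using that by (rule banach_space.axioms)
  obtain F0 :: "('k, 'b) nspace" where F0: "banach_space F0" "\<not> reflexive F0"
    using ex_nonreflexive[OF assms(2)] by blast
  let ?a = "\<not> contains_copy_of_l1 E"
  let ?b = "\<forall>k\<ge>1. \<forall>F :: ('k, 'b) nspace. banach_space F \<longrightarrow> P_wcc k E F \<subseteq> P_wco k E F"
  let ?c = "\<forall>k\<ge>1. \<forall>F :: ('k, 'b) nspace. banach_space F \<longrightarrow> P_cc k E F \<subseteq> P_wco k E F"
  let ?d = "\<exists>k>1. \<exists>F :: ('k, 'b) nspace. banach_space F \<and> \<not> reflexive F \<and> P_cc k E F \<subseteq> P_wco k E F"
  have ab: "?b" if ?a using P_wcc_subset_P_wco[OF assms(1) _ that] by blast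
  have bc: "?c" if ?b
  proof (intro allI impI)
    fix k :: nat and F :: "('k, 'b) nspace" assume "1 \<le> k" "banach_space F"
    then show "P_cc k E F \<subseteq> P_wco k E F"
      using that P_cc_subset_P_wcc[OF E F] by (meson order.trans)
  qed
  have cd: "?d" if ?c
  proof (intro exI[of _ 2] exI[of _ F0] conjI F0)
    show "P_cc 2 E F0 \<subseteq> P_wco 2 E F0" using that F0(1) one_le_numeral by blast
  qed simp
  have da: "?a" if ?d
    using that P_cc_not_subset_P_wco[OF E] by blast
  show ?thesis using ab bc cd da by argo
qed

end
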